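(* In the setting described in the context, assume that $p=N_{J_p}$ for some $J_p\in\{1,\dots,d_\infty-1\}$ (equivalently, $\lambda_p^{(\infty)}>\lambda_{p+1}^{(\infty)}$), and that there exists $\varepsilon>0$ such that for all $s\in[1-\varepsilon,1+\varepsilon]$ $$\big\|\mathbb{E}_{s t_{n,k}}(\Theta\Theta^\top)-\Sigma_{n,k}\big\|_{op}=o(k^{-1/2})\qquad(n\to\infty).$$ Then $$k^{1/2}\big(\mathbf{\Pi}_{\hat V_{n,k}}-\mathbf{\Pi}_{V_{n,k}^*}\big)\to\sum_{j=1}^{J_p}\sum_{\ell=J_p+1}^{d_\infty}\frac1{\mu_\ell-\mu_j}\Big(\mathbf{\Pi}_{W_\ell^{(\infty)}}\mathbf{U}\,\mathbf{\Pi}_{W_j^{(\infty)}}+\mathbf{\Pi}_{W_j^{(\infty)}}\mathbf{U}\,\mathbf{\Pi}_{W_\ell^{(\infty)}}\Big)=:\mathbf{W}_p$$ weakly. The convergence holds jointly for all $p\in\{N_1,\dots,N_{d_\infty-1}\}$.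
   Context: Let $\|\cdot\|$ be the Euclidean norm on $\mathbb{R}^d$. The random vector $X\in\mathbb{R}^d$ is regularly varying: there is a non-degenerate measure $\mu$ on $\mathbb{R}^d\setminus\{0\}$ such that for all Borel $\mu$-continuity sets $B$ bounded away from $0$, $\lim_{t\to\infty}\mathbb{P}\{X/t\in B\}/\mathbb{P}\{\|X\|>t\}=\mu(B)<\infty$. (Then $\mu$ is homogeneous of order $-\alpha$ for some $\alpha>0$ and $\mu\{\|x\|>1\}=1$.) Let $X_1,X_2,\dots$ be i.i.d. copies of $X$. Scaling: $\omega:\mathbb{R}^d\to(0,\infty)$ is a measurable function such that $x\mapsto\omega(x)x$ is bounded (the standard choice being $\omega(x)=1/\|x\|$ for $x\neq0$). Put $R=\|X\|$, $\Theta=\omega(X)X$, $R_i=\|X_i\|$, $\Theta_i=\omega(X_i)X_i$. $\mathbb{E}_t$ denotes conditional expectation given $R>t$. $\mathbb{E}_\infty$ (and $\mathrm{Cov}_\infty$) denotes expectation (covariance) in the limit model, i.e. when $X$ is distributed according to the probability measure $\mu$ restricted to $\{\|x\|>1\}$. The conditional distribution of $\Theta$ given $R>t$ converges weakly, as $t\to\infty$, to the distribution of $\Theta$ in the limit model (automatic for $\omega(x)=1/\|x\|$). Here $k=k_n\in\{1,\dots,n-1\}$ is an intermediate sequence: $k\to\infty$ and $k/n\to0$ as $n\to\infty$. $t_{n,k}$ is the $(1-k/n)$-quantile of $R$, and $\hat t_{n,k}$ is the $(k+1)$-th largest order statistic of $R_1,\dots,R_n$. The distribution function of $R$ is continuous,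 so that almost surely exactly $k$ of the $R_i$ exceed $\hat t_{n,k}$. Define $$\hat\Sigma_{n,k}=\frac1k\sum_{i=1}^n\Theta_i\Theta_i^\top\mathbf{1}_{\{R_i>\hat t_{n,k}\}},\quad \Sigma_{n,k}=\mathbb{E}_{t_{n,k}}(\Theta\Theta^\top),\quad \Sigma_\infty=\mathbb{E}_\infty(\Theta\Theta^\top).$$ $\|A\|_{op}=\sup_{\|x\|=1}\|Ax\|$ is the operator norm; $\mathbf{\Pi}_V$ is the orthogonal projection matrix onto the subspace $V$. $\mathbf{U}=(U_{ij})_{1\le i,j\le d}$ is a symmetric centered Gaussian random matrix with $\mathrm{Cov}(U_{ij},U_{\ell m})=\mathrm{Cov}_\infty(\theta_i\theta_j,\theta_\ell\theta_m)$, where $\theta_1,\dots,\theta_d$ are the components of $\Theta$. Eigenstructure: $\lambda_1^{(\infty)}\ge\dots\ge\lambda_d^{(\infty)}$ are the eigenvalues of $\Sigma_\infty$, $\mu_1>\dots>\mu_{d_\infty}$ its distinct eigenvalues, and $0=N_0<N_1<\dots<N_{d_\infty}=d$ are such that $\lambda_m^{(\infty)}=\mu_j$ for $N_{j-1}<m\le N_j$. $W_j^{(\infty)}$ is the eigenspace of $\Sigma_\infty$ for $\mu_j$. Projections: $\mathcal{V}_p$ is the set of $p$-dimensional linear subspaces of $\mathbb{R}^d$. $V_{n,k}^*$ is the maximizer over $V\in\mathcal{V}_p$ of $M_{n,k}(\mathbf{\Pi}_V)=\mathbb{E}_{t_{n,k}}(\Theta^\top\mathbf{\Pi}_V\Theta)$;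 it is spanned by orthonormal eigenvectors of $\Sigma_{n,k}$ for its $p$ largest eigenvalues. $\hat V_{n,k}$ is the maximizer over $V\in\mathcal{V}_p$ of $\hat M_{n,k}(\mathbf{\Pi}_V)=\frac1k\sum_{i=1}^n\Theta_i^\top\mathbf{\Pi}_V\Theta_i\mathbf{1}_{\{R_i>\hat t_{n,k}\}}$; it is spanned by orthonormal eigenvectors of $\hat\Sigma_{n,k}$ for its $p$ largest eigenvalues. If $\lambda_p^{(\infty)}>\lambda_{p+1}^{(\infty)}$, then $V_{n,k}^*$ is unique for $n$ large and $\hat V_{n,k}$ is unique with probability tending to $1$ under the assumptions of the claim (otherwise any choice is allowed).
   Formalization: The bias condition is taken with the o(k^{-1/2}) term uniform in s∈[1-ε,1+ε]; with an o-term depending on s the claim fails, since the random threshold can fall in shrinking shells near t_{n,k} that every fixed s≠1 eventually avoids. *)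

theory Defs
  imports "HOL-Probability.Probability"
begin

text \<open>The library's weak convergence is restricted to distribution functions on the real line.\<close>

definition converges_weakly ::
    "('i \<Rightarrow> 'v::topological_space measure) \<Rightarrow> 'v measure \<Rightarrow> 'i filter \<Rightarrow> bool" where
  "converges_weakly P L F \<longleftrightarrow>
     (\<forall>f :: 'v \<Rightarrow> real. continuous_on UNIV f \<and> bounded (range f) \<longrightarrow>
        ((\<lambda>i. \<integral>x. f x \<partial>P i) \<longlongrightarrow> (\<integral>x. f x \<partial>L)) F)"

text \<open>
  A measure on \<open>\<real>\<^sup>d\<close> without the origin is encoded as a Borel measure that does not charge 0.
  Non-degenerate means nonzero. Finiteness away from 0 is required for all sets and not only
  for continuity sets: for the counting measure, say, there are hardly any continuity sets, and
  the limit relation would be void. The frontier of a set bounded away from 0 is the same in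
  \<open>\<real>\<^sup>d\<close> and in \<open>\<real>\<^sup>d\<close> without the origin.
\<close>

definition regularly_varying ::
    "'a measure \<Rightarrow> ('a \<Rightarrow> real ^ 'd) \<Rightarrow> (real ^ 'd) measure \<Rightarrow> bool" where
  "regularly_varying M X \<nu> \<longleftrightarrow>
     sets \<nu> = sets borel \<and> emeasure \<nu> {0} = 0 \<and> emeasure \<nu> UNIV \<noteq> 0 \<and>
     (\<forall>r>0. emeasure \<nu> {x. r \<le> norm x} < \<infinity>) \<and>
     (\<forall>B \<in> sets borel. (\<exists>r>0. \<forall>x\<in>B. r \<le> norm x) \<and> emeasure \<nu> (frontier B) = 0 \<longrightarrow>
        ((\<lambda>t. measure M {w \<in> space M. (1 / t) *\<^sub>R X w \<in> B} /
              measure M {w \<in> space M. t < norm (X w)}) \<longlongrightarrow> measure \<nu> B) at_top)"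

definition exceedance_law :: "'a measure \<Rightarrow> ('a \<Rightarrow> real ^ 'd) \<Rightarrow> real \<Rightarrow> (real ^ 'd) measure" where
  "exceedance_law M X t = distr (uniform_measure M {w \<in> space M. t < norm (X w)}) borel X"

text \<open>
  The law of \<open>X\<close> in the limit model, \<open>\<nu>\<close> restricted to the complement of the closed unit ball.
  No normalization is needed, since \<open>\<nu> {x. 1 < norm x} = 1\<close> under regular variation.
\<close>

definition limit_law :: "(real ^ 'd) measure \<Rightarrow> (real ^ 'd) measure" where
  "limit_law \<nu> = density \<nu> (indicator {x. 1 < norm x})"

definition scaled :: "(real ^ 'd \<Rightarrow> real) \<Rightarrow> real ^ 'd \<Rightarrow> real ^ 'd" where
  "scaled \<omega> x = \<omega> x *\<^sub>R x"

definition outer_square :: "real ^ 'd \<Rightarrow> real ^ 'd ^ 'd" where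
  "outer_square v = (\<chi> i j. v $ i * v $ j)"

definition second_moment :: "(real ^ 'd \<Rightarrow> real) \<Rightarrow> (real ^ 'd) measure \<Rightarrow> real ^ 'd ^ 'd" where
  "second_moment \<omega> L = (\<integral>x. outer_square (scaled \<omega> x) \<partial>L)"

definition covariance :: "'a measure \<Rightarrow> ('a \<Rightarrow> real) \<Rightarrow> ('a \<Rightarrow> real) \<Rightarrow> real" where
  "covariance M f g = (\<integral>w. (f w - (\<integral>v. f v \<partial>M)) * (g w - (\<integral>v. g v \<partial>M)) \<partial>M)"

definition quantile :: "'a measure \<Rightarrow> ('a \<Rightarrow> real) \<Rightarrow> real \<Rightarrow> real" where
  "quantile M R q = Inf {x. q \<le> cdf (distr M borel R) x}"

definition threshold :: "'a measure \<Rightarrow> ('a \<Rightarrow> real ^ 'd) \<Rightarrow> nat \<Rightarrow> nat \<Rightarrow> real" where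
  "threshold M X n k = quantile M (\<lambda>w. norm (X w)) (1 - real k / real n)"

text \<open>The \<open>(k + 1)\<close>-th largest of the norms of \<open>x 1, \<dots>, x n\<close> (list positions start at 0).\<close>

definition emp_threshold :: "(nat \<Rightarrow> real ^ 'd) \<Rightarrow> nat \<Rightarrow> nat \<Rightarrow> real" where
  "emp_threshold x n k = rev (sort (map (\<lambda>i. norm (x i)) [1..<Suc n])) ! k"

definition proj_mat :: "(real ^ 'd) set \<Rightarrow> real ^ 'd ^ 'd" where
  "proj_mat V = (THE P. \<forall>x. P *v x \<in> V \<and> (\<forall>v\<in>V. orthogonal (x - P *v x) v))"

lemma proj_mat_ex1:
  fixes V :: "(real ^ 'd) set"
  assumes V: "subspace V"
  shows "\<exists>!P :: real ^ 'd ^ 'd. \<forall>x. P *v x \<in> V \<and> (\<forall>v\<in>V. orthogonal (x - P *v x) v)"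
proof -
  have unique: "a = b"
    if "a \<in> V" "b \<in> V" "\<And>v. v \<in> V \<Longrightarrow> orthogonal (x - a) v"
       "\<And>v. v \<in> V \<Longrightarrow> orthogonal (x - b) v" for a b x :: "real ^ 'd"
  proof -
    have "a - b \<in> V" using that(1,2) V by (rule subspace_diff[rotated])
    then have "(x - b) \<bullet> (a - b) = 0" "(x - a) \<bullet> (a - b) = 0"
      using that(3,4) unfolding orthogonal_def by blast+
    then have "(a - b) \<bullet> (a - b) = 0" by (simp only: inner_diff_left)
    then show ?thesis by simp
  qed
  have "\<exists>y. y \<in> V \<and> (\<forall>v\<in>V. orthogonal (x - y) v)" for x
  proof -
    have sp: "span V = V" using V by (simp only: span_eq_iff)
    obtain y z where yz: "y \<in> span V" "\<And>w. w \<in> span V \<Longrightarrow> orthogonal z w" "x = y + z"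
      by (rule orthogonal_subspace_decomp_exists[of V x]) (rule that)
    then have "x - y = z" by simp
    with yz show ?thesis unfolding sp by (intro exI[of _ y]) simp
  qed
  then have "\<exists>g. \<forall>x. g x \<in> V \<and> (\<forall>v\<in>V. orthogonal (x - g x) v)" by (intro choice allI)
  then obtain g where g: "\<And>x. g x \<in> V" "\<And>x v. v \<in> V \<Longrightarrow> orthogonal (x - g x) v" by blast
  have add: "g (x + y) = g x + g y" for x y
  proof (rule unique[of _ _ "x + y"])
    show "orthogonal (x + y - (g x + g y)) v" if "v \<in> V" for v
      using g(2)[OF that, of x] g(2)[OF that, of y]
      by (simp add: orthogonal_def inner_diff_left inner_add_left)
  qed (simp_all add: g subspace_add[OF V])
  have scale: "g (c *\<^sub>R x) = c *\<^sub>R g x" for c x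
  proof (rule unique[of _ _ "c *\<^sub>R x"])
    show "orthogonal (c *\<^sub>R x - c *\<^sub>R g x) v" if "v \<in> V" for v
      using g(2)[OF that, of x] by (simp add: orthogonal_def inner_diff_left)
  qed (simp_all add: g subspace_scale[OF V])
  have "linear g" by (rule linearI) (rule add, rule scale)
  then have mg: "matrix g *v x = g x" for x by (simp add: matrix_works)
  show ?thesis
  proof (rule ex1I[of _ "matrix g"])
    show "\<forall>x. matrix g *v x \<in> V \<and> (\<forall>v\<in>V. orthogonal (x - matrix g *v x) v)"
      by (simp add: g mg)
  next
    fix P :: "real ^ 'd ^ 'd"
    assume P: "\<forall>x. P *v x \<in> V \<and> (\<forall>v\<in>V. orthogonal (x - P *v x) v)"
    have "P *v x = matrix g *v x" for x
      unfolding mg by (rule unique[of _ _ x]) (use P g in blast)+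
    then show "P = matrix g" by (subst matrix_eq) blast
  qed
qed

definition subspaces_of_dim :: "nat \<Rightarrow> (real ^ 'd) set set" where
  "subspaces_of_dim p = {V. subspace V \<and> dim V = p}"

definition proj_gain :: "(real ^ 'd \<Rightarrow> real) \<Rightarrow> (real ^ 'd) measure \<Rightarrow> (real ^ 'd) set \<Rightarrow> real" where
  "proj_gain \<omega> L V = (\<integral>x. scaled \<omega> x \<bullet> (proj_mat V *v scaled \<omega> x) \<partial>L)"

definition emp_gain ::
    "(real ^ 'd \<Rightarrow> real) \<Rightarrow> (nat \<Rightarrow> real ^ 'd) \<Rightarrow> nat \<Rightarrow> nat \<Rightarrow> (real ^ 'd) set \<Rightarrow> real" where
  "emp_gain \<omega> x n k V = 1 / real k *
     (\<Sum>i = 1..n. scaled \<omega> (x i) \<bullet> (proj_mat V *v scaled \<omega> (x i)) *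
        of_bool (emp_threshold x n k < norm (x i)))"

text \<open>The eigenvalues in decreasing order, repeated according to their multiplicity as roots of
  the characteristic polynomial, and indexed from 1.\<close>

definition ordered_eigenvalues :: "real ^ 'd ^ 'd \<Rightarrow> (nat \<Rightarrow> real) \<Rightarrow> bool" where
  "ordered_eigenvalues A lam \<longleftrightarrow> antimono_on {1..CARD('d)} lam \<and>
     (\<forall>x. det (mat x - A) = (\<Prod>m = 1..CARD('d). x - lam m))"

definition eigenspace :: "real ^ 'd ^ 'd \<Rightarrow> real \<Rightarrow> (real ^ 'd) set" where
  "eigenspace A c = {v. A *v v = c *\<^sub>R v}"

text \<open>Degenerate normal laws are included.\<close>

definition gaussian :: "'a measure \<Rightarrow> ('a \<Rightarrow> 'v::euclidean_space) \<Rightarrow> bool" where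
  "gaussian M Y \<longleftrightarrow> Y \<in> borel_measurable M \<and>
     (\<forall>a. \<exists>m s. (s = 0 \<and> (AE w in M. a \<bullet> Y w = m)) \<or>
               (s > 0 \<and> distributed M lborel (\<lambda>w. a \<bullet> Y w) (normal_density m s)))"

text \<open>The limit variable, as a function of the value \<open>u\<close> of the Gaussian matrix, for the
  eigenvalues \<open>mu 1 > \<dots> > mu r\<close> of \<open>A\<close> and a projection onto the first \<open>J\<close> eigenspaces.\<close>

definition limit_map ::
    "real ^ 'd ^ 'd \<Rightarrow> (nat \<Rightarrow> real) \<Rightarrow> nat \<Rightarrow> nat \<Rightarrow> real ^ 'd ^ 'd \<Rightarrow> real ^ 'd ^ 'd" where
  "limit_map A mu r J u =
     (let P = (\<lambda>j. proj_mat (eigenspace A (mu j))) in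
      \<Sum>j = 1..J. \<Sum>l = Suc J..r.
        (1 / (mu l - mu j)) *\<^sub>R (P l ** u ** P j + P j ** u ** P l))"

end

theory Submission
  imports Defs
begin

text \<open>
  Conditionally on the \<open>(k + 1)\<close>-th largest norm being \<open>u\<close>, the \<open>k\<close> exceedances are i.i.d. with the
  law of \<open>X\<close> given \<open>R > u\<close>. Hence the characteristic function of \<open>a \<bullet> Z\<close>, where \<open>Z\<close> is the rescaled
  error of the empirical second moment matrix, is the mean of the \<open>k\<close>-th power of a characteristic
  function under that law, at the random level \<open>u\<close>. By regular variation \<open>u\<close> is close to the quantile
  of \<open>R\<close>, where the bias condition makes a second-order Taylor expansion uniform; this gives \<open>Z \<rightarrow> U\<close>.

  For the projections, let \<open>D\<close> be the rescaled difference of the projections \<open>P'\<close> and \<open>P\<close> that are optimal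
  for \<open>A + Z / \<kappa>\<close> and \<open>A\<close>. As optimal projections commute with their matrices, \<open>A D - D A = P' Z - Z P'\<close>
  and \<open>P' D + D P = D\<close>. In the limit these two linear equations determine \<open>D\<close>. The solution is
  \<open>- limit_map Z\<close>, with coefficients \<open>1 / (\<mu>\<^sub>j - \<mu>\<^sub>l)\<close>; the sign is immaterial since \<open>-U\<close> and \<open>U\<close> have
  the same law.
\<close>

section \<open>Weak convergence in Euclidean space\<close>

text \<open>All summands of the empirical matrix depend on the same random level, which rules out a
  central limit theorem for independent terms; conditioning on that level restores independence
  exactly. After a \<open>k\<close>-th power, a change of level from the quantile \<open>t\<close>
  to \<open>u\<close> matters asymptotically only through \<open>sqrt k * (Sig u - Sig t)\<close>,
  and the bias condition makes this vanish for \<open>u / t\<close> in a fixed interval around 1.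
  Hence consistency of the level, with no rate, is enough, and a Chernoff bound yields it as soon as
  the tail at \<open>b * t\<close> is at most \<open>q < 1\<close> times the tail at
  \<open>t\<close>, for each \<open>b > 1\<close>. Eigenvectors are the wrong objects for the
  projections: with multiple eigenvalues they need not converge, and maximizing subspaces may fail
  to be unique. Projections form a compact set and satisfy exact algebraic identities, so limits can
  be taken in these identities. All dimensions \<open>p\<close> are driven by one and the same
  \<open>Z\<close>, and joint convergence is a single application of the mapping argument to a
  function-valued map.\<close>

inductive trig_poly :: "('v::euclidean_space \<Rightarrow> complex) \<Rightarrow> bool" where
  base: "trig_poly (\<lambda>x. c * cis (a \<bullet> x))"
| add: "trig_poly f \<Longrightarrow> trig_poly g \<Longrightarrow> trig_poly (\<lambda>x. f x + g x)"

lemma trig_poly_const: "trig_poly (\<lambda>_. c)"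
  using trig_poly.base[of c 0] by simp

lemma trig_poly_mult:
  assumes "trig_poly f" "trig_poly g"
  shows "trig_poly (\<lambda>x. f x * g x)"
  using assms
proof (induction f)
  case (base c a)
  from base show ?case
  proof (induction g)
    case (base c' a')
    have "(\<lambda>x. c * cis (a \<bullet> x) * (c' * cis (a' \<bullet> x))) = (\<lambda>x. (c * c') * cis ((a + a') \<bullet> x))"
      by (simp add: fun_eq_iff cis_mult[symmetric] inner_add_left algebra_simps)
    then show ?case by (simp add: trig_poly.base)
  qed (simp add: distrib_left trig_poly.add)
qed (simp add: distrib_right trig_poly.add)

lemma trig_poly_sum:
  assumes "finite A" "\<And>i. i \<in> A \<Longrightarrow> trig_poly (f i)"
  shows "trig_poly (\<lambda>x. \<Sum>i\<in>A. f i x)"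
  using assms by induction (simp_all add: trig_poly_const trig_poly.add)

lemma trig_poly_sin: "trig_poly (\<lambda>x. complex_of_real (sin (a \<bullet> x)))"
proof -
  have "complex_of_real (sin (a \<bullet> x)) = (1 / (2 * \<i>)) * cis (a \<bullet> x) + (- 1 / (2 * \<i>)) * cis ((- a) \<bullet> x)" for x
    by (simp add: complex_eq_iff)
  moreover have "trig_poly (\<lambda>x. (1 / (2 * \<i>)) * cis (a \<bullet> x) + (- 1 / (2 * \<i>)) * cis ((- a) \<bullet> x))"
    by (intro trig_poly.intros)
  ultimately show ?thesis by simp
qed

text \<open>The class is an algebra that contains the sine of each coordinate, and a linear form of
  the vector of sines is a combination of them.\<close>

lemma trig_poly_polynomial_sin:
  fixes p :: "'v::euclidean_space \<Rightarrow> real"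
  assumes "real_polynomial_function p"
  shows "trig_poly (\<lambda>x. complex_of_real (p (\<Sum>b\<in>Basis. sin (c * (x \<bullet> b)) *\<^sub>R b)))"
  using assms
proof induction
  case (linear f)
  interpret bounded_linear f by fact
  have "trig_poly (\<lambda>x. \<Sum>b\<in>Basis. complex_of_real (f b) * complex_of_real (sin ((c *\<^sub>R b) \<bullet> x)))"
    by (intro trig_poly_sum trig_poly_mult trig_poly_const trig_poly_sin) auto
  then show ?case by (simp add: sum scaleR inner_commute mult.commute)
qed (simp_all add: trig_poly_const trig_poly.add trig_poly_mult)

lemma trig_poly_measurable: "trig_poly f \<Longrightarrow> f \<in> borel_measurable borel"
  by (induction rule: trig_poly.induct) (auto intro!: borel_measurable_continuous_onI continuous_intros)

lemma trig_poly_bounded: "trig_poly f \<Longrightarrow> \<exists>B. \<forall>x. norm (f x) \<le> B"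
proof (induction rule: trig_poly.induct)
  case (base c a)
  show ?case by (rule exI[of _ "norm c"]) (simp add: norm_mult)
next
  case (add f g)
  then obtain B C where "\<forall>x. norm (f x) \<le> B" "\<forall>x. norm (g x) \<le> C" by blast
  then have "\<forall>x. norm (f x + g x) \<le> B + C" by (meson add_mono norm_triangle_le)
  then show ?case ..
qed

lemma integrable_trig_poly:
  assumes "finite_measure M" "sets M = sets borel" "trig_poly f"
  shows "integrable M f"
proof -
  obtain B where B: "\<forall>x. norm (f x) \<le> B" using trig_poly_bounded[OF assms(3)] by blast
  have "f \<in> borel_measurable M"
    using trig_poly_measurable[OF assms(3)] assms(2) measurable_cong_sets by blast
  then show ?thesis
    using B assms(1) by (intro finite_measure.integrable_const_bound[of _ _ B]) auto
qed

lemma trig_poly_integral_tendsto: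
  assumes P: "\<And>n. prob_space (P n)" "\<And>n. sets (P n) = sets borel"
    and L: "prob_space L" "sets L = sets borel"
    and conv: "\<And>a. (\<lambda>n. \<integral>x. cis (a \<bullet> x) \<partial>P n) \<longlonglongrightarrow> (\<integral>x. cis (a \<bullet> x) \<partial>L)"
    and "trig_poly f"
  shows "(\<lambda>n. \<integral>x. f x \<partial>P n) \<longlonglongrightarrow> (\<integral>x. f x \<partial>L)"
  using \<open>trig_poly f\<close>
proof (induction rule: trig_poly.induct)
  case (base c a)
  show ?case by simp (intro tendsto_intros conv)
next
  case (add f g)
  have i: "integrable (P n) h" "integrable L h" if "trig_poly h" for n h
    using that P L prob_space.finite_measure integrable_trig_poly by blast+
  show ?case using add by (simp add: i) (intro tendsto_intros)
qed

text \<open>A continuous substitute for the indicator of \<open>\<bar>y\<bar> > L\<close>, rising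
  from 0 to 1 between \<open>L\<close> and \<open>L + 1\<close>: its integrals control tails and are
  limits along weakly convergent laws.\<close>

definition ramp :: "real \<Rightarrow> real \<Rightarrow> real" where
  "ramp L y = max 0 (min 1 (\<bar>y\<bar> - L))"

lemma ramp_bounds: "0 \<le> ramp L y" "ramp L y \<le> 1" by (auto simp: ramp_def)

lemma continuous_ramp: "continuous_on A (ramp L)"
  unfolding ramp_def by (intro continuous_intros)

lemma integral_ramp_small:
  assumes "prob_space M" "f \<in> borel_measurable M" "\<eta> > 0"
  shows "\<exists>L>0. (\<integral>x. ramp L (f x) \<partial>M) < \<eta>"
proof -
  interpret prob_space M by fact
  have "(\<lambda>n. \<integral>x. ramp (real n) (f x) \<partial>M) \<longlonglongrightarrow> (\<integral>x. 0 \<partial>M)"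
  proof (rule integral_dominated_convergence[where w="\<lambda>_. 1"])
    show "(\<lambda>x. ramp (real n) (f x)) \<in> borel_measurable M" for n
      unfolding ramp_def using assms by measurable
    show "AE x in M. (\<lambda>n. ramp (real n) (f x)) \<longlonglongrightarrow> 0"
    proof (rule AE_I2)
      fix x
      have "\<forall>\<^sub>F n in sequentially. ramp (real n) (f x) = 0"
        using eventually_ge_at_top[of "nat \<lceil>\<bar>f x\<bar>\<rceil>"]
        by eventually_elim (auto simp: ramp_def max_def min_def)
      then show "(\<lambda>n. ramp (real n) (f x)) \<longlonglongrightarrow> 0" by (rule tendsto_eventually)
    qed
  qed (auto simp: ramp_def)
  then have "\<forall>\<^sub>F n in sequentially. (\<integral>x. ramp (real n) (f x) \<partial>M) < \<eta>"
    using \<open>\<eta> > 0\<close> by (simp add: order_tendstoD)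
  then have "\<forall>\<^sub>F n in sequentially. (\<integral>x. ramp (real n) (f x) \<partial>M) < \<eta> \<and> n > 0"
    using eventually_gt_at_top by (rule eventually_conj)
  then obtain n :: nat where "(\<integral>x. ramp (real n) (f x) \<partial>M) < \<eta>" "n > 0"
    unfolding eventually_sequentially by blast
  then show ?thesis by (intro exI[of _ "real n"]) auto
qed

lemma char_distr_inner:
  assumes "b \<in> borel_measurable M"
  shows "char (distr M borel b) t = (\<integral>x. cis (t * b x) \<partial>M)"
  unfolding char_def using assms
  by (subst integral_distr) (auto simp: cis_conv_exp intro!: borel_measurable_continuous_onI continuous_intros)

text \<open>One direction at a time: the characteristic function of \<open>x \<bullet> b\<close> at
  \<open>t\<close> is that of the vector at \<open>t *\<^sub>R b\<close>, so the one-dimensional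
  Levy theorem applies. Since the limit gives the ramp a small mean for large \<open>l\<close>, no
  mass escapes in direction \<open>b\<close>.\<close>

lemma charfun_imp_tight:
  fixes P :: "nat \<Rightarrow> 'v::euclidean_space measure"
  assumes P: "\<And>n. prob_space (P n)" "\<And>n. sets (P n) = sets borel"
    and L: "prob_space L" "sets L = sets borel"
    and conv: "\<And>a. (\<lambda>n. \<integral>x. cis (a \<bullet> x) \<partial>P n) \<longlonglongrightarrow> (\<integral>x. cis (a \<bullet> x) \<partial>L)"
  shows "(\<lambda>n. \<integral>x. ramp l (x \<bullet> b) \<partial>P n) \<longlonglongrightarrow> (\<integral>x. ramp l (x \<bullet> b) \<partial>L)"
proof -
  note [measurable_cong] = P(2) L(2)
  define D where "D n = distr (P n) borel (\<lambda>x. x \<bullet> b)" for n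
  define E where "E = distr L borel (\<lambda>x. x \<bullet> b)"
  have D: "real_distribution (D n)" for n
    unfolding D_def by (intro prob_space.real_distribution_distr P) simp
  have E: "real_distribution E"
    unfolding E_def by (intro prob_space.real_distribution_distr L) simp
  have "weak_conv_m D E"
  proof (rule levy_continuity[OF D E])
    show "(\<lambda>n. char (D n) t) \<longlonglongrightarrow> char E t" for t
      using conv[of "t *\<^sub>R b"] unfolding D_def E_def
      by (subst (1 2) char_distr_inner) (simp_all add: inner_commute)
  qed
  moreover have "isCont (ramp l) x" for x
    using continuous_ramp[of UNIV l] by (simp add: continuous_on_eq_continuous_at)
  moreover have "norm (ramp l x) \<le> 1" for x using ramp_bounds[of l x] by simp
  ultimately have "(\<lambda>n. integral\<^sup>L (D n) (ramp l)) \<longlonglongrightarrow> integral\<^sup>L E (ramp l)"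
    by (intro weak_conv_imp_integral_bdd_continuous_conv[of D E "ramp l" 1] D E)
  moreover have "ramp l \<in> borel_measurable borel"
    by (intro borel_measurable_continuous_onI continuous_ramp)
  ultimately show ?thesis by (simp add: D_def E_def integral_distr)
qed

text \<open>Since \<open>sin\<close> maps the box injectively onto a cube, composing a polynomial with it
  gives a trigonometric polynomial that is close to \<open>f\<close> on the box and bounded everywhere.\<close>

lemma trig_poly_approx:
  fixes f :: "'v::euclidean_space \<Rightarrow> real"
  assumes f: "continuous_on UNIV f" "\<And>x. \<bar>f x\<bar> \<le> C" and "\<eta> > 0" "L > 0"
  obtains g where "trig_poly (\<lambda>x. complex_of_real (g x))" "\<And>x. \<bar>g x\<bar> \<le> C + \<eta>"
    "\<And>x. (\<forall>b\<in>Basis. \<bar>x \<bullet> b\<bar> \<le> L) \<Longrightarrow> \<bar>f x - g x\<bar> \<le> \<eta>"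
proof -
  \<comment> \<open>This scale carries \<open>[- L, L]\<close> onto
    \<open>[- pi / 2, pi / 2]\<close>, where \<open>arcsin\<close> inverts \<open>sin\<close>;
    below, \<open>h\<close> is \<open>f\<close> transported to the cube.\<close>
  define c where "c = pi / (2 * L)"
  have c: "c > 0" "c * L = pi / 2" using \<open>L > 0\<close> by (auto simp: c_def)
  define S where "S = cbox (- One) (One :: 'v)"
  define h where "h y = f (\<Sum>b\<in>Basis. (arcsin (y \<bullet> b) / c) *\<^sub>R b)" for y
  have "continuous_on S h"
    unfolding h_def
    by (rule continuous_on_compose2[OF f(1)])
       (auto simp: S_def mem_box c_def \<open>L > 0\<close>[THEN less_imp_neq, symmetric] intro!: continuous_intros)
  then obtain p where p: "real_polynomial_function p" "\<And>y. y \<in> S \<Longrightarrow> \<bar>h y - p y\<bar> < \<eta>"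
    using Stone_Weierstrass_real_polynomial_function[of S h \<eta>] \<open>\<eta> > 0\<close> by (auto simp: S_def)
  define s where "s x = (\<Sum>b\<in>Basis. sin (c * (x \<bullet> b)) *\<^sub>R b)" for x :: 'v
  have s: "s x \<in> S" for x by (simp add: S_def s_def mem_box)
  show ?thesis
  proof
    show "trig_poly (\<lambda>x. complex_of_real (p (s x)))"
      unfolding s_def by (rule trig_poly_polynomial_sin[OF p(1)])
    show "\<bar>p (s x)\<bar> \<le> C + \<eta>" for x
    proof -
      have "\<bar>h (s x)\<bar> \<le> C" by (simp add: h_def f(2))
      then show ?thesis using p(2)[OF s[of x]] by linarith
    qed
    show "\<bar>f x - p (s x)\<bar> \<le> \<eta>" if "\<forall>b\<in>Basis. \<bar>x \<bullet> b\<bar> \<le> L" for x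
    proof -
      have "arcsin (sin (c * (x \<bullet> b))) = c * (x \<bullet> b)" if b: "b \<in> Basis" for b
      proof (rule arcsin_sin)
        have "\<bar>c * (x \<bullet> b)\<bar> \<le> c * L"
          using \<open>\<forall>b\<in>Basis. \<bar>x \<bullet> b\<bar> \<le> L\<close> b c by (simp add: abs_mult)
        then show "- (pi / 2) \<le> c * (x \<bullet> b)" "c * (x \<bullet> b) \<le> pi / 2" using c by auto
      qed
      then have "h (s x) = f x"
        using c(1) unfolding h_def s_def by (simp add: euclidean_representation)
      then show ?thesis using p(2)[OF s[of x]] by simp
    qed
  qed
qed

lemma bounded_range_abs_le:
  fixes f :: "'v \<Rightarrow> real"
  assumes "bounded (range f)"
  obtains C where "C > 0" "\<And>x. \<bar>f x\<bar> \<le> C"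
  using assms unfolding bounded_pos by auto

text \<open>On a large box \<open>f\<close> is replaced by a trigonometric polynomial, whose
  integrals converge by assumption. Off the box the replacement costs at most a constant, which is
  charged to the sum \<open>r\<close> of the ramps of all coordinates; its integral is small for the
  limit and therefore eventually for \<open>P n\<close>.\<close>

theorem levy_continuity_euclidean:
  fixes P :: "nat \<Rightarrow> 'v::euclidean_space measure"
  assumes P: "\<And>n. prob_space (P n)" "\<And>n. sets (P n) = sets borel"
    and L: "prob_space L" "sets L = sets borel"
    and conv: "\<And>a. (\<lambda>n. \<integral>x. cis (a \<bullet> x) \<partial>P n) \<longlonglongrightarrow> (\<integral>x. cis (a \<bullet> x) \<partial>L)"
  shows "converges_weakly P L sequentially"
  unfolding converges_weakly_def
proof (intro allI impI, elim conjE)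
  fix f :: "'v \<Rightarrow> real"
  assume cf: "continuous_on UNIV f" and bf: "bounded (range f)"
  note [measurable_cong] = P(2) L(2)
  obtain C where C: "C > 0" "\<And>x. \<bar>f x\<bar> \<le> C" using bounded_range_abs_le[OF bf] by blast
  have fm: "f \<in> borel_measurable borel" by (rule borel_measurable_continuous_onI[OF cf])
  have rm: "(\<lambda>x. ramp l (x \<bullet> b)) \<in> borel_measurable borel" for l and b :: 'v
    unfolding ramp_def by measurable
  show "(\<lambda>n. \<integral>x. f x \<partial>P n) \<longlonglongrightarrow> (\<integral>x. f x \<partial>L)"
  proof (rule LIMSEQ_I)
    fix e :: real assume "e > 0"
    define d where "d = real DIM('v)"
    have d: "d > 0" by (simp add: d_def)
    \<comment> \<open>Room for the total error: \<open>3 * \<eta>\<close> from the two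
      approximations and the convergence for \<open>g\<close>, and \<open>(2 * C + 1)\<close> times
      \<open>2 * \<eta>\<close> and \<open>\<eta>\<close> from the tails of \<open>P n\<close> and
      \<open>L\<close>.\<close>
    define \<eta> where "\<eta> = min 1 (e / (5 + 4 * (2 * C + 1)))"
    have \<eta>: "\<eta> > 0" "\<eta> \<le> 1" using \<open>e > 0\<close> C by (auto simp: \<eta>_def)
    have "\<eta> * (5 + 4 * (2 * C + 1)) \<le> e / (5 + 4 * (2 * C + 1)) * (5 + 4 * (2 * C + 1))"
      using C by (intro mult_right_mono) (auto simp: \<eta>_def)
    then have \<eta>e: "\<eta> * (5 + 4 * (2 * C + 1)) \<le> e" using C by simp
    have "\<exists>l>0. (\<integral>x. ramp l (x \<bullet> b) \<partial>L) < \<eta> / d" for b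
      using integral_ramp_small[OF L(1), of "\<lambda>x. x \<bullet> b" "\<eta> / d"] \<eta> d by simp
    then obtain l where l: "\<And>b. l b > 0" "\<And>b. (\<integral>x. ramp (l b) (x \<bullet> b) \<partial>L) < \<eta> / d" by metis
    define r where "r x = (\<Sum>b\<in>Basis. ramp (l b) (x \<bullet> b))" for x :: 'v
    \<comment> \<open>One more than every \<open>l b\<close>: outside the box of this size some
      coordinate has its ramp at the full value 1.\<close>
    define K where "K = Max (l ` Basis) + 1"
    have K: "l b + 1 \<le> K" if "b \<in> Basis" for b using that by (simp add: K_def)
    have "K > 0" using K[OF SOME_Basis] l(1)[of "SOME b. b \<in> Basis"] by linarith
    have ri: "integrable M (\<lambda>x. ramp (l b) (x \<bullet> b))" if "prob_space M" "sets M = sets borel" for M b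
    proof -
      interpret prob_space M by fact
      have "(\<lambda>x. ramp (l b) (x \<bullet> b)) \<in> borel_measurable M" using rm that(2) measurable_cong_sets by blast
      then show ?thesis
        by (intro integrable_const_bound[of _ 1]) (use ramp_bounds in auto)
    qed
    obtain g where g: "trig_poly (\<lambda>x. complex_of_real (g x))" "\<And>x. \<bar>g x\<bar> \<le> C + \<eta>"
      "\<And>x. (\<forall>b\<in>Basis. \<bar>x \<bullet> b\<bar> \<le> K) \<Longrightarrow> \<bar>f x - g x\<bar> \<le> \<eta>"
      using trig_poly_approx[OF cf C(2) \<eta>(1) \<open>K > 0\<close>] by blast
    have gm: "g \<in> borel_measurable borel"
      using trig_poly_measurable[OF g(1)] by (simp add: borel_measurable_complex_iff)
    have diff: "\<bar>f x - g x\<bar> \<le> \<eta> + (2 * C + 1) * r x" for x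
    proof (cases "\<forall>b\<in>Basis. \<bar>x \<bullet> b\<bar> \<le> K")
      case True
      have "0 \<le> r x" unfolding r_def by (intro sum_nonneg ramp_bounds)
      then have "0 \<le> (2 * C + 1) * r x" using C by simp
      then show ?thesis using g(3)[OF True] by linarith
    next
      case False
      then obtain b where b: "b \<in> Basis" "\<bar>x \<bullet> b\<bar> > K" by force
      have "1 = ramp (l b) (x \<bullet> b)" using K[OF b(1)] b(2) by (auto simp: ramp_def)
      also have "\<dots> \<le> r x" unfolding r_def by (rule member_le_sum) (use b ramp_bounds in auto)
      finally have R: "(2 * C + 1) * 1 \<le> (2 * C + 1) * r x" using C by (intro mult_left_mono) auto
      have "\<bar>f x - g x\<bar> \<le> \<eta> + (2 * C + 1) * 1" using C(2)[of x] g(2)[of x] abs_triangle_ineq4[of "f x" "g x"] by simp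
      also have "\<dots> \<le> \<eta> + (2 * C + 1) * r x" using R by simp
      finally show ?thesis .
    qed
    have int_diff: "\<bar>(\<integral>x. f x \<partial>M) - (\<integral>x. g x \<partial>M)\<bar> \<le> \<eta> + (2 * C + 1) * (\<integral>x. r x \<partial>M)"
      if M: "prob_space M" "sets M = sets borel" for M
    proof -
      interpret prob_space M by fact
      have "f \<in> borel_measurable M" "g \<in> borel_measurable M"
        using fm gm M(2) measurable_cong_sets by blast+
      then have i: "integrable M f" "integrable M g"
        using C(2) g(2) by (auto intro: integrable_const_bound[of f C] integrable_const_bound[of g "C + \<eta>"])
      have "integrable M r" unfolding r_def by (intro Bochner_Integration.integrable_sum ri M)
      then have ir: "integrable M (\<lambda>x. \<eta> + (2 * C + 1) * r x)" by simp
      have "\<bar>\<integral>x. f x - g x \<partial>M\<bar> \<le> (\<integral>x. \<bar>f x - g x\<bar> \<partial>M)" by (rule integral_abs_bound)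
      also have "\<dots> \<le> (\<integral>x. \<eta> + (2 * C + 1) * r x \<partial>M)"
        using i ir diff by (intro integral_mono) auto
      also have "\<dots> = \<eta> + (2 * C + 1) * (\<integral>x. r x \<partial>M)"
        using \<open>integrable M r\<close> by (simp add: prob_space)
      finally show ?thesis using i by simp
    qed
    have r_sum: "(\<integral>x. r x \<partial>M) = (\<Sum>b\<in>Basis. \<integral>x. ramp (l b) (x \<bullet> b) \<partial>M)"
      if M: "prob_space M" "sets M = sets borel" for M
      unfolding r_def by (intro Bochner_Integration.integral_sum ri M)
    have "(\<integral>x. r x \<partial>L) \<le> (\<Sum>b\<in>(Basis::'v set). \<eta> / d)"
      unfolding r_sum[OF L] using l(2) by (intro sum_mono) (simp add: less_imp_le)
    then have rL: "(\<integral>x. r x \<partial>L) \<le> \<eta>" using d by (simp add: d_def)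
    have "(\<lambda>n. \<integral>x. r x \<partial>P n) \<longlonglongrightarrow> (\<integral>x. r x \<partial>L)"
      unfolding r_sum[OF L] r_sum[OF P] by (intro tendsto_sum charfun_imp_tight P L conv)
    then have ev1: "\<forall>\<^sub>F n in sequentially. (\<integral>x. r x \<partial>P n) < 2 * \<eta>"
      using rL \<eta>(1) by (intro order_tendstoD(2)) auto
    have "(\<lambda>n. \<integral>x. complex_of_real (g x) \<partial>P n) \<longlonglongrightarrow> (\<integral>x. complex_of_real (g x) \<partial>L)"
      by (rule trig_poly_integral_tendsto[OF P L conv g(1)])
    then have "(\<lambda>n. \<integral>x. g x \<partial>P n) \<longlonglongrightarrow> (\<integral>x. g x \<partial>L)"
      unfolding integral_complex_of_real tendsto_of_real_iff .
    then have ev2: "\<forall>\<^sub>F n in sequentially. \<bar>(\<integral>x. g x \<partial>P n) - (\<integral>x. g x \<partial>L)\<bar> < \<eta>"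
      using tendstoD[of _ _ _ \<eta>] \<eta>(1) by (fastforce simp: dist_real_def)
    from ev1 ev2 have "\<forall>\<^sub>F n in sequentially. \<bar>(\<integral>x. f x \<partial>P n) - (\<integral>x. f x \<partial>L)\<bar> < e"
    proof eventually_elim
      case (elim n)
      have "(2 * C + 1) * (\<integral>x. r x \<partial>P n) \<le> (2 * C + 1) * (2 * \<eta>)"
        "(2 * C + 1) * (\<integral>x. r x \<partial>L) \<le> (2 * C + 1) * \<eta>"
        using elim(1) rL C by (auto intro!: mult_left_mono)
      moreover have "3 * \<eta> + (2 * C + 1) * (2 * \<eta>) + (2 * C + 1) * \<eta> < \<eta> * (5 + 4 * (2 * C + 1))"
        using \<eta> mult_pos_pos[OF C(1) \<eta>(1)] by (simp add: algebra_simps)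
      ultimately show ?case
        using int_diff[OF P, of n] int_diff[OF L] elim(2) \<eta>e by linarith
    qed
    then show "\<exists>no. \<forall>n\<ge>no. norm ((\<integral>x. f x \<partial>P n) - (\<integral>x. f x \<partial>L)) < e"
      by (simp add: eventually_sequentially)
  qed
qed

text \<open>Maximizing subspaces are not functions of \<open>Z n\<close>, so the limit relation is stated along
  sequences of sample points.\<close>

theorem extended_continuous_mapping:
  fixes Z :: "nat \<Rightarrow> 'a \<Rightarrow> 'v::euclidean_space" and Y :: "nat \<Rightarrow> 'a \<Rightarrow> 'w::topological_space"
  assumes M: "prob_space M" and L: "prob_space L" "sets L = sets borel"
    and mZ: "\<forall>\<^sub>F n in sequentially. Z n \<in> borel_measurable M"
    and mY: "\<forall>\<^sub>F n in sequentially. Y n \<in> borel_measurable M"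
    and conv: "converges_weakly (\<lambda>n. distr M borel (Z n)) L sequentially"
    and g: "continuous_on UNIV g"
    and G: "AE w in M. G w"
    and seq: "\<And>r w z. strict_mono (r :: nat \<Rightarrow> nat) \<Longrightarrow> (\<And>i. w i \<in> space M \<and> G (w i)) \<Longrightarrow>
        (\<lambda>i. Z (r i) (w i)) \<longlonglongrightarrow> z \<Longrightarrow> (\<lambda>i. Y (r i) (w i)) \<longlonglongrightarrow> g z"
  shows "converges_weakly (\<lambda>n. distr M borel (Y n)) (distr L borel g) sequentially"
  unfolding converges_weakly_def
proof (intro allI impI, elim conjE)
  fix f :: "'w \<Rightarrow> real"
  assume cf: "continuous_on UNIV f" and bf: "bounded (range f)"
  interpret prob_space M by fact
  note [measurable_cong] = L(2)
  obtain C where C: "C > 0" "\<And>x. \<bar>f x\<bar> \<le> C" using bounded_range_abs_le[OF bf] by blast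
  have fm: "f \<in> borel_measurable borel" by (rule borel_measurable_continuous_onI[OF cf])
  have gm: "g \<in> borel_measurable borel" by (rule borel_measurable_continuous_onI[OF g])
  have cfg: "continuous_on UNIV (\<lambda>x. f (g x))"
    by (rule continuous_on_compose2[OF cf g]) simp
  have fgm: "(\<lambda>x. f (g x)) \<in> borel_measurable borel" by (rule borel_measurable_continuous_onI[OF cfg])
  have bfg: "bounded (range (\<lambda>x. f (g x)))"
    by (rule bounded_subset[OF bf]) auto
  have rc: "continuous_on UNIV (\<lambda>x::'v. ramp l (norm x))" for l
    by (rule continuous_on_compose2[OF continuous_ramp]) (auto intro: continuous_intros)
  have rb: "bounded (range (\<lambda>x::'v. ramp l (norm x)))" for l
    unfolding bounded_iff by (rule exI[of _ 1]) (use ramp_bounds in auto)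
  have rm: "(\<lambda>x::'v. ramp l (norm x)) \<in> borel_measurable borel" for l
    by (rule borel_measurable_continuous_onI[OF rc])
  have uniform: "\<forall>\<^sub>F n in sequentially. \<forall>w\<in>space M. G w \<longrightarrow> norm (Z n w) \<le> l \<longrightarrow>
      \<bar>f (Y n w) - f (g (Z n w))\<bar> \<le> \<eta>" if "\<eta> > 0" for \<eta> l
  proof (rule ccontr)
    \<comment> \<open>Compactness argument: bad points for infinitely many \<open>n\<close> have
      their \<open>Z\<close>-values in a fixed ball, so they converge along a subsequence, and
      \<open>seq\<close> together with continuity contradicts their being bad.\<close>
    define bad where "bad n w \<longleftrightarrow> w \<in> space M \<and> G w \<and> norm (Z n w) \<le> l \<and>
      \<not> \<bar>f (Y n w) - f (g (Z n w))\<bar> \<le> \<eta>" for n w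
    assume "\<not> ?thesis"
    then have "\<exists>\<^sub>F n in sequentially. \<exists>w. bad n w"
      unfolding frequently_def bad_def by (auto elim!: contrapos_nn eventually_mono)
    then have "infinite {n. \<exists>w. bad n w}" by (simp add: frequently_cofinite flip: cofinite_eq_sequentially)
    then obtain r :: "nat \<Rightarrow> nat" where r: "strict_mono r" "\<And>i. \<exists>w. bad (r i) w"
      using infinite_enumerate[of "{n. \<exists>w. bad n w}"] by blast
    then obtain w where w: "\<And>i. bad (r i) (w i)" by metis
    have "bounded (range (\<lambda>i. Z (r i) (w i)))"
      unfolding bounded_iff using w by (auto simp: bad_def)
    then obtain z s where s: "strict_mono s" "((\<lambda>i. Z (r i) (w i)) \<circ> s) \<longlonglongrightarrow> z"
      using bounded_imp_convergent_subsequence by blast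
    then have Zlim: "(\<lambda>i. Z ((r \<circ> s) i) ((w \<circ> s) i)) \<longlonglongrightarrow> z" by (simp add: o_def)
    have "(\<lambda>i. Y ((r \<circ> s) i) ((w \<circ> s) i)) \<longlonglongrightarrow> g z"
      by (rule seq[OF strict_mono_o[OF r(1) s(1)] _ Zlim]) (use w in \<open>auto simp: bad_def\<close>)
    then have 1: "(\<lambda>i. f (Y ((r \<circ> s) i) ((w \<circ> s) i))) \<longlonglongrightarrow> f (g z)"
      using cf continuous_on_tendsto_compose[of UNIV f] by fastforce
    have 2: "(\<lambda>i. f (g (Z ((r \<circ> s) i) ((w \<circ> s) i)))) \<longlonglongrightarrow> f (g z)"
      using Zlim cfg continuous_on_tendsto_compose[of UNIV "\<lambda>x. f (g x)"] by fastforce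
    have "(\<lambda>i. \<bar>f (Y ((r \<circ> s) i) ((w \<circ> s) i)) - f (g (Z ((r \<circ> s) i) ((w \<circ> s) i)))\<bar>) \<longlonglongrightarrow> 0"
      using tendsto_diff[OF 1 2] by (simp add: tendsto_rabs_zero_iff)
    from order_tendstoD(2)[OF this \<open>\<eta> > 0\<close>] obtain i
      where "\<bar>f (Y ((r \<circ> s) i) ((w \<circ> s) i)) - f (g (Z ((r \<circ> s) i) ((w \<circ> s) i)))\<bar> < \<eta>"
      unfolding eventually_sequentially by blast
    then show False using w[of "s i"] by (simp add: bad_def)
  qed
  have lim: "(\<lambda>n. \<integral>x. f (g x) \<partial>distr M borel (Z n)) \<longlonglongrightarrow> (\<integral>x. f (g x) \<partial>L)"
    using conv cfg bfg unfolding converges_weakly_def by blast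
  have "(\<lambda>n. (\<integral>x. f x \<partial>distr M borel (Y n)) - (\<integral>x. f (g x) \<partial>distr M borel (Z n))) \<longlonglongrightarrow> 0"
  proof (rule tendstoI)
    fix e :: real assume "e > 0"
    define \<eta> where "\<eta> = e / (2 + 2 * C)"
    have \<eta>: "\<eta> > 0" using \<open>e > 0\<close> C by (simp add: \<eta>_def)
    have \<eta>e: "\<eta> + 2 * C * \<eta> < e"
    proof -
      have "\<eta> * (2 + 2 * C) = e" unfolding \<eta>_def using C by simp
      then show ?thesis using \<eta> by (simp add: algebra_simps)
    qed
    obtain l where l: "l > 0" "(\<integral>x. ramp l (norm x) \<partial>L) < \<eta>"
      using integral_ramp_small[OF L(1), of norm \<eta>] \<eta> by auto
    have "(\<lambda>n. \<integral>x. ramp l (norm x) \<partial>distr M borel (Z n)) \<longlonglongrightarrow> (\<integral>x. ramp l (norm x) \<partial>L)"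
      using conv rc rb unfolding converges_weakly_def by blast
    then have "\<forall>\<^sub>F n in sequentially. (\<integral>x. ramp l (norm x) \<partial>distr M borel (Z n)) < \<eta>"
      using l(2) by (rule order_tendstoD)
    with mY mZ uniform[OF \<eta>, of "l + 1"]
    show "\<forall>\<^sub>F n in sequentially. dist ((\<integral>x. f x \<partial>distr M borel (Y n)) - (\<integral>x. f (g x) \<partial>distr M borel (Z n))) 0 < e"
    proof eventually_elim
      case (elim n)
      have [measurable]: "(\<lambda>w. f (Y n w)) \<in> borel_measurable M" "(\<lambda>w. f (g (Z n w))) \<in> borel_measurable M"
        "(\<lambda>w. ramp l (norm (Z n w))) \<in> borel_measurable M"
        using measurable_compose[OF elim(1) fm] measurable_compose[OF elim(2) fgm]
          measurable_compose[OF elim(2) rm] by auto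
      have i: "integrable M (\<lambda>w. f (Y n w))" "integrable M (\<lambda>w. f (g (Z n w)))"
        "integrable M (\<lambda>w. ramp l (norm (Z n w)))"
        using C(2) ramp_bounds
        by (auto intro: integrable_const_bound[of "\<lambda>w. f (Y n w)" C] integrable_const_bound[of "\<lambda>w. f (g (Z n w))" C]
            integrable_const_bound[of "\<lambda>w. ramp l (norm (Z n w))" 1])
      have "AE w in M. \<bar>f (Y n w) - f (g (Z n w))\<bar> \<le> \<eta> + 2 * C * ramp l (norm (Z n w))"
        using G AE_space
      proof eventually_elim
        case w: (elim w)
        show ?case
        proof (cases "norm (Z n w) \<le> l + 1")
          case True
          moreover have "0 \<le> 2 * C * ramp l (norm (Z n w))"
            using C ramp_bounds by simp
          ultimately show ?thesis using elim(3) w by fastforce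
        next
          case False
          \<comment> \<open>Beyond radius \<open>l + 1\<close> the trivial bound
            \<open>2 * C\<close> is charged to the ramp, whose mean is below
            \<open>\<eta>\<close>.\<close>
          then have "ramp l (norm (Z n w)) = 1" by (simp add: ramp_def)
          then show ?thesis using C(2)[of "Y n w"] C(2)[of "g (Z n w)"] \<eta> by simp
        qed
      qed
      then have "(\<integral>w. \<bar>f (Y n w) - f (g (Z n w))\<bar> \<partial>M) \<le> (\<integral>w. \<eta> + 2 * C * ramp l (norm (Z n w)) \<partial>M)"
        using i by (intro integral_mono_AE) auto
      also have "\<dots> = \<eta> + 2 * C * (\<integral>w. ramp l (norm (Z n w)) \<partial>M)"
        using i by (simp add: prob_space)
      also have "(\<integral>w. ramp l (norm (Z n w)) \<partial>M) = (\<integral>x. ramp l (norm x) \<partial>distr M borel (Z n))"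
        using elim rm by (simp add: integral_distr)
      also have "\<eta> + 2 * C * \<dots> \<le> \<eta> + 2 * C * \<eta>" using elim C by simp
      finally have "(\<integral>w. \<bar>f (Y n w) - f (g (Z n w))\<bar> \<partial>M) < e" using \<eta>e by simp
      moreover have "\<bar>\<integral>w. f (Y n w) - f (g (Z n w)) \<partial>M\<bar> \<le> (\<integral>w. \<bar>f (Y n w) - f (g (Z n w))\<bar> \<partial>M)"
        by (rule integral_abs_bound)
      ultimately show ?case
        using elim fm fgm i by (simp add: integral_distr)
    qed
  qed
  from tendsto_add[OF this lim] show "(\<lambda>n. \<integral>x. f x \<partial>distr M borel (Y n)) \<longlonglongrightarrow> (\<integral>x. f x \<partial>distr L borel g)"
    using gm fm by (simp add: integral_distr)
qed

section \<open>Spectral projections\<close>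

lemma bounded_bilinear_matrix_mult:
  "bounded_bilinear ((**) :: real ^ 'n ^ 'm \<Rightarrow> real ^ 'p ^ 'n \<Rightarrow> real ^ 'p ^ 'm)"
  unfolding bilinear_conv_bounded_bilinear[symmetric] bilinear_def linear_iff
  by (auto simp: matrix_matrix_mult_def vec_eq_iff sum.distrib sum_distrib_left algebra_simps)

lemmas tendsto_matrix_mult [tendsto_intros] = bounded_bilinear.tendsto[OF bounded_bilinear_matrix_mult]
lemmas continuous_on_matrix_mult [continuous_intros] = bounded_bilinear.continuous_on[OF bounded_bilinear_matrix_mult]

lemma bounded_linear_trace: "bounded_linear (trace :: real ^ 'n ^ 'n \<Rightarrow> real)"
  unfolding linear_conv_bounded_linear[symmetric] linear_iff
  by (auto simp: trace_def sum.distrib sum_distrib_left)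

lemma bounded_linear_transpose: "bounded_linear (transpose :: real ^ 'n ^ 'm \<Rightarrow> real ^ 'm ^ 'n)"
  unfolding linear_conv_bounded_linear[symmetric] linear_iff
  by (auto simp: transpose_def vec_eq_iff)

lemma bounded_linear_matrix_vector: "bounded_linear (\<lambda>A :: real ^ 'n ^ 'm. A *v x)"
  unfolding linear_conv_bounded_linear[symmetric] linear_iff
  by (auto simp: vec_eq_iff matrix_vector_mult_def sum.distrib sum_distrib_left algebra_simps)

lemmas tendsto_trace [tendsto_intros] = bounded_linear.tendsto[OF bounded_linear_trace]
lemmas tendsto_transpose [tendsto_intros] = bounded_linear.tendsto[OF bounded_linear_transpose]
lemmas tendsto_matrix_vector [tendsto_intros] = bounded_linear.tendsto[OF bounded_linear_matrix_vector]

lemma symmetric_matrix_inner: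
  fixes A :: "real ^ 'n ^ 'n"
  assumes "transpose A = A"
  shows "x \<bullet> (A *v y) = (A *v x) \<bullet> y"
  using assms by (metis dot_lmul_matrix transpose_matrix_vector)

lemma symmetric_matrixI:
  fixes A :: "real ^ 'n ^ 'n"
  assumes "\<And>x y. x \<bullet> (A *v y) = (A *v x) \<bullet> y"
  shows "transpose A = A"
proof -
  have "x v* A = A *v x" for x
  proof -
    have "(x v* A) \<bullet> y = (A *v x) \<bullet> y" for y by (simp add: dot_lmul_matrix assms)
    then show ?thesis by (metis vector_eq_rdot)
  qed
  then show ?thesis by (simp add: matrix_eq)
qed

lemma outer_square_mult: "outer_square v *v x = (v \<bullet> x) *\<^sub>R v"
  by (simp add: outer_square_def matrix_vector_mult_def inner_vec_def vec_eq_iff sum_distrib_right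
      sum_distrib_left mult_ac)

lemma transpose_outer_square: "transpose (outer_square v) = outer_square v"
  by (simp add: outer_square_def transpose_def vec_eq_iff mult.commute)

lemma trace_mult_outer_square: "trace (A ** outer_square v) = v \<bullet> (A *v v)"
  by (simp add: trace_def matrix_matrix_mult_def outer_square_def inner_vec_def matrix_vector_mult_def
      sum_distrib_left mult_ac)

section \<open>Orthonormal sets and orthogonal projections\<close>

definition orthonormal :: "'v::real_inner set \<Rightarrow> bool" where
  "orthonormal B \<longleftrightarrow> pairwise orthogonal B \<and> (\<forall>b\<in>B. norm b = 1)"

lemma orthonormal_inner:
  "orthonormal B \<Longrightarrow> b \<in> B \<Longrightarrow> b' \<in> B \<Longrightarrow> b \<bullet> b' = of_bool (b = b')"
  by (auto simp: orthonormal_def pairwise_def orthogonal_def norm_eq_1)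

lemma orthonormal_subset: "orthonormal B \<Longrightarrow> C \<subseteq> B \<Longrightarrow> orthonormal C"
  by (auto simp: orthonormal_def pairwise_def)

lemma orthonormal_independent:
  fixes B :: "'v::euclidean_space set"
  shows "orthonormal B \<Longrightarrow> independent B"
  by (rule pairwise_orthogonal_independent) (auto simp: orthonormal_def)

lemma orthonormal_finite:
  fixes B :: "'v::euclidean_space set"
  shows "orthonormal B \<Longrightarrow> finite B"
  using orthonormal_independent finiteI_independent by blast

lemma orthonormal_card:
  fixes B :: "'v::euclidean_space set"
  shows "orthonormal B \<Longrightarrow> dim (span B) = card B"
  using orthonormal_independent dim_span_eq_card_independent by blast

lemma orthonormal_insert:
  assumes "orthonormal C" "norm u = 1" "\<And>x. x \<in> C \<Longrightarrow> u \<bullet> x = 0"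
  shows "orthonormal (insert u C)"
  using assms by (auto simp: orthonormal_def pairwise_insert orthogonal_def inner_commute)

lemma matrix_sum_mult: "(\<Sum>i\<in>I. F i) *v x = (\<Sum>i\<in>I. F i *v (x :: real ^ 'n))"
  for F :: "_ \<Rightarrow> real ^ 'n ^ 'm"
  using linear_sum[OF bounded_linear.linear[OF bounded_linear_matrix_vector]] .

lemma proj_mat_unique:
  assumes "subspace V" "\<And>x. P *v x \<in> V" "\<And>x v. v \<in> V \<Longrightarrow> orthogonal (x - P *v x) v"
  shows "proj_mat V = P"
  unfolding proj_mat_def
  by (rule the1_equality[OF proj_mat_ex1[OF assms(1)]]) (use assms in blast)

lemma proj_mat_props:
  assumes "subspace V"
  shows "proj_mat V *v x \<in> V" "v \<in> V \<Longrightarrow> (x - proj_mat V *v x) \<bullet> v = 0"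
  using theI'[OF proj_mat_ex1[OF assms]] by (auto simp: proj_mat_def orthogonal_def)

lemma proj_mat_fix:
  assumes V: "subspace V" and v: "v \<in> V"
  shows "proj_mat V *v v = v"
proof -
  have "v - proj_mat V *v v \<in> V" using subspace_diff[OF V v] proj_mat_props[OF V] by blast
  then have "(v - proj_mat V *v v) \<bullet> (v - proj_mat V *v v) = 0" using proj_mat_props(2)[OF V] by blast
  then show ?thesis by simp
qed

lemma proj_mat_idem:
  assumes "subspace V" shows "proj_mat V ** proj_mat V = proj_mat V"
  by (simp add: matrix_eq proj_mat_fix proj_mat_props assms flip: matrix_vector_mul_assoc)

lemma proj_mat_symmetric:
  assumes V: "subspace V" shows "transpose (proj_mat V) = proj_mat V"
proof (rule symmetric_matrixI)
  fix x y
  have *: "x \<bullet> (proj_mat V *v y) = (proj_mat V *v x) \<bullet> (proj_mat V *v y)" for x y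
    using proj_mat_props(2)[OF V proj_mat_props(1)[OF V]] by (simp add: inner_diff_left)
  show "x \<bullet> (proj_mat V *v y) = (proj_mat V *v x) \<bullet> y"
    using *[of x y] *[of y x] by (metis inner_commute)
qed

lemma sum_inner_orthonormal:
  fixes f :: "_ \<Rightarrow> 'w::real_vector"
  assumes B: "orthonormal B" "finite B" and "b \<in> B"
  shows "(\<Sum>b'\<in>B. (b' \<bullet> b) *\<^sub>R f b') = f b"
proof -
  have "(\<Sum>b'\<in>B. (b' \<bullet> b) *\<^sub>R f b') = (\<Sum>b'\<in>B. if b' = b then f b' else 0)"
    using assms by (intro sum.cong) (auto simp: orthonormal_inner)
  then show ?thesis using assms by (simp add: sum.delta)
qed

lemma proj_mat_span_orthonormal:
  fixes B :: "(real ^ 'd) set"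
  assumes B: "orthonormal B"
  shows "proj_mat (span B) = (\<Sum>b\<in>B. outer_square b)"
proof (rule proj_mat_unique)
  fix x v :: "real ^ 'd"
  show "(\<Sum>b\<in>B. outer_square b) *v x \<in> span B"
    unfolding matrix_sum_mult outer_square_mult by (intro span_sum span_scale) (rule span_base)
  assume v: "v \<in> span B"
  show "orthogonal (x - (\<Sum>b\<in>B. outer_square b) *v x) v"
  proof (rule orthogonal_to_span[OF v])
    fix y assume y: "y \<in> B"
    have "(\<Sum>b\<in>B. (b \<bullet> x) * (b \<bullet> y)) = (\<Sum>b\<in>B. (b \<bullet> y) *\<^sub>R (b \<bullet> x))"
      by (simp add: mult.commute)
    also have "\<dots> = y \<bullet> x" by (rule sum_inner_orthonormal[OF B orthonormal_finite[OF B] y])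
    also have "\<dots> = x \<bullet> y" by (rule inner_commute)
    finally show "orthogonal (x - (\<Sum>b\<in>B. outer_square b) *v x) y"
      by (simp add: orthogonal_def matrix_sum_mult outer_square_mult inner_diff_left inner_sum_left)
  qed
qed simp

lemma orthonormal_basis_of_subspace:
  fixes V :: "'v::euclidean_space set"
  assumes "subspace V"
  obtains B where "orthonormal B" "span B = V" "B \<subseteq> V"
  using orthonormal_basis_subspace[OF assms] unfolding orthonormal_def by metis

text \<open>Writes the gain of a subspace through the quadratic form on an arbitrary orthonormal
  basis of it, so that the basis can be adapted to the direction under study.\<close>

lemma trace_mult_proj_mat_span:
  assumes "orthonormal B"
  shows "trace (A ** proj_mat (span B)) = (\<Sum>b\<in>B. b \<bullet> (A *v b))"
proof -
  have "A ** proj_mat (span B) = (\<Sum>b\<in>B. A ** outer_square b)"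
    unfolding proj_mat_span_orthonormal[OF assms]
    by (rule bounded_bilinear.sum_right[OF bounded_bilinear_matrix_mult])
  then show ?thesis
    by (simp add: trace_mult_outer_square linear_sum[OF bounded_linear.linear[OF bounded_linear_trace]])
qed

lemma trace_orthonormal_basis:
  fixes A :: "real ^ 'n ^ 'n"
  assumes "orthonormal B" "span B = UNIV"
  shows "trace A = (\<Sum>b\<in>B. b \<bullet> (A *v b))"
proof -
  have "proj_mat (UNIV :: (real ^ 'n) set) = mat 1"
    by (rule proj_mat_unique) (auto simp: orthogonal_def)
  then show ?thesis using trace_mult_proj_mat_span[OF assms(1), of A] assms(2) by simp
qed

lemma trace_proj_mat:
  assumes "subspace V"
  shows "trace (proj_mat V) = real (dim V)"
proof -
  obtain B where B: "orthonormal B" "span B = V" using orthonormal_basis_of_subspace[OF assms] by metis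
  have "(\<Sum>b\<in>B. b \<bullet> b) = (\<Sum>b\<in>B. 1)"
    using B(1) by (intro sum.cong) (auto simp: orthonormal_inner)
  then show ?thesis
    using trace_mult_proj_mat_span[OF B(1), of "mat 1"] orthonormal_card[OF B(1)] B(2) by simp
qed

section \<open>Subspaces of maximal trace\<close>

lemma quadratic_nonpos_imp_zero:
  fixes h c :: real
  assumes "\<And>t. 2 * t * h + t\<^sup>2 * c \<le> 0"
  shows "h = 0"
proof (rule ccontr)
  assume "h \<noteq> 0"
  \<comment> \<open>Small enough for the linear term to beat the quadratic one, whatever the sign of
    \<open>c\<close>.\<close>
  define t where "t = h / (\<bar>c\<bar> + 1)"
  have *: "\<bar>c\<bar> + 1 > 0" by simp
  have h: "h = t * (\<bar>c\<bar> + 1)" using * by (simp add: t_def)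
  have "2 * t * h + t\<^sup>2 * c = t\<^sup>2 * (2 * (\<bar>c\<bar> + 1) + c)"
    by (subst h) (simp add: algebra_simps power2_eq_square)
  moreover have "t\<^sup>2 > 0" "2 * (\<bar>c\<bar> + 1) + c > 0" using \<open>h \<noteq> 0\<close> * by (auto simp: t_def)
  ultimately show False using assms[of t] by (metis mult_pos_pos not_le)
qed

text \<open>The first-order condition at \<open>t = 0\<close>: the derivative of the Rayleigh
  quotient along \<open>w\<close> is \<open>2 * (w \<bullet> (A *v v))\<close>. The squared norm on
  the right-hand side accounts for \<open>v + t *\<^sub>R w\<close> not being a unit vector.\<close>

lemma rayleigh_stationary:
  fixes A :: "real ^ 'd ^ 'd"
  assumes A: "transpose A = A" and vw: "norm v = 1" "v \<bullet> w = 0"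
    and max: "\<And>t. (v + t *\<^sub>R w) \<bullet> (A *v (v + t *\<^sub>R w)) \<le> (v \<bullet> (A *v v)) * (norm (v + t *\<^sub>R w))\<^sup>2"
  shows "w \<bullet> (A *v v) = 0"
proof (rule quadratic_nonpos_imp_zero)
  fix t
  have n: "(norm (v + t *\<^sub>R w))\<^sup>2 = 1 + t\<^sup>2 * (w \<bullet> w)"
    unfolding power2_norm_eq_inner using vw by (simp add: inner_add_left inner_add_right inner_commute norm_eq_1 power2_eq_square)
  have "v \<bullet> (A *v w) = w \<bullet> (A *v v)" using symmetric_matrix_inner[OF A] by (metis inner_commute)
  then have "(v + t *\<^sub>R w) \<bullet> (A *v (v + t *\<^sub>R w)) =
      v \<bullet> (A *v v) + 2 * t * (w \<bullet> (A *v v)) + t\<^sup>2 * (w \<bullet> (A *v w))"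
    by (simp add: matrix_vector_right_distrib matrix_vector_mult_scaleR inner_add_left inner_add_right power2_eq_square
        algebra_simps)
  with max[of t] show "2 * t * (w \<bullet> (A *v v)) + t\<^sup>2 * (w \<bullet> (A *v w) - (v \<bullet> (A *v v)) * (w \<bullet> w)) \<le> 0"
    unfolding n by (simp add: algebra_simps)
qed

text \<open>Rotating \<open>v\<close> towards \<open>w\<close> does not increase the trace.\<close>

lemma trace_max_invariant:
  fixes A :: "real ^ 'd ^ 'd"
  assumes A: "transpose A = A"
    and V: "is_arg_max (\<lambda>V. trace (A ** proj_mat V)) (\<lambda>V. V \<in> subspaces_of_dim p) V"
    and v: "v \<in> V" and w: "\<And>x. x \<in> V \<Longrightarrow> w \<bullet> x = 0"
  shows "w \<bullet> (A *v v) = 0"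
proof -
  have sV: "subspace V" and dV: "dim V = p" and
    mx: "\<And>V'. subspace V' \<Longrightarrow> dim V' = p \<Longrightarrow> trace (A ** proj_mat V') \<le> trace (A ** proj_mat V)"
    using V by (auto simp: is_arg_max_linorder subspaces_of_dim_def)
  have unit: "w \<bullet> (A *v v) = 0" if v: "v \<in> V" "norm v = 1" for v
  proof -
    \<comment> \<open>The part of \<open>V\<close> orthogonal to \<open>v\<close> stays fixed and
      only \<open>v\<close> is traded for the unit vector \<open>u\<close>, so the two traces differ
      in a single summand.\<close>
    define S where "S = V \<inter> {x. v \<bullet> x = 0}"
    have sS: "subspace S" unfolding S_def by (intro subspace_inter sV subspace_hyperplane)
    obtain C where C: "orthonormal C" "span C = S" "C \<subseteq> S" using orthonormal_basis_of_subspace[OF sS] .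
    have vC: "orthonormal (insert v C)"
      by (rule orthonormal_insert[OF C(1) v(2)]) (use C(3) in \<open>auto simp: S_def\<close>)
    have vv: "v \<bullet> v = 1" using v(2) by (simp add: norm_eq_1)
    have "v \<notin> C" using C(3) vv by (auto simp: S_def)
    have sp: "span (insert v C) = V"
    proof
      show "span (insert v C) \<subseteq> V"
        by (rule span_minimal[OF _ sV]) (use v C(3) in \<open>auto simp: S_def\<close>)
      show "V \<subseteq> span (insert v C)"
      proof
        fix x assume "x \<in> V"
        then have "x - (v \<bullet> x) *\<^sub>R v \<in> S"
          using v sV vv by (auto simp: S_def inner_diff_right intro!: subspace_diff subspace_scale)
        then show "x \<in> span (insert v C)" unfolding C(2)[symmetric] span_insert by blast
      qed
    qed
    have pC: "p = Suc (card C)"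
      using orthonormal_card[OF vC] sp dV \<open>v \<notin> C\<close> orthonormal_finite[OF C(1)] by simp
    have val: "trace (A ** proj_mat V) = v \<bullet> (A *v v) + (\<Sum>b\<in>C. b \<bullet> (A *v b))"
      unfolding sp[symmetric] trace_mult_proj_mat_span[OF vC]
      using \<open>v \<notin> C\<close> orthonormal_finite[OF C(1)] by simp
    show ?thesis
    proof (rule rayleigh_stationary[OF A v(2)])
      show "v \<bullet> w = 0" using w[OF v(1)] by (simp add: inner_commute)
    next
      fix t
      define y where "y = v + t *\<^sub>R w"
      have yv: "y \<bullet> v = 1" using w[OF v(1)] vv by (simp add: y_def inner_add_left)
      then have y0: "norm y > 0" by auto
      define u where "u = (1 / norm y) *\<^sub>R y"
      have un: "norm u = 1" using y0 by (simp add: u_def)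
      have uC: "u \<bullet> x = 0" if "x \<in> C" for x
      proof -
        have "x \<in> V" "v \<bullet> x = 0" using that C(3) by (auto simp: S_def)
        then show ?thesis by (simp add: u_def y_def inner_add_left w)
      qed
      have oC: "orthonormal (insert u C)" by (rule orthonormal_insert[OF C(1) un uC])
      have "u \<notin> C" using uC un by (metis norm_eq_1 zero_neq_one)
      have "dim (span (insert u C)) = p"
        using orthonormal_card[OF oC] \<open>u \<notin> C\<close> orthonormal_finite[OF C(1)] pC by simp
      then have "trace (A ** proj_mat (span (insert u C))) \<le> trace (A ** proj_mat V)"
        by (intro mx) auto
      then have "u \<bullet> (A *v u) \<le> v \<bullet> (A *v v)"
        unfolding val trace_mult_proj_mat_span[OF oC]
        using \<open>u \<notin> C\<close> orthonormal_finite[OF C(1)] by simp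
      moreover have "u \<bullet> (A *v u) = (y \<bullet> (A *v y)) / (norm y)\<^sup>2"
        by (simp add: u_def matrix_vector_mult_scaleR power2_eq_square)
      ultimately show "(v + t *\<^sub>R w) \<bullet> (A *v (v + t *\<^sub>R w)) \<le> (v \<bullet> (A *v v)) * (norm (v + t *\<^sub>R w))\<^sup>2"
        using y0 by (simp add: y_def[symmetric] divide_le_eq)
    qed
  qed
  show ?thesis
  proof (cases "v = 0")
    case False
    have "w \<bullet> (A *v ((1 / norm v) *\<^sub>R v)) = 0"
      by (rule unit[OF subspace_scale[OF sV v]]) (use False in simp)
    then show ?thesis using False by (simp add: matrix_vector_mult_scaleR)
  qed simp
qed

text \<open>A maximizer is invariant under \<open>A\<close>, and by symmetry of \<open>A\<close> so
  is its orthogonal complement; a projection whose range and kernel are both invariant commutes with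
  \<open>A\<close>. This holds for every maximizer.\<close>

lemma trace_max_commute:
  fixes A :: "real ^ 'd ^ 'd"
  assumes A: "transpose A = A"
    and V: "is_arg_max (\<lambda>V. trace (A ** proj_mat V)) (\<lambda>V. V \<in> subspaces_of_dim p) V"
  shows "A ** proj_mat V = proj_mat V ** A"
proof -
  have sV: "subspace V" using V by (auto simp: is_arg_max_linorder subspaces_of_dim_def)
  let ?P = "proj_mat V"
  note symP = symmetric_matrix_inner[OF proj_mat_symmetric[OF sV]]
  note symA = symmetric_matrix_inner[OF A]
  have perp: "(x - ?P *v x) \<bullet> (A *v v) = 0" if "v \<in> V" for x v
    by (rule trace_max_invariant[OF A V that]) (rule proj_mat_props(2)[OF sV])
  have "y \<bullet> (A *v (?P *v x)) = y \<bullet> (?P *v (A *v x))" for x y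
  proof -
    have "y \<bullet> (A *v (?P *v x)) = (?P *v y) \<bullet> (A *v (?P *v x))"
      using perp[of "?P *v x" y] proj_mat_props(1)[OF sV] by (simp add: inner_diff_left)
    moreover have "x \<bullet> (A *v (?P *v y)) = (?P *v x) \<bullet> (A *v (?P *v y))"
      using perp[of "?P *v y" x] proj_mat_props(1)[OF sV] by (simp add: inner_diff_left)
    then have "(?P *v y) \<bullet> (A *v x) = (?P *v y) \<bullet> (A *v (?P *v x))"
      unfolding symA[of "?P *v y"] by (simp only: inner_commute[of x] inner_commute[of "?P *v x"])
    ultimately show ?thesis by (simp only: symP)
  qed
  then have "A *v (?P *v x) = ?P *v (A *v x)" for x using vector_eq_ldot by blast
  then show ?thesis by (simp add: matrix_eq flip: matrix_vector_mul_assoc)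
qed

text \<open>Induction on the dimension of an invariant subspace: a maximizer of the quadratic form
  on its unit sphere is an eigenvector, and the part of the subspace orthogonal to it is again
  invariant.\<close>

theorem spectral_basis:
  fixes A :: "real ^ 'd ^ 'd"
  assumes A: "transpose A = A"
  obtains B c where "orthonormal B" "span B = UNIV" "\<And>b. b \<in> B \<Longrightarrow> A *v b = c b *\<^sub>R b"
proof -
  have "\<exists>B. orthonormal B \<and> span B = S \<and> (\<forall>b\<in>B. \<exists>c. A *v b = c *\<^sub>R b)"
    if "subspace S" "\<And>x. x \<in> S \<Longrightarrow> A *v x \<in> S" for S
    using that
  proof (induction "dim S" arbitrary: S rule: less_induct)
    case less
    note sS = less.prems(1) and inv = less.prems(2)
    show ?case
    proof (cases "S = {0}")
      case True
      then show ?thesis by (intro exI[of _ "{}"]) (auto simp: orthonormal_def)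
    next
      case False
      define K where "K = S \<inter> sphere 0 1"
      have "compact K" unfolding K_def
        by (intro closed_Int_compact closed_subspace sS) auto
      moreover obtain x where "x \<in> S" "x \<noteq> 0" using False sS subspace_0 by blast
      then have "(1 / norm x) *\<^sub>R x \<in> K" using sS by (auto simp: K_def intro: subspace_scale)
      then have "K \<noteq> {}" by blast
      moreover have "continuous_on K (\<lambda>x. x \<bullet> (A *v x))" by (intro continuous_intros linear_continuous_on) auto
      ultimately obtain v where v: "v \<in> K" "\<And>y. y \<in> K \<Longrightarrow> y \<bullet> (A *v y) \<le> v \<bullet> (A *v v)"
        using continuous_attains_sup[of K] by blast
      have vS: "v \<in> S" and vn: "norm v = 1" using v(1) by (auto simp: K_def)
      have vv: "v \<bullet> v = 1" using vn by (simp add: norm_eq_1)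
      have stat: "w \<bullet> (A *v v) = 0" if w: "w \<in> S" "v \<bullet> w = 0" for w
      proof (rule rayleigh_stationary[OF A vn w(2)])
        fix t
        define y where "y = v + t *\<^sub>R w"
        have "y \<bullet> v = 1" using w vv by (simp add: y_def inner_add_left inner_commute[of w])
        then have y0: "norm y > 0" by auto
        have "y \<in> S" unfolding y_def by (intro subspace_add subspace_scale sS vS w)
        then have "(1 / norm y) *\<^sub>R y \<in> K" using y0 sS by (auto simp: K_def intro: subspace_scale)
        from v(2)[OF this] show "(v + t *\<^sub>R w) \<bullet> (A *v (v + t *\<^sub>R w)) \<le> (v \<bullet> (A *v v)) * (norm (v + t *\<^sub>R w))\<^sup>2"
          using y0 by (simp add: y_def[symmetric] matrix_vector_mult_scaleR power2_eq_square field_simps)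
      qed
      \<comment> \<open>The component of \<open>A *v v\<close> orthogonal to \<open>v\<close>. It
        lies in \<open>S\<close>, so by stationarity it is orthogonal to \<open>A *v v\<close>,
        hence to itself.\<close>
      define z where "z = A *v v - (v \<bullet> (A *v v)) *\<^sub>R v"
      have zS: "z \<in> S" unfolding z_def by (intro subspace_diff subspace_scale sS inv vS)
      have vz: "v \<bullet> z = 0" by (simp add: z_def inner_diff_right vv)
      have "z \<bullet> z = z \<bullet> (A *v v) - (v \<bullet> (A *v v)) * (z \<bullet> v)" by (simp add: z_def inner_diff_right inner_diff_left)
      then have "z = 0" using stat[OF zS vz] vz by (simp add: inner_commute)
      then have ev: "A *v v = (v \<bullet> (A *v v)) *\<^sub>R v" by (simp add: z_def)
      define S' where "S' = S \<inter> {x. v \<bullet> x = 0}"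
      have sS': "subspace S'" unfolding S'_def by (intro subspace_inter sS subspace_hyperplane)
      have "v \<notin> S'" using vv by (simp add: S'_def)
      moreover have "S' \<subseteq> S" by (auto simp: S'_def)
      ultimately have "S' \<subset> S" using vS by blast
      then have dim: "dim S' < dim S"
        by (intro dim_psubset) (metis sS sS' span_eq_iff)
      have inv': "A *v x \<in> S'" if "x \<in> S'" for x
      proof -
        have "v \<bullet> (A *v x) = (A *v v) \<bullet> x" by (rule symmetric_matrix_inner[OF A])
        also have "\<dots> = 0" using that by (subst ev) (simp add: S'_def)
        finally show ?thesis using that inv by (simp add: S'_def)
      qed
      obtain C where C: "orthonormal C" "span C = S'" "\<forall>b\<in>C. \<exists>c. A *v b = c *\<^sub>R b"
        using less.hyps[OF dim sS' inv'] by blast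
      have CS': "C \<subseteq> S'" using C(2) span_superset by blast
      have o: "orthonormal (insert v C)"
        by (rule orthonormal_insert[OF C(1) vn]) (use CS' in \<open>auto simp: S'_def\<close>)
      have "span (insert v C) = S"
      proof
        show "span (insert v C) \<subseteq> S"
          by (rule span_minimal[OF _ sS]) (use vS CS' in \<open>auto simp: S'_def\<close>)
        show "S \<subseteq> span (insert v C)"
        proof
          fix x assume "x \<in> S"
          then have "x - (v \<bullet> x) *\<^sub>R v \<in> S'"
            using vS sS vv by (auto simp: S'_def inner_diff_right intro!: subspace_diff subspace_scale)
          then show "x \<in> span (insert v C)" unfolding C(2)[symmetric] span_insert by blast
        qed
      qed
      then show ?thesis using o C(3) ev by blast
    qed
  qed
  from this[of UNIV] obtain B where B: "orthonormal B" "span B = UNIV" "\<forall>b\<in>B. \<exists>c. A *v b = c *\<^sub>R b"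
    by auto
  from B(3) obtain c where "\<forall>b\<in>B. A *v b = c b *\<^sub>R b" by metis
  with B that show ?thesis by blast
qed

section \<open>Eigenvalues and their multiplicities\<close>

lemma sum_singleton_mset: "finite B \<Longrightarrow> (\<Sum>b\<in>B. {#f b#}) = image_mset f (mset_set B)"
  by (induction rule: finite_induct) auto

lemma proots_prod_linear_factors:
  fixes c :: "'b \<Rightarrow> real"
  assumes "finite B"
  shows "proots (\<Prod>b\<in>B. [:- c b, 1:]) = image_mset c (mset_set B)"
  using assms by (subst proots_prod) (simp_all add: sum_singleton_mset)

text \<open>Polynomials that agree on all reals are equal, and the multiset of roots recovers the
  linear factors with their multiplicities.\<close>

lemma prod_linear_factors_unique:
  fixes c :: "'b \<Rightarrow> real" and l :: "'m \<Rightarrow> real"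
  assumes "finite B" "finite M" "\<And>x. (\<Prod>b\<in>B. x - c b) = (\<Prod>m\<in>M. x - l m)"
  shows "image_mset c (mset_set B) = image_mset l (mset_set M)"
proof -
  have "poly (\<Prod>b\<in>B. [:- c b, 1:]) = poly (\<Prod>m\<in>M. [:- l m, 1:])"
    using assms(3) by (simp add: poly_prod fun_eq_iff)
  then have "(\<Prod>b\<in>B. [:- c b, 1:]) = (\<Prod>m\<in>M. [:- l m, 1:])" by (simp only: poly_eq_poly_eq_iff)
  then show ?thesis using assms proots_prod_linear_factors by metis
qed

lemma image_mset_eq_card_eq:
  assumes "finite B" "finite M" "image_mset c (mset_set B) = image_mset l (mset_set M)"
  shows "card {b\<in>B. Q (c b)} = card {m\<in>M. Q (l m)}"
proof -
  have "size (filter_mset Q (image_mset c (mset_set B))) = size (filter_mset Q (image_mset l (mset_set M)))"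
    using assms(3) by simp
  then show ?thesis
    using assms(1,2) by (simp add: filter_mset_image_mset filter_mset_mset_set o_def)
qed

text \<open>The matrix \<open>Q\<close> with the basis vectors as columns diagonalizes:
  \<open>(mat x - A) ** Q = Q ** D\<close>. This connects the roots counted by
  \<open>ordered_eigenvalues\<close> with an eigenbasis.\<close>

lemma det_eigenbasis:
  fixes A :: "real ^ 'd ^ 'd"
  assumes B: "orthonormal B" "span B = UNIV" and c: "\<And>b. b \<in> B \<Longrightarrow> A *v b = c b *\<^sub>R b"
  shows "det (mat x - A) = (\<Prod>b\<in>B. x - c b)"
proof -
  have "card B = CARD('d)" using orthonormal_card[OF B(1)] B(2) by simp
  then obtain f :: "'d \<Rightarrow> real ^ 'd" where f: "bij_betw f UNIV B"
    using finite_same_card_bij[of "UNIV :: 'd set" B] orthonormal_finite[OF B(1)] by auto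
  have fB: "f j \<in> B" for j using f by (auto simp: bij_betw_def)
  define Q where "Q = (\<chi> i j. f j $ i)"
  define D where "D = (\<chi> i j. if i = j then x - c (f j) else (0::real))"
  have "transpose Q ** Q = mat 1"
  proof -
    have "f i \<bullet> f j = of_bool (i = j)" for i j
      using f orthonormal_inner[OF B(1) fB fB, of i j] by (simp add: bij_betw_def inj_eq)
    then have "(\<Sum>l\<in>UNIV. f i $ l * f j $ l) = of_bool (i = j)" for i j by (simp add: inner_vec_def)
    then show ?thesis by (simp add: vec_eq_iff Q_def matrix_matrix_mult_def transpose_def mat_def)
  qed
  then have "det Q * det Q = 1" using det_mul[of "transpose Q" Q] by (simp add: det_transpose)
  then have dQ: "det Q \<noteq> 0" by auto
  have "(mat x - A) ** Q = Q ** D"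
  proof -
    have "((mat x - A) ** Q) $ i $ j = (Q ** D) $ i $ j" for i j
    proof -
      have "(mat x :: real ^ 'd ^ 'd) *v f j = x *\<^sub>R f j"
        by (simp add: vec_eq_iff matrix_vector_mult_def mat_def if_distrib[of "\<lambda>z. z * _"] cong: if_cong)
      then have "(mat x - A) *v f j = (x - c (f j)) *\<^sub>R f j"
        using c[OF fB[of j]] by (simp add: matrix_vector_mult_diff_rdistrib scaleR_left_diff_distrib)
      moreover have "((mat x - A) ** Q) $ i $ j = ((mat x - A) *v f j) $ i"
        by (simp add: matrix_matrix_mult_def matrix_vector_mult_def Q_def)
      moreover have "(Q ** D) $ i $ j = f j $ i * (x - c (f j))"
        by (simp add: matrix_matrix_mult_def Q_def D_def if_distrib[of "\<lambda>z. _ * z"] cong: if_cong)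
      ultimately show ?thesis by simp
    qed
    then show ?thesis by (simp add: vec_eq_iff)
  qed
  then have "det (mat x - A) * det Q = det Q * det D" by (metis det_mul)
  then have "det (mat x - A) = det D" using dQ by simp
  also have "\<dots> = (\<Prod>j\<in>UNIV. x - c (f j))" by (subst det_diagonal) (auto simp: D_def)
  also have "\<dots> = (\<Prod>b\<in>B. x - c b)" by (rule prod.reindex_bij_betw[OF f])
  finally show ?thesis .
qed

lemma strict_mono_block:
  fixes N :: "nat \<Rightarrow> nat"
  assumes "N 0 = 0" "1 \<le> m" "m \<le> N r"
  obtains j where "j \<in> {1..r}" "N (j - 1) < m" "m \<le> N j"
proof
  let ?j = "LEAST j. m \<le> N j"
  show 1: "m \<le> N ?j" by (rule LeastI[of _ r]) fact
  have "?j \<noteq> 0" using 1 assms(1,2) by (metis not_one_le_zero le_zero_eq)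
  moreover have "?j \<le> r" by (rule Least_le) fact
  ultimately show "?j \<in> {1..r}" by simp
  show "N (?j - 1) < m"
    using not_less_Least[of "?j - 1" "\<lambda>j. m \<le> N j"] \<open>?j \<noteq> 0\<close> by simp
qed

text \<open>The values \<open>c b\<close> and the values \<open>lam m\<close> form the same
  multiset, so anything about eigenvalues may be counted on either side, and the blocks given by
  \<open>N\<close> do the counting on the side of \<open>lam\<close>. The second claim yields the
  dimension \<open>p = N J\<close> of the sum of the first \<open>J\<close> eigenspaces.\<close>

lemma eigenbasis_multiplicities:
  fixes A :: "real ^ 'd ^ 'd" and \<mu> lam :: "nat \<Rightarrow> real" and N :: "nat \<Rightarrow> nat"
  assumes B: "orthonormal B" "span B = UNIV" and c: "\<And>b. b \<in> B \<Longrightarrow> A *v b = c b *\<^sub>R b"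
    and lam: "ordered_eigenvalues A lam"
    and N: "N 0 = 0" "strict_mono_on {0..r} N" "N r = CARD('d)"
    and mu: "\<forall>i\<in>{1..r}. \<forall>j\<in>{1..r}. i < j \<longrightarrow> \<mu> j < \<mu> i"
    and blocks: "\<forall>j\<in>{1..r}. \<forall>m. N (j - 1) < m \<and> m \<le> N j \<longrightarrow> lam m = \<mu> j"
  shows "b \<in> B \<Longrightarrow> \<exists>j\<in>{1..r}. c b = \<mu> j"
    and "J \<in> {1..r} \<Longrightarrow> card {b\<in>B. \<mu> J \<le> c b} = N J"
proof -
  have fin: "finite B" by (rule orthonormal_finite[OF B(1)])
  have ms: "image_mset c (mset_set B) = image_mset lam (mset_set {1..CARD('d)})"
    using lam det_eigenbasis[OF B c]
    by (intro prod_linear_factors_unique fin) (auto simp: ordered_eigenvalues_def)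
  have block: "\<exists>j\<in>{1..r}. N (j - 1) < m \<and> m \<le> N j \<and> lam m = \<mu> j" if m: "m \<in> {1..CARD('d)}" for m
  proof -
    obtain j where "j \<in> {1..r}" "N (j - 1) < m" "m \<le> N j"
      by (rule strict_mono_block[of N m r]) (use m N in auto)
    then show ?thesis using blocks by blast
  qed
  show "\<exists>j\<in>{1..r}. c b = \<mu> j" if "b \<in> B"
  proof -
    have "card {b'\<in>B. c b' = c b} = card {m\<in>{1..CARD('d)}. lam m = c b}"
      by (rule image_mset_eq_card_eq[OF fin _ ms]) simp
    moreover have "card {b'\<in>B. c b' = c b} > 0" using that fin by (auto simp: card_gt_0_iff)
    ultimately obtain m where "m \<in> {1..CARD('d)}" "lam m = c b"
      by (auto simp: card_gt_0_iff)
    then show ?thesis using block by metis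
  qed
  show "card {b\<in>B. \<mu> J \<le> c b} = N J" if J: "J \<in> {1..r}"
  proof -
    have mono: "N i \<le> N j" if "i \<le> j" "j \<le> r" for i j
      using that N(2) by (cases "i = j") (auto simp: strict_mono_on_def intro: less_imp_le)
    have "\<mu> J \<le> lam m \<longleftrightarrow> m \<le> N J" if m: "m \<in> {1..CARD('d)}" for m
    proof -
      obtain j where j: "j \<in> {1..r}" "N (j - 1) < m" "m \<le> N j" "lam m = \<mu> j" using block[OF m] by blast
      show ?thesis
      proof (cases "j \<le> J")
        case True
        have "\<mu> J \<le> \<mu> j" using True mu j(1) J by (cases "j = J") (auto intro: less_imp_le)
        moreover have "m \<le> N J" using mono[OF True] j J by auto
        ultimately show ?thesis using j by simp
      next
        case False
        have "\<mu> j < \<mu> J" using False mu j(1) J by auto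
        moreover have "N J \<le> N (j - 1)" using False j(1) by (intro mono) auto
        ultimately show ?thesis using j by simp
      qed
    qed
    then have "{m\<in>{1..CARD('d)}. \<mu> J \<le> lam m} = {1..N J}"
      using mono[of J r] J N(3) by auto
    then show ?thesis using image_mset_eq_card_eq[OF fin _ ms, of "\<lambda>x. \<mu> J \<le> x"] by simp
  qed
qed

lemma subspace_eigenspace: "subspace (eigenspace A m)"
  unfolding eigenspace_def
  by (rule subspaceI) (auto simp: matrix_vector_right_distrib matrix_vector_mult_scaleR scaleR_right_distrib)

lemma tendsto_subseqI:
  fixes f :: "nat \<Rightarrow> 'v::metric_space"
  assumes "\<And>s. strict_mono s \<Longrightarrow> \<exists>t. strict_mono (t :: nat \<Rightarrow> nat) \<and> (\<lambda>i. f (s (t i))) \<longlonglongrightarrow> l"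
  shows "f \<longlonglongrightarrow> l"
proof (rule tendstoI, rule ccontr)
  fix e :: real assume "e > 0" and "\<not> (\<forall>\<^sub>F n in sequentially. dist (f n) l < e)"
  then have "\<exists>\<^sub>F n in sequentially. \<not> dist (f n) l < e" by (simp add: frequently_def)
  then have "infinite {n. \<not> dist (f n) l < e}" by (simp add: frequently_cofinite flip: cofinite_eq_sequentially)
  then obtain s :: "nat \<Rightarrow> nat" where s: "strict_mono s" "\<And>i. \<not> dist (f (s i)) l < e"
    using infinite_enumerate[of "{n. \<not> dist (f n) l < e}"] by blast
  obtain t where t: "(\<lambda>i. f (s (t i))) \<longlonglongrightarrow> l" using assms[OF s(1)] by blast
  from tendstoD[OF t \<open>e > 0\<close>] s(2) show False by (auto simp: eventually_sequentially)
qed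

lemma norm_projection_sq:
  fixes P :: "real ^ 'd ^ 'd"
  assumes "transpose P = P" "P ** P = P"
  shows "(norm P)\<^sup>2 = trace P"
proof -
  have "(norm P)\<^sup>2 = trace (transpose P ** P)"
    unfolding power2_norm_eq_inner
    by (simp add: inner_vec_def trace_def matrix_matrix_mult_def transpose_def)
       (rule sum.swap)
  then show ?thesis using assms by simp
qed

text \<open>A crude bound that gives limit points for sequences of projections: the squared
  Euclidean norm of a projection matrix is its trace, hence its rank.\<close>

lemma norm_proj_mat_le:
  fixes V :: "(real ^ 'd) set"
  assumes "subspace V"
  shows "norm (proj_mat V) \<le> real CARD('d)"
proof -
  have "(norm (proj_mat V))\<^sup>2 = real (dim V)"
    using norm_projection_sq[OF proj_mat_symmetric proj_mat_idem] trace_proj_mat assms by metis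
  also have "\<dots> \<le> real CARD('d)" using dim_subset_UNIV_cart[of V] by simp
  also have "\<dots> \<le> (real CARD('d))\<^sup>2" by (simp add: power2_eq_square)
  finally show ?thesis by (simp add: power2_le_iff_abs_le)
qed

section \<open>Perturbation of the spectral projection at an eigenvalue gap\<close>

locale spectral_gap =
  fixes A :: "real ^ 'd ^ 'd" and B :: "(real ^ 'd) set" and c :: "real ^ 'd \<Rightarrow> real"
    and \<mu> :: "nat \<Rightarrow> real" and r J p :: nat
  assumes sym: "transpose A = A"
    and onb: "orthonormal B" "span B = UNIV"
    and eig: "\<And>b. b \<in> B \<Longrightarrow> A *v b = c b *\<^sub>R b"
    and c_range: "\<And>b. b \<in> B \<Longrightarrow> \<exists>j\<in>{1..r}. c b = \<mu> j"
    and mu: "\<forall>i\<in>{1..r}. \<forall>j\<in>{1..r}. i < j \<longrightarrow> \<mu> j < \<mu> i"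
    and J: "J \<in> {1..<r}"
    and card_top: "card {b\<in>B. \<mu> J \<le> c b} = p"
begin

lemma finB: "finite B" by (rule orthonormal_finite[OF onb(1)])

lemma matrix_eqI_basis:
  fixes X Y :: "real ^ 'd ^ 'd"
  assumes "\<And>b b'. b \<in> B \<Longrightarrow> b' \<in> B \<Longrightarrow> b \<bullet> (X *v b') = b \<bullet> (Y *v b')"
  shows "X = Y"
proof -
  have "X *v b' = Y *v b'" if b': "b' \<in> B" for b'
  proof -
    have "orthogonal (X *v b' - Y *v b') x" for x
    proof (rule orthogonal_to_span[where S=B])
      show "x \<in> span B" by (simp add: onb)
      show "orthogonal (X *v b' - Y *v b') y" if "y \<in> B" for y
        using assms[OF that b'] by (simp add: orthogonal_def inner_diff_right inner_commute[of _ y])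
    qed
    from this[of "X *v b' - Y *v b'"] show ?thesis by (simp add: orthogonal_def)
  qed
  then have "X *v x = Y *v x" for x
    using linear_eq_on[of "(*v) X" "(*v) Y" x B] onb by simp
  then show ?thesis by (simp add: matrix_eq)
qed

lemma mu_less:
  assumes "i \<in> {1..r}" "j \<in> {1..r}"
  shows "\<mu> j < \<mu> i \<longleftrightarrow> i < j"
proof (cases i j rule: linorder_cases)
  case less
  then show ?thesis using mu assms by simp
next
  case greater
  then have "\<mu> i < \<mu> j" using mu assms by simp
  then show ?thesis using greater by simp
qed simp

lemma mu_eq: "i \<in> {1..r} \<Longrightarrow> j \<in> {1..r} \<Longrightarrow> \<mu> j = \<mu> i \<longleftrightarrow> i = j"
  using mu_less[of i j] mu_less[of j i] by (cases i j rule: linorder_cases) auto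

definition top_proj :: "real ^ 'd ^ 'd" where
  "top_proj = proj_mat (span {b\<in>B. \<mu> J \<le> c b})"

lemma top_orthonormal: "orthonormal {b\<in>B. \<mu> J \<le> c b}"
  by (rule orthonormal_subset[OF onb(1)]) auto

lemma top_proj_basis: "b \<in> B \<Longrightarrow> top_proj *v b = (if \<mu> J \<le> c b then b else 0)"
proof -
  assume b: "b \<in> B"
  have "top_proj *v b = (\<Sum>b'\<in>{b\<in>B. \<mu> J \<le> c b}. (b' \<bullet> b) *\<^sub>R b')"
    unfolding top_proj_def proj_mat_span_orthonormal[OF top_orthonormal]
    by (simp add: matrix_sum_mult outer_square_mult)
  also have "\<dots> = (\<Sum>b'\<in>{b\<in>B. \<mu> J \<le> c b}. if b' = b then b' else 0)"
    using b by (intro sum.cong) (auto simp: orthonormal_inner[OF onb(1)])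
  finally show ?thesis using b finB by (simp add: sum.delta)
qed

lemma eigenspace_proj_basis:
  assumes "b \<in> B"
  shows "proj_mat (eigenspace A m) *v b = (if c b = m then b else 0)"
proof (cases "c b = m")
  case True
  then have "b \<in> eigenspace A m" using eig[OF assms] by (simp add: eigenspace_def)
  then show ?thesis using True proj_mat_fix[OF subspace_eigenspace] by simp
next
  case False
  let ?P = "proj_mat (eigenspace A m)"
  have PV: "?P *v b \<in> eigenspace A m" by (rule proj_mat_props(1)[OF subspace_eigenspace])
  have "m * (b \<bullet> (?P *v b)) = b \<bullet> (A *v (?P *v b))" using PV by (simp add: eigenspace_def)
  also have "\<dots> = c b * (b \<bullet> (?P *v b))" by (simp add: symmetric_matrix_inner[OF sym] eig[OF assms])
  finally have "b \<bullet> (?P *v b) = 0" using False by simp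
  moreover have "(b - ?P *v b) \<bullet> (?P *v b) = 0" by (rule proj_mat_props(2)[OF subspace_eigenspace PV])
  ultimately show ?thesis using False by (simp add: inner_diff_left)
qed

text \<open>Each eigenspace projection fixes or kills a basis vector, so at most one term of the
  double sum survives in a given entry. Only entries that link one of the first \<open>J\<close>
  eigenspaces with a later one remain, in the form needed to compare with the solution of the
  commutator equation.\<close>

lemma limit_map_basis:
  assumes b: "b \<in> B" "b' \<in> B"
  shows "b \<bullet> (limit_map A \<mu> r J u *v b') =
    (if \<mu> J \<le> c b \<and> \<not> \<mu> J \<le> c b' then 1 / (c b' - c b) * (b \<bullet> (u *v b'))
     else if \<not> \<mu> J \<le> c b \<and> \<mu> J \<le> c b' then 1 / (c b - c b') * (b \<bullet> (u *v b')) else 0)"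
proof -
  let ?P = "\<lambda>j. proj_mat (eigenspace A (\<mu> j))"
  let ?z = "b \<bullet> (u *v b')"
  obtain i i' where i: "i \<in> {1..r}" "c b = \<mu> i" "i' \<in> {1..r}" "c b' = \<mu> i'" using c_range b by metis
  have hi: "\<mu> J \<le> c b \<longleftrightarrow> i \<le> J" "\<mu> J \<le> c b' \<longleftrightarrow> i' \<le> J"
    using i J mu_less[of J i] mu_less[of J i'] by (auto simp: not_less[symmetric])
  have PP: "b \<bullet> ((?P l ** u ** ?P j) *v b') = of_bool (i = l \<and> i' = j) * ?z"
    if "l \<in> {1..r}" "j \<in> {1..r}" for l j
  proof -
    have "b \<bullet> ((?P l ** u ** ?P j) *v b') = (?P l *v b) \<bullet> (u *v (?P j *v b'))"
      by (simp add: symmetric_matrix_inner[OF proj_mat_symmetric[OF subspace_eigenspace]] flip: matrix_vector_mul_assoc)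
    then show ?thesis using b i that by (auto simp: eigenspace_proj_basis mu_eq)
  qed
  have "b \<bullet> (limit_map A \<mu> r J u *v b') =
      (\<Sum>j = 1..J. \<Sum>l = Suc J..r. (1 / (\<mu> l - \<mu> j)) * (b \<bullet> ((?P l ** u ** ?P j) *v b') + b \<bullet> ((?P j ** u ** ?P l) *v b')))"
    unfolding limit_map_def Let_def
    by (simp add: matrix_sum_mult inner_sum_right scaleR_matrix_vector_assoc[symmetric]
        matrix_vector_mult_add_rdistrib inner_add_right)
  also have "\<dots> = (\<Sum>j = 1..J. \<Sum>l = Suc J..r. (1 / (\<mu> l - \<mu> j)) *
      (of_bool (i = l \<and> i' = j) * ?z + of_bool (i = j \<and> i' = l) * ?z))"
    using J by (intro sum.cong refl) (simp add: PP)
  also have "\<dots> = (\<Sum>j = 1..J. \<Sum>l = Suc J..r. (if i = l then if i' = j then (1 / (\<mu> i - \<mu> i')) * ?z else 0 else 0)) +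
     (\<Sum>j = 1..J. \<Sum>l = Suc J..r. (if i' = l then if i = j then (1 / (\<mu> i' - \<mu> i)) * ?z else 0 else 0))"
    unfolding sum.distrib[symmetric] by (intro sum.cong refl) auto
  also have "\<dots> = (if i > J \<and> i' \<le> J then (1 / (\<mu> i - \<mu> i')) * ?z else 0) +
     (if i' > J \<and> i \<le> J then (1 / (\<mu> i' - \<mu> i)) * ?z else 0)"
    using i by (simp add: sum.delta' sum.delta) auto
  finally show ?thesis using hi i by auto
qed

lemma inner_mult_basis: "b \<in> B \<Longrightarrow> b \<bullet> (A *v x) = c b * (b \<bullet> x)"
  by (simp add: symmetric_matrix_inner[OF sym, of b] eig)

lemma inner_top_proj_basis:
  assumes "b \<in> B"
  shows "b \<bullet> (top_proj *v x) = of_bool (\<mu> J \<le> c b) * (b \<bullet> x)"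
proof -
  have "transpose top_proj = top_proj" unfolding top_proj_def by (intro proj_mat_symmetric) simp
  from symmetric_matrix_inner[OF this, of b x] show ?thesis using assms by (simp add: top_proj_basis)
qed

text \<open>Both equations are read entrywise in the eigenbasis. The second one kills the entries
  within the top block and within the low block; on a mixed entry the commutator with
  \<open>A\<close> multiplies by \<open>c b - c b'\<close>, which the gap keeps away from 0. The
  scalar \<open>\<gamma>\<close> serves limits of rescaled sequences; for
  \<open>\<gamma> = 0\<close> the solution is 0.\<close>

lemma perturbation_equation_unique:
  fixes E z :: "real ^ 'd ^ 'd"
  assumes com: "A ** E - E ** A = \<gamma> *\<^sub>R (top_proj ** z - z ** top_proj)"
    and off: "top_proj ** E + E ** top_proj = E"
  shows "E = (- \<gamma>) *\<^sub>R limit_map A \<mu> r J z"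
proof (rule matrix_eqI_basis)
  fix b b' assume b: "b \<in> B" "b' \<in> B"
  let ?e = "b \<bullet> (E *v b')" and ?z = "b \<bullet> (z *v b')"
  let ?h = "\<lambda>b. \<mu> J \<le> c b"
  have top: "X *v (top_proj *v b') = of_bool (?h b') *\<^sub>R (X *v b')" for X :: "real ^ 'd ^ 'd"
    using b by (simp add: top_proj_basis)
  have "b \<bullet> ((A ** E - E ** A) *v b') = c b * ?e - c b' * ?e"
    using b by (simp add: matrix_vector_mult_diff_rdistrib inner_diff_right inner_mult_basis eig
        matrix_vector_mult_scaleR flip: matrix_vector_mul_assoc)
  moreover have "b \<bullet> ((\<gamma> *\<^sub>R (top_proj ** z - z ** top_proj)) *v b') =
      \<gamma> * (of_bool (?h b) * ?z - of_bool (?h b') * ?z)"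
    using b by (simp add: matrix_vector_mult_diff_rdistrib inner_diff_right inner_top_proj_basis top
        flip: scaleR_matrix_vector_assoc matrix_vector_mul_assoc)
  ultimately have 1: "c b * ?e - c b' * ?e = \<gamma> * (of_bool (?h b) * ?z - of_bool (?h b') * ?z)"
    using com by simp
  have "b \<bullet> ((top_proj ** E + E ** top_proj) *v b') = of_bool (?h b) * ?e + of_bool (?h b') * ?e"
    using b by (simp add: matrix_vector_mult_add_rdistrib inner_add_right inner_top_proj_basis top
        flip: matrix_vector_mul_assoc)
  then have 2: "of_bool (?h b) * ?e + of_bool (?h b') * ?e = ?e" unfolding off by simp
  have L: "b \<bullet> (((- \<gamma>) *\<^sub>R limit_map A \<mu> r J z) *v b') = - \<gamma> * (b \<bullet> (limit_map A \<mu> r J z *v b'))"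
    by (simp only: scaleR_matrix_vector_assoc[symmetric] inner_scaleR_right)
  show "?e = b \<bullet> (((- \<gamma>) *\<^sub>R limit_map A \<mu> r J z) *v b')"
  proof (cases "?h b = ?h b'")
    case True
    then have "?e = 0" using 2 by (cases "?h b") auto
    then show ?thesis unfolding L limit_map_basis[OF b] using True by simp
  next
    case False
    then have ne: "c b - c b' \<noteq> 0" by auto
    show ?thesis
    proof (cases "?h b")
      case True
      then have "(c b - c b') * ?e = \<gamma> * ?z" using 1 False by (simp add: left_diff_distrib)
      then have "?e = \<gamma> * ?z / (c b - c b')" using ne by (simp add: field_simps)
      also have "\<dots> = - \<gamma> * (1 / (c b' - c b) * ?z)" using ne by (simp add: divide_simps) (simp add: algebra_simps)
      finally show ?thesis unfolding L limit_map_basis[OF b] using True False by simp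
    next
      case hi: False
      then have "(c b - c b') * ?e = - \<gamma> * ?z" using 1 False by (simp add: left_diff_distrib)
      then have "?e = - \<gamma> * (1 / (c b - c b') * ?z)" using ne by (simp add: field_simps)
      then show ?thesis unfolding L limit_map_basis[OF b] using hi False by simp
    qed
  qed
qed

text \<open>The diagonal entries of \<open>P\<close> in the eigenbasis lie between 0 and 1 and sum
  to \<open>p\<close>, and the gain is their sum weighted by the eigenvalues; it is largest only if
  the whole weight sits on the top \<open>p\<close> vectors. The hypotheses on \<open>P\<close> are
  equations because they are applied to a limit of projections, and equations pass to
  limits.\<close>

lemma top_proj_unique_max:
  fixes P :: "real ^ 'd ^ 'd"
  assumes P: "transpose P = P" "P ** P = P" "trace P = real p"
    and max: "trace (A ** top_proj) \<le> trace (A ** P)"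
  shows "P = top_proj"
proof -
  define x where "x b = b \<bullet> (P *v b)" for b
  have x_norm: "x b = (norm (P *v b))\<^sup>2" for b
    unfolding power2_norm_eq_inner x_def using P
    by (metis matrix_vector_mul_assoc symmetric_matrix_inner)
  have x01: "0 \<le> x b" "x b \<le> 1" if "b \<in> B" for b
  proof -
    show "0 \<le> x b" by (simp add: x_norm)
    have "norm b = 1" using that onb by (simp add: orthonormal_def)
    then have "x b \<le> norm (P *v b)" using norm_cauchy_schwarz[of b "P *v b"] by (simp add: x_def)
    then have *: "norm (P *v b) * norm (P *v b) \<le> 1 * norm (P *v b)" unfolding x_norm power2_eq_square by simp
    have "norm (P *v b) \<le> 1"
    proof (rule ccontr)
      assume "\<not> norm (P *v b) \<le> 1"
      then have "1 * norm (P *v b) < norm (P *v b) * norm (P *v b)" by (intro mult_strict_right_mono) auto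
      with * show False by simp
    qed
    then show "x b \<le> 1" unfolding x_norm by (simp add: power_le_one)
  qed
  let ?T = "{b\<in>B. \<mu> J \<le> c b}"
  have sx: "(\<Sum>b\<in>B. x b) = card ?T"
    using trace_orthonormal_basis[OF onb, of P] P(3) card_top by (simp add: x_def)
  have tP: "trace (A ** P) = (\<Sum>b\<in>B. c b * x b)"
    unfolding trace_orthonormal_basis[OF onb]
    by (intro sum.cong refl) (simp add: x_def symmetric_matrix_inner[OF sym] eig flip: matrix_vector_mul_assoc)
  have tT: "trace (A ** top_proj) = (\<Sum>b\<in>?T. c b)"
    unfolding top_proj_def trace_mult_proj_mat_span[OF top_orthonormal]
    using onb by (intro sum.cong refl) (auto simp: eig orthonormal_inner)
  \<comment> \<open>The distance of \<open>x b\<close> from its value 1 or 0 for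
    \<open>top_proj\<close>. Subtracting \<open>\<mu> J\<close> times the trace condition turns the
    loss of gain into the sum of the nonnegative terms
    \<open>\<bar>c b - \<mu> J\<bar> * y b\<close>.\<close>
  define y where "y b = (if \<mu> J \<le> c b then 1 - x b else x b)" for b
  have split: "(\<Sum>b\<in>B. f b * x b) = (\<Sum>b\<in>?T. f b) - (\<Sum>b\<in>B. (if \<mu> J \<le> c b then f b * y b else - f b * y b))" for f
  proof -
    have "(\<Sum>b\<in>?T. f b) = (\<Sum>b\<in>B. if \<mu> J \<le> c b then f b else 0)"
      using finB by (simp add: sum.inter_filter)
    then show ?thesis
      by (simp only: sum_subtractf[symmetric]) (intro sum.cong refl, simp add: y_def algebra_simps)
  qed
  have "(\<Sum>b\<in>B. \<mu> J * x b) = (\<Sum>b\<in>?T. \<mu> J)" unfolding sum_distrib_left[symmetric] sx by simp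
  then have "(\<Sum>b\<in>B. (if \<mu> J \<le> c b then \<mu> J * y b else - \<mu> J * y b)) = 0" using split[of "\<lambda>_. \<mu> J"] by simp
  moreover have "(\<Sum>b\<in>B. (if \<mu> J \<le> c b then c b * y b else - c b * y b)) \<le> 0"
    using max unfolding tP tT split by simp
  ultimately have "(\<Sum>b\<in>B. \<bar>c b - \<mu> J\<bar> * y b) \<le> 0"
  proof -
    have "(\<Sum>b\<in>B. \<bar>c b - \<mu> J\<bar> * y b) = (\<Sum>b\<in>B. (if \<mu> J \<le> c b then c b * y b else - c b * y b)) -
      (\<Sum>b\<in>B. (if \<mu> J \<le> c b then \<mu> J * y b else - \<mu> J * y b))"
      unfolding sum_subtractf[symmetric] by (intro sum.cong refl) (simp add: algebra_simps)
    then show ?thesis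
      using \<open>(\<Sum>b\<in>B. (if \<mu> J \<le> c b then \<mu> J * y b else - \<mu> J * y b)) = 0\<close>
        \<open>(\<Sum>b\<in>B. (if \<mu> J \<le> c b then c b * y b else - c b * y b)) \<le> 0\<close> by simp
  qed
  moreover have y0: "0 \<le> y b" if "b \<in> B" for b using x01[OF that] by (simp add: y_def)
  then have nn: "0 \<le> \<bar>c b - \<mu> J\<bar> * y b" if "b \<in> B" for b using that by simp
  ultimately have "(\<Sum>b\<in>B. \<bar>c b - \<mu> J\<bar> * y b) = 0" using sum_nonneg[of B "\<lambda>b. \<bar>c b - \<mu> J\<bar> * y b"] nn by fastforce
  then have z: "\<bar>c b - \<mu> J\<bar> * y b = 0" if "b \<in> B" for b
    using sum_nonneg_eq_0_iff[of B "\<lambda>b. \<bar>c b - \<mu> J\<bar> * y b"] finB nn that by blast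
  \<comment> \<open>A deviation at an eigenvalue equal to \<open>\<mu> J\<close> costs nothing, so
    at first only the low entries are settled; the trace then forces all top entries to be
    1.\<close>
  have low: "x b = 0" if "b \<in> B" "\<not> \<mu> J \<le> c b" for b using z[OF that(1)] that(2) by (auto simp: y_def)
  have "(\<Sum>b\<in>B. x b) = (\<Sum>b\<in>?T. x b)"
    using finB low by (intro sum.mono_neutral_right) auto
  then have "(\<Sum>b\<in>?T. 1 - x b) = 0" using sx by (simp add: sum_subtractf)
  then have high: "x b = 1" if "b \<in> B" "\<mu> J \<le> c b" for b
    using sum_nonneg_eq_0_iff[of ?T "\<lambda>b. 1 - x b"] finB x01 that by auto
  have "P *v b = top_proj *v b" if b: "b \<in> B" for b
  proof (cases "\<mu> J \<le> c b")
    case True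
    have "(norm (P *v b - b))\<^sup>2 = x b - 2 * x b + b \<bullet> b"
      unfolding power2_norm_eq_inner using x_norm[of b]
      by (simp add: inner_diff_left inner_diff_right x_def inner_commute power2_norm_eq_inner)
    also have "\<dots> = 0" using high[OF b True] orthonormal_inner[OF onb(1) b b] by simp
    finally show ?thesis using b True by (simp add: top_proj_basis)
  next
    case False
    then have "P *v b = 0" using low[OF b] x_norm[of b] by simp
    then show ?thesis using b False by (simp add: top_proj_basis)
  qed
  then show ?thesis by (intro matrix_eqI_basis) simp
qed

text \<open>Compactness with uniqueness in the limit: every limit point of the projections is a
  projection of trace \<open>p\<close> whose gain for \<open>A\<close> is at least that of
  \<open>top_proj\<close>, hence it is \<open>top_proj\<close>.\<close>

lemma maximizer_tendsto:
  fixes Bs :: "nat \<Rightarrow> real ^ 'd ^ 'd"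
  assumes lim: "Bs \<longlonglongrightarrow> A"
    and V: "\<And>i. is_arg_max (\<lambda>V. trace (Bs i ** proj_mat V)) (\<lambda>V. V \<in> subspaces_of_dim p) (V i)"
  shows "(\<lambda>i. proj_mat (V i)) \<longlonglongrightarrow> top_proj"
proof (rule tendsto_subseqI)
  fix s :: "nat \<Rightarrow> nat" assume s: "strict_mono s"
  have sub: "subspace (V i)" and dimV: "dim (V i) = p"
    and mx: "\<And>W. subspace W \<Longrightarrow> dim W = p \<Longrightarrow> trace (Bs i ** proj_mat W) \<le> trace (Bs i ** proj_mat (V i))" for i
    using V[of i] by (auto simp: is_arg_max_linorder subspaces_of_dim_def)
  have "bounded (range (\<lambda>i. proj_mat (V (s i))))"
    unfolding bounded_iff using norm_proj_mat_le[OF sub] by blast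
  then obtain P t where t: "strict_mono t" "((\<lambda>i. proj_mat (V (s i))) \<circ> t) \<longlonglongrightarrow> P"
    using bounded_imp_convergent_subsequence by blast
  then have lP: "(\<lambda>i. proj_mat (V (s (t i)))) \<longlonglongrightarrow> P" by (simp add: o_def)
  have lB: "(\<lambda>i. Bs (s (t i))) \<longlonglongrightarrow> A"
    using LIMSEQ_subseq_LIMSEQ[OF lim strict_mono_o[OF s t(1)]] by (simp add: o_def)
  have "(\<lambda>i. transpose (proj_mat (V (s (t i))))) \<longlonglongrightarrow> transpose P" by (intro tendsto_intros lP)
  then have 1: "transpose P = P" using lP by (simp add: proj_mat_symmetric[OF sub] LIMSEQ_unique)
  have "(\<lambda>i. proj_mat (V (s (t i))) ** proj_mat (V (s (t i)))) \<longlonglongrightarrow> P ** P" by (intro tendsto_intros lP)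
  then have 2: "P ** P = P" using lP by (simp add: proj_mat_idem[OF sub] LIMSEQ_unique)
  have "(\<lambda>i. trace (proj_mat (V (s (t i))))) \<longlonglongrightarrow> trace P" by (intro tendsto_intros lP)
  then have 3: "trace P = real p" by (simp add: trace_proj_mat[OF sub] dimV LIMSEQ_const_iff)
  have "trace (A ** top_proj) \<le> trace (A ** P)"
  proof (rule LIMSEQ_le)
    show "(\<lambda>i. trace (Bs (s (t i)) ** top_proj)) \<longlonglongrightarrow> trace (A ** top_proj)" by (intro tendsto_intros lB)
    show "(\<lambda>i. trace (Bs (s (t i)) ** proj_mat (V (s (t i))))) \<longlonglongrightarrow> trace (A ** P)" by (intro tendsto_intros lB lP)
    show "\<exists>N. \<forall>n\<ge>N. trace (Bs (s (t n)) ** top_proj) \<le> trace (Bs (s (t n)) ** proj_mat (V (s (t n))))"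
      unfolding top_proj_def using mx orthonormal_card[OF top_orthonormal] card_top by simp
  qed
  then have "P = top_proj" by (intro top_proj_unique_max 1 2 3)
  then show "\<exists>t. strict_mono t \<and> (\<lambda>i. proj_mat (V (s (t i)))) \<longlonglongrightarrow> top_proj"
    using t(1) lP by blast
qed

theorem projection_perturbation:
  fixes As Zs :: "nat \<Rightarrow> real ^ 'd ^ 'd" and \<kappa> :: "nat \<Rightarrow> real"
  assumes As: "As \<longlonglongrightarrow> A" "\<And>i. transpose (As i) = As i"
    and Zs: "Zs \<longlonglongrightarrow> z" "\<And>i. transpose (Zs i) = Zs i"
    and \<kappa>: "filterlim \<kappa> at_top sequentially" "\<And>i. \<kappa> i > 0"
    and V: "\<And>i. is_arg_max (\<lambda>V. trace ((As i + (1 / \<kappa> i) *\<^sub>R Zs i) ** proj_mat V)) (\<lambda>V. V \<in> subspaces_of_dim p) (V i)"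
    and W: "\<And>i. is_arg_max (\<lambda>V. trace (As i ** proj_mat V)) (\<lambda>V. V \<in> subspaces_of_dim p) (W i)"
  shows "(\<lambda>i. \<kappa> i *\<^sub>R (proj_mat (V i) - proj_mat (W i))) \<longlonglongrightarrow> - limit_map A \<mu> r J z"
proof -
  define Bs where "Bs i = As i + (1 / \<kappa> i) *\<^sub>R Zs i" for i
  have "(\<lambda>i. 1 / \<kappa> i) \<longlonglongrightarrow> 0"
    using tendsto_inverse_0_at_top[OF \<kappa>(1)] by (simp add: inverse_eq_divide)
  then have "Bs \<longlonglongrightarrow> A + 0 *\<^sub>R z" unfolding Bs_def by (intro tendsto_intros As Zs)
  then have Blim: "Bs \<longlonglongrightarrow> A" by simp
  have Bsym: "transpose (Bs i) = Bs i" for i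
    using As(2) Zs(2) by (simp add: Bs_def transpose_def vec_eq_iff)
  note V = V[folded Bs_def]
  define P where "P i = proj_mat (V i)" for i
  define P' where "P' i = proj_mat (W i)" for i
  define D where "D i = \<kappa> i *\<^sub>R (P i - P' i)" for i
  have sV: "subspace (V i)" "subspace (W i)" for i
    using V[of i] W[of i] by (auto simp: is_arg_max_linorder subspaces_of_dim_def)
  have lP: "P \<longlonglongrightarrow> top_proj" "P' \<longlonglongrightarrow> top_proj"
    unfolding P_def P'_def by (rule maximizer_tendsto[OF Blim V] maximizer_tendsto[OF As(1) W])+
  note bil = bounded_bilinear_matrix_mult
  note mult_simps = bounded_bilinear.diff_left[OF bil] bounded_bilinear.diff_right[OF bil]
    bounded_bilinear.add_left[OF bil] bounded_bilinear.add_right[OF bil]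
    bounded_bilinear.scaleR_left[OF bil] bounded_bilinear.scaleR_right[OF bil]
  \<comment> \<open>As \<open>Bs i\<close> commutes with \<open>P i\<close>, the commutator of
    \<open>As i\<close> with \<open>P i\<close> comes from the perturbation alone, and its factor
    \<open>1 / \<kappa> i\<close> cancels the scaling of \<open>D i\<close>.\<close>
  have com: "As i ** D i - D i ** As i = P i ** Zs i - Zs i ** P i" for i
  proof -
    have 1: "Bs i ** P i = P i ** Bs i" unfolding P_def by (rule trace_max_commute[OF Bsym V])
    have 2: "As i ** P' i = P' i ** As i" unfolding P'_def by (rule trace_max_commute[OF As(2) W])
    have A: "As i = Bs i - (1 / \<kappa> i) *\<^sub>R Zs i" by (simp add: Bs_def)
    have "As i ** D i - D i ** As i = \<kappa> i *\<^sub>R (As i ** P i - P i ** As i) - \<kappa> i *\<^sub>R (As i ** P' i - P' i ** As i)"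
      by (simp add: D_def mult_simps algebra_simps)
    also have "\<dots> = \<kappa> i *\<^sub>R (As i ** P i - P i ** As i)" by (simp add: 2)
    also have "As i ** P i - P i ** As i = (1 / \<kappa> i) *\<^sub>R (P i ** Zs i - Zs i ** P i)"
      unfolding A by (simp add: mult_simps 1 scaleR_diff_right)
    finally show ?thesis using \<kappa>(2)[of i] by simp
  qed
  \<comment> \<open>By idempotence, \<open>P ** (P - P') + (P - P') ** P' = P - P'\<close>.\<close>
  have off: "P i ** D i + D i ** P' i = D i" for i
    using proj_mat_idem[OF sV(1)[of i]] proj_mat_idem[OF sV(2)[of i]]
    by (simp add: D_def P_def P'_def mult_simps algebra_simps)
  have "D \<longlonglongrightarrow> - limit_map A \<mu> r J z"
  proof (rule tendsto_subseqI)
    fix s :: "nat \<Rightarrow> nat" assume s: "strict_mono s"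
    txt \<open>The normalization makes the sequence relatively compact; that \<open>D\<close> itself is bounded follows
      because the limit equations with \<open>\<gamma> = 0\<close> have only the zero solution.\<close>
    define h where "h i = 1 / max 1 (norm (D i))" for i
    define E where "E i = h i *\<^sub>R D i" for i
    have h: "0 < h i" "h i \<le> 1" for i unfolding h_def by (auto simp: divide_le_eq_1)
    have E1: "norm (E i) \<le> 1" for i by (simp add: E_def h_def)
    have "bounded (range (\<lambda>i. (E (s i), h (s i))))"
      unfolding bounded_iff
    proof (intro exI ballI)
      fix x assume "x \<in> range (\<lambda>i. (E (s i), h (s i)))"
      then obtain i where "x = (E (s i), h (s i))" by blast
      then show "norm x \<le> 1 + 1"
        using norm_Pair_le[of "E (s i)" "h (s i)"] E1[of "s i"] h[of "s i"] by auto
    qed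
    then obtain x t where t: "strict_mono t" "((\<lambda>i. (E (s i), h (s i))) \<circ> t) \<longlonglongrightarrow> x"
      using bounded_imp_convergent_subsequence by blast
    obtain F \<gamma> where x: "x = (F, \<gamma>)" by (cases x)
    define q where "q i = s (t i)" for i
    have q: "strict_mono q" using strict_mono_o[OF s t(1)] by (simp add: o_def q_def[abs_def])
    have lim: "(\<lambda>i. E (q i)) \<longlonglongrightarrow> F" "(\<lambda>i. h (q i)) \<longlonglongrightarrow> \<gamma>"
      using tendsto_fst[OF t(2)] tendsto_snd[OF t(2)] by (auto simp: x o_def q_def)
    have subs: "(\<lambda>i. f (q i)) \<longlonglongrightarrow> l" if "f \<longlonglongrightarrow> l" for f :: "nat \<Rightarrow> real ^ 'd ^ 'd" and l
      using LIMSEQ_subseq_LIMSEQ[OF that q] by (simp add: o_def)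
    note lims = lim subs[OF As(1)] subs[OF Zs(1)] subs[OF lP(1)] subs[OF lP(2)]
    have "As i ** E i - E i ** As i = h i *\<^sub>R (P i ** Zs i - Zs i ** P i)" for i
      unfolding com[symmetric] by (simp add: E_def mult_simps scaleR_diff_right)
    moreover have "(\<lambda>i. As (q i) ** E (q i) - E (q i) ** As (q i)) \<longlonglongrightarrow> A ** F - F ** A"
      by (intro tendsto_intros lims)
    moreover have "(\<lambda>i. h (q i) *\<^sub>R (P (q i) ** Zs (q i) - Zs (q i) ** P (q i))) \<longlonglongrightarrow>
        \<gamma> *\<^sub>R (top_proj ** z - z ** top_proj)"
      by (intro tendsto_intros lims)
    ultimately have eq1: "A ** F - F ** A = \<gamma> *\<^sub>R (top_proj ** z - z ** top_proj)"
      by (simp add: LIMSEQ_unique)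
    have "P i ** E i + E i ** P' i = E i" for i
    proof -
      have "P i ** E i + E i ** P' i = h i *\<^sub>R (P i ** D i + D i ** P' i)"
        by (simp add: E_def mult_simps scaleR_add_right)
      then show ?thesis by (simp add: off E_def)
    qed
    moreover have "(\<lambda>i. P (q i) ** E (q i) + E (q i) ** P' (q i)) \<longlonglongrightarrow> top_proj ** F + F ** top_proj"
      by (intro tendsto_intros lims)
    ultimately have eq2: "top_proj ** F + F ** top_proj = F" using lim(1) by (simp add: LIMSEQ_unique)
    have F: "F = (- \<gamma>) *\<^sub>R limit_map A \<mu> r J z" by (rule perturbation_equation_unique[OF eq1 eq2])
    have "\<gamma> \<noteq> 0"
    proof
      assume "\<gamma> = 0"
      then have "F = 0" using F by simp
      have "\<forall>\<^sub>F i in sequentially. h (q i) < 1" using lim(2) \<open>\<gamma> = 0\<close> by (simp add: order_tendstoD)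
      then have "\<forall>\<^sub>F i in sequentially. norm (E (q i)) = 1"
      proof eventually_elim
        case (elim i)
        then have "norm (D (q i)) > 1" by (auto simp: h_def max_def divide_less_eq_1 split: if_splits)
        moreover from this have "D (q i) \<noteq> 0" by auto
        ultimately show ?case by (simp add: E_def h_def)
      qed
      then have "(\<lambda>i. norm (E (q i))) \<longlonglongrightarrow> 1" by (rule tendsto_eventually)
      moreover have "(\<lambda>i. norm (E (q i))) \<longlonglongrightarrow> norm F" by (intro tendsto_intros lims)
      ultimately show False using \<open>F = 0\<close> LIMSEQ_unique by fastforce
    qed
    then have "(\<lambda>i. inverse (h (q i)) *\<^sub>R E (q i)) \<longlonglongrightarrow> inverse \<gamma> *\<^sub>R F" by (intro tendsto_intros lims)
    moreover have "inverse (h i) *\<^sub>R E i = D i" for i using h(1)[of i] by (simp add: E_def)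
    moreover have "inverse \<gamma> *\<^sub>R F = - limit_map A \<mu> r J z" using \<open>\<gamma> \<noteq> 0\<close> by (simp add: F)
    ultimately show "\<exists>t. strict_mono t \<and> (\<lambda>i. D (s (t i))) \<longlonglongrightarrow> - limit_map A \<mu> r J z"
      using t(1) by (auto simp: q_def)
  qed
  then show ?thesis by (simp add: D_def[abs_def] P_def P'_def)
qed

end

section \<open>Order statistics\<close>

text \<open>A real-valued sum in place of a cardinality, so that measurability in \<open>x\<close>
  and in the level follows from that of sums.\<close>

definition exceedances :: "('a \<Rightarrow> real) \<Rightarrow> nat set \<Rightarrow> real \<Rightarrow> (nat \<Rightarrow> 'a) \<Rightarrow> real" where
  "exceedances R K u x = (\<Sum>i\<in>K. if u < R (x i) then 1 else 0)"

lemma exceedances_card: "finite K \<Longrightarrow> exceedances R K u x = real (card {i\<in>K. u < R (x i)})"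
  by (simp add: exceedances_def sum.inter_filter[symmetric])

lemma prod_choice_indicator:
  fixes g :: "nat \<Rightarrow> complex"
  assumes "finite I" "S \<subseteq> I"
  shows "(\<Prod>i\<in>I. if i \<in> S then (if Q i then g i else 0) else (if Q i then 0 else 1)) =
    (if S = {i\<in>I. Q i} then \<Prod>i\<in>I. (if Q i then g i else 1) else 0)"
proof (cases "S = {i\<in>I. Q i}")
  case True
  then show ?thesis by (auto intro!: prod.cong)
next
  case False
  then obtain i where "i \<in> I" "i \<in> S \<longleftrightarrow> \<not> Q i" using assms(2) by blast
  then have "\<exists>i\<in>I. (if i \<in> S then (if Q i then g i else 0) else (if Q i then 0 else 1)) = 0"
    by (intro bexI[of _ i]) auto
  then show ?thesis using False assms(1) by (simp add: prod_zero_iff)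
qed

text \<open>Splitting according to which indices exceed \<open>u\<close> turns the event of exactly
  \<open>k\<close> exceedances into a sum of products of functions of single coordinates, which
  integrate separately. Only the actual set of exceeding indices contributes.\<close>

lemma exceedances_sum_subsets:
  fixes g :: "'a \<Rightarrow> complex"
  assumes "finite I"
  shows "(if exceedances R I u x = real k then \<Prod>i\<in>I. (if u < R (x i) then g (x i) else 1) else 0) =
    (\<Sum>S | S \<subseteq> I \<and> card S = k. \<Prod>i\<in>I. if i \<in> S then (if u < R (x i) then g (x i) else 0) else (if u < R (x i) then 0 else 1))"
proof -
  let ?T = "{i\<in>I. u < R (x i)}"
  have "(\<Sum>S | S \<subseteq> I \<and> card S = k. \<Prod>i\<in>I. if i \<in> S then (if u < R (x i) then g (x i) else 0) else (if u < R (x i) then 0 else 1)) =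
     (\<Sum>S | S \<subseteq> I \<and> card S = k. if S = ?T then \<Prod>i\<in>I. (if u < R (x i) then g (x i) else 1) else 0)"
    by (intro sum.cong refl prod_choice_indicator assms) auto
  also have "\<dots> = (if card ?T = k then \<Prod>i\<in>I. (if u < R (x i) then g (x i) else 1) else 0)"
    using assms by (subst sum.delta) auto
  finally show ?thesis using assms by (simp add: exceedances_card)
qed

text \<open>Counted from 0 at the largest value: without ties, the \<open>(k + 1)\<close>-th largest
  has rank \<open>k\<close>, and the points above it are those of rank below
  \<open>k\<close>.\<close>

definition rank :: "('a \<Rightarrow> real) \<Rightarrow> nat set \<Rightarrow> (nat \<Rightarrow> 'a) \<Rightarrow> nat \<Rightarrow> nat" where
  "rank R K x i = card {l\<in>K. R (x i) < R (x l)}"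

lemma rank_less:
  assumes "finite K" "i \<in> K" "R (x j) < R (x i)"
  shows "rank R K x i < rank R K x j"
  unfolding rank_def using assms by (intro psubset_card_mono) auto

lemma rank_bij:
  assumes K: "finite K" and inj: "inj_on (\<lambda>i. R (x i)) K"
  shows "bij_betw (rank R K x) K {..<card K}"
proof -
  have "inj_on (rank R K x) K"
  proof (rule inj_onI, rule ccontr)
    fix i j assume ij: "i \<in> K" "j \<in> K" "rank R K x i = rank R K x j" "i \<noteq> j"
    then have "R (x i) \<noteq> R (x j)" using inj by (auto simp: inj_on_def)
    then consider "R (x i) < R (x j)" | "R (x j) < R (x i)" by linarith
    then show False
    proof cases
      case 1
      from rank_less[where R=R and x=x, OF K ij(2) 1] ij(3) show False by simp
    next
      case 2
      from rank_less[where R=R and x=x, OF K ij(1) 2] ij(3) show False by simp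
    qed
  qed
  moreover have "rank R K x i < card K" if "i \<in> K" for i
    unfolding rank_def using that by (intro psubset_card_mono K psubsetI) auto
  then have "rank R K x ` K \<subseteq> {..<card K}" by auto
  ultimately show ?thesis
    unfolding bij_betw_def by (simp add: card_image card_subset_eq)
qed

lemma exceedances_eq_rank:
  assumes "finite K"
  shows "exceedances R (K - {j}) (R (x j)) x = real (rank R K x j)"
proof -
  have "{i \<in> K - {j}. R (x j) < R (x i)} = {i \<in> K. R (x j) < R (x i)}" by auto
  then show ?thesis using assms by (simp add: exceedances_card rank_def)
qed

text \<open>Ranks are a bijection when there are no ties, so exactly one index has rank
  \<open>k\<close>. The last clause lets a sum over all candidate indices stand for the order
  statistic: its condition compares the candidate with the other points only, which suits
  integration with the candidate held fixed.\<close>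

lemma order_statistic_obtain:
  assumes K: "finite K" and inj: "inj_on (\<lambda>i. R (x i)) K" and k: "k < card K"
  obtains j where "j \<in> K" "rank R K x j = k" "\<And>i. i \<in> K \<Longrightarrow> R (x j) < R (x i) \<longleftrightarrow> rank R K x i < k"
    "\<And>f :: nat \<Rightarrow> complex. (\<Sum>i\<in>K. if exceedances R (K - {i}) (R (x i)) x = real k then f i else 0) = f j"
proof -
  have bij: "bij_betw (rank R K x) K {..<card K}" by (rule rank_bij[where R=R and x=x, OF K inj])
  then obtain j where j: "j \<in> K" "rank R K x j = k"
    using k by (metis bij_betw_imp_surj_on imageE lessThan_iff)
  have eq: "i = j" if "i \<in> K" "rank R K x i = k" for i
    by (rule inj_onD[OF bij_betw_imp_inj_on[OF bij]]) (use that j in simp_all)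
  have gt: "R (x j) < R (x i) \<longleftrightarrow> rank R K x i < k" if i: "i \<in> K" for i
  proof (cases "i = j")
    case True
    then show ?thesis using j by simp
  next
    case False
    then have "R (x i) \<noteq> R (x j)" using inj i j(1) by (auto simp: inj_on_def)
    then consider "R (x i) < R (x j)" | "R (x j) < R (x i)" by linarith
    then show ?thesis
    proof cases
      case 1
      from rank_less[where R=R and x=x, OF K j(1) 1] 1 j(2) show ?thesis by simp
    next
      case 2
      from rank_less[where R=R and x=x, OF K i 2] 2 j(2) show ?thesis by simp
    qed
  qed
  have "(\<Sum>i\<in>K. if exceedances R (K - {i}) (R (x i)) x = real k then f i else 0) = f j" for f :: "nat \<Rightarrow> complex"
  proof -
    have "(\<Sum>i\<in>K. if exceedances R (K - {i}) (R (x i)) x = real k then f i else 0) = (\<Sum>i\<in>K. if i = j then f i else 0)"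
    proof (intro sum.cong refl)
      fix i assume "i \<in> K"
      then show "(if exceedances R (K - {i}) (R (x i)) x = real k then f i else 0) = (if i = j then f i else 0)"
        using eq[of i] j(2) by (cases "i = j") (auto simp: exceedances_eq_rank[OF K])
    qed
    then show ?thesis using K j(1) by (simp add: sum.delta)
  qed
  note sum_eq = this
  show thesis by (rule that[OF j gt sum_eq])
qed

section \<open>Product samples and conditioning on an order statistic\<close>

context prob_space
begin

abbreviation sample :: "nat set \<Rightarrow> (nat \<Rightarrow> 'a) measure" where
  "sample K \<equiv> PiM K (\<lambda>_. M)"

lemma prob_space_sample: "prob_space (sample K)"
  by (intro prob_space_PiM prob_space_axioms)

lemma product_sigma_finite_sample: "product_sigma_finite (\<lambda>_::nat. M)"
  by (simp add: product_sigma_finite_def sigma_finite_measure_axioms)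

definition tail :: "('a \<Rightarrow> real) \<Rightarrow> real \<Rightarrow> real" where
  "tail R u = prob {x\<in>space M. u < R x}"

text \<open>The conditional expectation of \<open>g\<close> given \<open>u < R\<close>.\<close>

definition tail_mean :: "('a \<Rightarrow> real) \<Rightarrow> ('a \<Rightarrow> complex) \<Rightarrow> real \<Rightarrow> complex" where
  "tail_mean R g u = (\<integral>x. (if u < R x then g x else 0) \<partial>M) / complex_of_real (tail R u)"

text \<open>Given that exactly \<open>k\<close> of the sample points exceed \<open>u\<close>, these are i.i.d. with the law of
  an exceedance.\<close>

lemma integral_exceedances:
  fixes g :: "'a \<Rightarrow> complex"
  assumes I: "finite I" and R[measurable]: "R \<in> borel_measurable M" and g[measurable]: "g \<in> borel_measurable M"
    and gb: "\<And>x. norm (g x) \<le> 1" and t: "tail R u > 0"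
  shows "(\<integral>x. (if exceedances R I u x = real k then \<Prod>i\<in>I. (if u < R (x i) then g (x i) else 1) else 0) \<partial>sample I) =
    tail_mean R g u ^ k * (\<integral>x. (if exceedances R I u x = real k then 1 else 0) \<partial>sample I)"
proof -
  interpret product_sigma_finite "\<lambda>_::nat. M" by (rule product_sigma_finite_sample)
  \<comment> \<open>For arbitrary \<open>g\<close>, because the constant function 1 gives the
    probability of exactly \<open>k\<close> exceedances as the same sum over subsets; the quotient
    of the two is the power of \<open>tail_mean\<close>.\<close>
  have main: "(\<integral>x. (if exceedances R I u x = real k then \<Prod>i\<in>I. (if u < R (x i) then g (x i) else 1) else 0) \<partial>sample I) =
      (\<Sum>S | S \<subseteq> I \<and> card S = k. (\<integral>x. (if u < R x then g x else 0) \<partial>M) ^ k * (\<integral>x. (if u < R x then 0 else 1) \<partial>M) ^ (card I - k))"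
    if [measurable]: "g \<in> borel_measurable M" and gb: "\<And>x. norm (g x) \<le> 1" for g :: "'a \<Rightarrow> complex"
  proof -
    let ?f = "\<lambda>S i x. if i \<in> S then (if u < R x then g x else 0) else (if u < R x then 0 else 1)"
    have int: "integrable M (?f S i)" for S and i :: nat
      by (rule integrable_const_bound[of _ 1]) (use gb in auto)
    have ip: "integrable (sample I) (\<lambda>x. \<Prod>i\<in>I. ?f S i (x i))" for S
      by (rule product_integrable_prod[OF I int])
    have "(\<integral>x. (\<Prod>i\<in>I. ?f S i (x i)) \<partial>sample I) =
        (\<integral>x. (if u < R x then g x else 0) \<partial>M) ^ k * (\<integral>x. (if u < R x then 0 else 1) \<partial>M) ^ (card I - k)"
      if S: "S \<subseteq> I" "card S = k" for S
    proof -
      have "(\<integral>x. (\<Prod>i\<in>I. ?f S i (x i)) \<partial>sample I) = (\<Prod>i\<in>I. \<integral>x. ?f S i x \<partial>M)"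
        by (rule product_integral_prod[OF I int])
      also have "\<dots> = (\<Prod>i\<in>I. if i \<in> S then (\<integral>x. (if u < R x then g x else 0) \<partial>M) else (\<integral>x. (if u < R x then 0 else 1) \<partial>M))"
        by (intro prod.cong) auto
      also have "\<dots> = (\<integral>x. (if u < R x then g x else 0) \<partial>M) ^ card (I \<inter> S) * (\<integral>x. (if u < R x then 0 else 1) \<partial>M) ^ card (I \<inter> - S)"
        using I by (simp add: prod.If_cases)
      moreover have "I \<inter> S = S" "I \<inter> - S = I - S" using S by auto
      ultimately show ?thesis using S I by (simp add: card_Diff_subset finite_subset)
    qed
    then show ?thesis
      unfolding exceedances_sum_subsets[OF I]
      by (subst Bochner_Integration.integral_sum[OF ip]) (auto intro!: sum.cong)
  qed
  have "(\<integral>x. (if u < R x then 1 else 0) \<partial>M) = complex_of_real (\<integral>x. indicator {x\<in>space M. u < R x} x \<partial>M)"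
    unfolding integral_complex_of_real[symmetric]
    by (intro Bochner_Integration.integral_cong) (auto simp: indicator_def)
  then have "(\<integral>x. (if u < R x then 1 else 0) \<partial>M) = complex_of_real (tail R u)"
    by (simp add: tail_def)
  then have "(\<integral>x. (if u < R x then g x else 0) \<partial>M) = tail_mean R g u * (\<integral>x. (if u < R x then 1 else 0) \<partial>M)"
    using t by (simp add: tail_mean_def)
  moreover have "(\<integral>x. (if exceedances R I u x = real k then 1 else 0) \<partial>sample I) =
      (\<Sum>S | S \<subseteq> I \<and> card S = k. (\<integral>x. (if u < R x then 1 else 0) \<partial>M) ^ k * (\<integral>x. (if u < R x then 0 else 1 :: complex) \<partial>M) ^ (card I - k))"
    using main[of "\<lambda>_. 1"] by (simp only: if_cancel prod.neutral_const) simp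
  ultimately show ?thesis
    unfolding main[OF g gb] by (simp add: power_mult_distrib)
qed

lemma exceedances_measurable:
  assumes [measurable]: "R \<in> borel_measurable M" and "finite I" "I \<subseteq> K" "j \<in> K"
  shows "(\<lambda>x. exceedances R I (R (x j)) x) \<in> borel_measurable (sample K)"
    "(\<lambda>x. exceedances R I u x) \<in> borel_measurable (sample K)"
proof -
  have Rm: "(\<lambda>x. R (x i)) \<in> borel_measurable (sample K)" if "i \<in> K" for i
    by (rule measurable_compose[OF measurable_component_singleton[OF that] assms(1)])
  note [measurable] = Rm[OF \<open>j \<in> K\<close>]
  show "(\<lambda>x. exceedances R I (R (x j)) x) \<in> borel_measurable (sample K)"
    "(\<lambda>x. exceedances R I u x) \<in> borel_measurable (sample K)"
    unfolding exceedances_def using assms(3,4) by (auto intro!: borel_measurable_sum measurable_If borel_measurable_less Rm)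
qed

lemma tail_eq: 
  assumes [measurable]: "R \<in> borel_measurable M"
  shows "tail R u = (\<integral>x. (if u < R x then 1 else 0) \<partial>M)"
proof -
  have "tail R u = (\<integral>x. indicator {x\<in>space M. u < R x} x \<partial>M)" by (simp add: tail_def)
  also have "\<dots> = (\<integral>x. (if u < R x then 1 else 0) \<partial>M)"
    by (intro Bochner_Integration.integral_cong) (auto simp: indicator_def)
  finally show ?thesis .
qed

lemma tail_mean_measurable:
  assumes [measurable]: "R \<in> borel_measurable M" "g \<in> borel_measurable M"
  shows "tail_mean R g \<in> borel_measurable borel"
proof -
  have 1: "(\<lambda>u. \<integral>x. (if u < R x then g x else 0) \<partial>M) \<in> borel_measurable borel"
    by (rule borel_measurable_lebesgue_integral) measurable
  have 2: "(\<lambda>u. \<integral>x. (if u < R x then 1 else 0 :: real) \<partial>M) \<in> borel_measurable borel"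
    by (rule borel_measurable_lebesgue_integral) measurable
  show ?thesis
    unfolding tail_mean_def[abs_def] tail_eq[OF assms(1)] using 1 2 by measurable
qed

lemma norm_tail_mean_le:
  assumes [measurable]: "R \<in> borel_measurable M" "g \<in> borel_measurable M"
    and gb: "\<And>x. norm (g x) \<le> 1" and t: "tail R u > 0"
  shows "norm (tail_mean R g u) \<le> 1"
proof -
  have "norm (\<integral>x. (if u < R x then g x else 0) \<partial>M) \<le> (\<integral>x. (if u < R x then 1 else 0) \<partial>M)"
    by (rule order_trans[OF integral_norm_bound])
       (auto intro!: integral_mono integrable_const_bound[of _ 1] simp: gb)
  then show ?thesis
    using t by (simp add: tail_mean_def tail_eq norm_divide divide_le_eq)
qed

lemma sample_component_measurable:
  assumes "R \<in> measurable M N" "i \<in> K"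
  shows "(\<lambda>x. R (x i)) \<in> measurable (sample K) N"
  by (rule measurable_compose[OF measurable_component_singleton[OF assms(2)] assms(1)])

text \<open>Fubini with coordinate \<open>j\<close> outermost, so that the level
  \<open>R (x j)\<close> is frozen while the other points are integrated.\<close>

lemma integral_sample_split:
  fixes f :: "_ \<Rightarrow> 'b :: {banach, second_countable_topology}"
  assumes K: "finite K" "j \<in> K" and f: "integrable (sample K) f"
    and eq: "\<And>x y. f (merge {j} (K - {j}) (x, y)) = h (x j) y"
    and h: "(\<lambda>x. \<integral>y. h x y \<partial>sample (K - {j})) \<in> borel_measurable M"
  shows "(\<integral>x. f x \<partial>sample K) = (\<integral>x. \<integral>y. h x y \<partial>sample (K - {j}) \<partial>M)"
proof -
  interpret product_sigma_finite "\<lambda>_::nat. M" by (rule product_sigma_finite_sample)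
  have "(\<integral>x. f x \<partial>sample K) = (\<integral>x. \<integral>y. f (merge {j} (K - {j}) (x, y)) \<partial>sample (K - {j}) \<partial>sample {j})"
    using product_integral_fold[of "{j}" "K - {j}" f] K f by (simp add: insert_absorb)
  also have "\<dots> = (\<integral>x. (\<integral>y. h (x j) y \<partial>sample (K - {j})) \<partial>sample {j})" by (simp add: eq)
  also have "\<dots> = (\<integral>x. \<integral>y. h x y \<partial>sample (K - {j}) \<partial>M)"
    by (rule product_integral_singleton[OF h])
  finally show ?thesis .
qed

lemma sample_splits_measurable:
  assumes "R \<in> borel_measurable M" "finite I"
  shows "(\<lambda>(x, y). exceedances R I (R x) y) \<in> borel_measurable (M \<Otimes>\<^sub>M sample I)"
    "\<And>g :: 'a \<Rightarrow> complex. g \<in> borel_measurable M \<Longrightarrow>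
      (\<lambda>(x, y). \<Prod>i\<in>I. if R x < R (y i) then g (y i) else 1) \<in> borel_measurable (M \<Otimes>\<^sub>M sample I)"
proof -
  have c: "(\<lambda>p. f (snd p i)) \<in> borel_measurable (M \<Otimes>\<^sub>M sample I)"
    if "f \<in> borel_measurable M" "i \<in> I" for f :: "'a \<Rightarrow> 'c::topological_space" and i
    by (rule measurable_compose[OF measurable_snd]) (rule sample_component_measurable[OF that])
  have R1: "(\<lambda>p. R (fst p)) \<in> borel_measurable (M \<Otimes>\<^sub>M sample I)"
    by (rule measurable_compose[OF measurable_fst assms(1)])
  show "(\<lambda>(x, y). exceedances R I (R x) y) \<in> borel_measurable (M \<Otimes>\<^sub>M sample I)"
    unfolding exceedances_def case_prod_beta
    by (auto intro!: borel_measurable_sum measurable_If borel_measurable_less R1 c assms)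
  show "(\<lambda>(x, y). \<Prod>i\<in>I. if R x < R (y i) then g (y i) else 1) \<in> borel_measurable (M \<Otimes>\<^sub>M sample I)"
    if "g \<in> borel_measurable M" for g :: "'a \<Rightarrow> complex"
    unfolding case_prod_beta
    by (auto intro!: borel_measurable_prod measurable_If borel_measurable_less R1 c assms that)
qed

text \<open>With the level \<open>R (x j)\<close> frozen, the remaining points are still an i.i.d.
  sample and \<open>integral_exceedances\<close> applies to them. The power of
  \<open>tail_mean\<close> stays under the integral, evaluated at the random level.\<close>

lemma integral_order_statistic:
  fixes g :: "'a \<Rightarrow> complex" and k :: nat
  assumes K: "finite K" "j \<in> K" and R: "R \<in> borel_measurable M" and g: "g \<in> borel_measurable M"
    and gb: "\<And>x. norm (g x) \<le> 1" and t: "\<And>u. tail R u > 0"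
  defines "I \<equiv> K - {j}"
  defines "F \<equiv> \<lambda>x. if exceedances R I (R (x j)) x = real k then \<Prod>i\<in>I. (if R (x j) < R (x i) then g (x i) else 1) else 0"
    and "G \<equiv> \<lambda>x. if exceedances R I (R (x j)) x = real k then tail_mean R g (R (x j)) ^ k else 0"
  shows "integrable (sample K) F" "integrable (sample K) G" "(\<integral>x. F x \<partial>sample K) = (\<integral>x. G x \<partial>sample K)"
proof -
  interpret S: prob_space "sample K" by (rule prob_space_sample)
  interpret SI: prob_space "sample I" by (rule prob_space_sample)
  have I: "finite I" "I \<subseteq> K" "j \<notin> I" using K by (auto simp: I_def)
  note [measurable] = R g exceedances_measurable(1)[OF R I(1,2) K(2)] sample_component_measurable[OF R K(2)]
    tail_mean_measurable[OF R g] sample_splits_measurable[OF R I(1)]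
  have m: "(\<lambda>x. \<Prod>i\<in>I. (if R (x j) < R (x i) then g (x i) else 1)) \<in> borel_measurable (sample K)"
  proof (intro borel_measurable_prod measurable_If borel_measurable_const)
    fix i assume "i \<in> I"
    then have "i \<in> K" using I by auto
    then show "(\<lambda>x. g (x i)) \<in> borel_measurable (sample K)" by (rule sample_component_measurable[OF g])
    show "{x \<in> space (sample K). R (x j) < R (x i)} \<in> sets (sample K)"
      using sample_component_measurable[OF R \<open>i \<in> K\<close>] by measurable
  qed
  note m[measurable]
  have pb: "norm (\<Prod>i\<in>I. (if Q i then g (x i) else 1)) \<le> 1" for Q and x :: "nat \<Rightarrow> 'a"
    unfolding prod_norm[symmetric] by (intro prod_le_1) (auto simp: gb)
  have tb: "norm (tail_mean R g u ^ k) \<le> 1" for u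
    unfolding norm_power by (intro power_le_one norm_tail_mean_le R g gb t) simp
  show iF: "integrable (sample K) F" unfolding F_def
    by (rule S.integrable_const_bound[of _ 1]) (use pb in auto)
  show iG: "integrable (sample K) G" unfolding G_def
    by (rule S.integrable_const_bound[of _ 1]) (use tb in auto)
  have mj: "merge {j} I (x, y) j = x j" for x y by (simp add: merge_def)
  have mi: "merge {j} I (x, y) i = y i" if "i \<in> I" for i x y using that I by (auto simp: merge_def)
  have exm: "exceedances R I u (merge {j} I (x, y)) = exceedances R I u y" for u x y
    unfolding exceedances_def using I by (intro sum.cong) (auto simp: merge_def)
  have "(\<integral>x. F x \<partial>sample K) = (\<integral>x. \<integral>y. (if exceedances R I (R x) y = real k then \<Prod>i\<in>I. (if R x < R (y i) then g (y i) else 1) else 0) \<partial>sample I \<partial>M)"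
    unfolding I_def
  proof (rule integral_sample_split[OF K iF], fold I_def)
    show "F (merge {j} I (x, y)) = (if exceedances R I (R (x j)) y = real k then \<Prod>i\<in>I. (if R (x j) < R (y i) then g (y i) else 1) else 0)" for x y
    proof -
      have "(\<Prod>i\<in>I. if R (x j) < R (merge {j} I (x, y) i) then g (merge {j} I (x, y) i) else 1) =
        (\<Prod>i\<in>I. if R (x j) < R (y i) then g (y i) else 1)"
        by (intro prod.cong refl) (simp add: mi)
      then show ?thesis unfolding F_def exm mj by simp
    qed
    show "(\<lambda>x. \<integral>y. (if exceedances R I (R x) y = real k then \<Prod>i\<in>I. (if R x < R (y i) then g (y i) else 1) else 0) \<partial>sample I) \<in> borel_measurable M"
      by (rule SI.borel_measurable_lebesgue_integral) measurable
  qed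
  also have "\<dots> = (\<integral>x. \<integral>y. (if exceedances R I (R x) y = real k then tail_mean R g (R x) ^ k else 0) \<partial>sample I \<partial>M)"
  proof (rule Bochner_Integration.integral_cong[OF refl])
    fix x
    have "(\<integral>y. (if exceedances R I (R x) y = real k then tail_mean R g (R x) ^ k else 0) \<partial>sample I) =
      (\<integral>y. tail_mean R g (R x) ^ k * (if exceedances R I (R x) y = real k then 1 else 0) \<partial>sample I)"
      by (intro Bochner_Integration.integral_cong) auto
    also have "\<dots> = tail_mean R g (R x) ^ k * (\<integral>y. (if exceedances R I (R x) y = real k then 1 else 0) \<partial>sample I)"
      by (rule integral_mult_right_zero)
    finally show "(\<integral>y. (if exceedances R I (R x) y = real k then \<Prod>i\<in>I. (if R x < R (y i) then g (y i) else 1) else 0) \<partial>sample I) =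
      (\<integral>y. (if exceedances R I (R x) y = real k then tail_mean R g (R x) ^ k else 0) \<partial>sample I)"
      using integral_exceedances[OF I(1) R g gb t] by simp
  qed
  also have "\<dots> = (\<integral>x. G x \<partial>sample K)"
    unfolding I_def
  proof (rule integral_sample_split[OF K iG, symmetric], fold I_def)
    show "G (merge {j} I (x, y)) = (if exceedances R I (R (x j)) y = real k then tail_mean R g (R (x j)) ^ k else 0)" for x y
      unfolding G_def exm mj ..
    show "(\<lambda>x. \<integral>y. (if exceedances R I (R x) y = real k then tail_mean R g (R x) ^ k else 0) \<partial>sample I) \<in> borel_measurable M"
      by (rule SI.borel_measurable_lebesgue_integral) measurable
  qed
  finally show "(\<integral>x. F x \<partial>sample K) = (\<integral>x. G x \<partial>sample K)" .
qed

text \<open>By Fubini the probability that two given points tie is a mean of probabilities of single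
  values of \<open>R\<close>, which vanish.\<close>

lemma AE_no_ties:
  fixes R :: "'a \<Rightarrow> real"
  assumes K: "finite K" and R[measurable]: "R \<in> borel_measurable M"
    and atomless: "\<And>v. prob {x\<in>space M. R x = v} = 0"
  shows "AE x in sample K. inj_on (\<lambda>i. R (x i)) K"
proof -
  interpret S: prob_space "sample K" by (rule prob_space_sample)
  have "AE x in sample K. R (x i) \<noteq> R (x j)" if ij: "i \<in> K" "j \<in> K" "i \<noteq> j" for i j
  proof -
    interpret SI: prob_space "sample (K - {i})" by (rule prob_space_sample)
    let ?f = "\<lambda>x. if R (x i) = R (x j) then 1 else 0 :: real"
    note [measurable] = sample_component_measurable[OF R ij(1)] sample_component_measurable[OF R ij(2)]
    have "?f \<in> borel_measurable (sample K)" by measurable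
    then have int: "integrable (sample K) ?f" by (intro S.integrable_const_bound[of _ 1]) auto
    interpret product_sigma_finite "\<lambda>_::nat. M" by (rule product_sigma_finite_sample)
    have "(\<integral>x. ?f x \<partial>sample K) = (\<integral>x. \<integral>y. ?f (x(i := y)) \<partial>M \<partial>sample (K - {i}))"
      using product_integral_insert[of "K - {i}" i ?f] K int ij by (simp add: insert_absorb)
    also have "\<dots> = (\<integral>x. prob {y\<in>space M. R y = R (x j)} \<partial>sample (K - {i}))"
    proof (rule Bochner_Integration.integral_cong[OF refl])
      fix x
      have "(\<integral>y. ?f (x(i := y)) \<partial>M) = (\<integral>y. indicator {y\<in>space M. R y = R (x j)} y \<partial>M)"
        using ij by (intro Bochner_Integration.integral_cong) (auto simp: indicator_def)
      moreover have "{y\<in>space M. R y = R (x j)} \<inter> space M = {y\<in>space M. R y = R (x j)}" by auto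
      ultimately show "(\<integral>y. ?f (x(i := y)) \<partial>M) = prob {y\<in>space M. R y = R (x j)}" by simp
    qed
    finally have "(\<integral>x. ?f x \<partial>sample K) = 0" by (simp add: atomless)
    then have "AE x in sample K. ?f x = 0" using int by (subst (asm) integral_nonneg_eq_0_iff_AE) auto
    then show ?thesis by eventually_elim (auto split: if_splits)
  qed
  note * = this
  have "AE x in sample K. \<forall>i\<in>K. \<forall>j\<in>K. i \<noteq> j \<longrightarrow> R (x i) \<noteq> R (x j)"
  proof (intro AE_finite_allI K)
    fix i j assume "i \<in> K" "j \<in> K"
    then show "AE x in sample K. i \<noteq> j \<longrightarrow> R (x i) \<noteq> R (x j)"
      using * by (cases "i = j") auto
  qed
  then show ?thesis by eventually_elim (auto simp: inj_on_def)
qed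

text \<open>Markov's inequality for \<open>z\<close> raised to the number of exceedances, whose mean
  is \<open>(1 + (z - 1) * tail R u)\<close> to the power of the sample size. The event is abstract
  so that \<open>z > 1\<close> covers the upper tail and \<open>z < 1\<close> the lower one.\<close>

lemma prob_exceedances_Chernoff:
  assumes K: "finite K" and R[measurable]: "R \<in> borel_measurable M" and z: "0 < z"
    and event: "\<And>x. Q x \<Longrightarrow> z ^ k \<le> z ^ card {i\<in>K. u < R (x i)}"
    and Q[measurable]: "Measurable.pred (sample K) Q"
  shows "measure (sample K) {x\<in>space (sample K). Q x} \<le> exp (real (card K) * tail R u * (z - 1)) / z ^ k"
proof -
  interpret S: prob_space "sample K" by (rule prob_space_sample)
  interpret product_sigma_finite "\<lambda>_::nat. M" by (rule product_sigma_finite_sample)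
  let ?f = "\<lambda>x. if u < R x then z else 1"
  have int: "integrable M ?f" by (rule integrable_const_bound[of _ "max z 1"]) (use z in auto)
  have ip: "integrable (sample K) (\<lambda>x. \<Prod>i\<in>K. ?f (x i))"
    by (rule product_integrable_prod[OF K int])
  have p: "(\<Prod>i\<in>K. ?f (x i)) = z ^ card {i\<in>K. u < R (x i)}" for x
    using K by (simp add: prod.If_cases Int_def)
  have "z ^ k * measure (sample K) {x\<in>space (sample K). Q x} = (\<integral>x. z ^ k * indicator {x\<in>space (sample K). Q x} x \<partial>sample K)"
    by simp
  also have "\<dots> \<le> (\<integral>x. (\<Prod>i\<in>K. ?f (x i)) \<partial>sample K)"
  proof (rule integral_mono[OF _ ip])
    show "integrable (sample K) (\<lambda>x. z ^ k * indicator {x \<in> space (sample K). Q x} x)"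
      by (rule S.integrable_const_bound[of _ "z ^ k"]) (use z in \<open>auto simp: indicator_def\<close>)
    show "z ^ k * indicator {x \<in> space (sample K). Q x} x \<le> (\<Prod>i\<in>K. ?f (x i))" for x
      unfolding p using event[of x] z by (auto simp: indicator_def)
  qed
  also have "\<dots> = (\<Prod>i\<in>K. \<integral>x. ?f x \<partial>M)" by (rule product_integral_prod[OF K int])
  also have "(\<integral>x. ?f x \<partial>M) = (\<integral>x. (z - 1) * (if u < R x then 1 else 0) + 1 \<partial>M)"
    by (intro Bochner_Integration.integral_cong) auto
  also have "\<dots> = (z - 1) * tail R u + 1"
  proof -
    have "integrable M (\<lambda>x. if u < R x then 1 else 0 :: real)" by (rule integrable_const_bound[of _ 1]) auto
    then show ?thesis by (simp add: tail_eq prob_space)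
  qed
  also have "(\<Prod>i\<in>K. (z - 1) * tail R u + 1) \<le> (\<Prod>i\<in>K. exp ((z - 1) * tail R u))"
  proof (rule prod_mono, intro conjI)
    have "0 \<le> tail R u" "tail R u \<le> 1" by (auto simp: tail_def)
    then have "0 \<le> z * tail R u + (1 - tail R u)" using z by (intro add_nonneg_nonneg) auto
    then show "0 \<le> (z - 1) * tail R u + 1" by (simp add: algebra_simps)
    show "(z - 1) * tail R u + 1 \<le> exp ((z - 1) * tail R u)" by (metis add.commute exp_ge_add_one_self)
  qed
  also have "\<dots> = exp (real (card K) * tail R u * (z - 1))"
    by (simp add: exp_of_nat_mult[symmetric] mult_ac)
  finally show ?thesis using z by (simp add: le_divide_eq mult.commute)
qed

text \<open>By conditioning on the order statistic of rank \<open>k\<close>; the two probabilities bound the event that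
  it lies outside \<open>[u1, u2]\<close>.\<close>

lemma norm_integral_top_order_statistics:
  fixes g :: "'a \<Rightarrow> complex"
  assumes K: "finite K" "k < card K" and R[measurable]: "R \<in> borel_measurable M" and g[measurable]: "g \<in> borel_measurable M"
    and gb: "\<And>x. norm (g x) \<le> 1" and t: "\<And>u. tail R u > 0"
    and atomless: "\<And>v. prob {x\<in>space M. R x = v} = 0"
    and c: "norm c \<le> 1" and close: "\<And>u. u1 \<le> u \<Longrightarrow> u \<le> u2 \<Longrightarrow> norm (tail_mean R g u ^ k - c) \<le> \<delta>" and \<delta>: "0 \<le> \<delta>"
  shows "norm ((\<integral>x. (\<Prod>i\<in>K. if rank R K x i < k then g (x i) else 1) \<partial>sample K) - c) \<le>
    \<delta> + 2 * (measure (sample K) {x\<in>space (sample K). exceedances R K u1 x \<le> real k} +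
              measure (sample K) {x\<in>space (sample K). real k \<le> exceedances R K u2 x})"
proof -
  interpret S: prob_space "sample K" by (rule prob_space_sample)
  let ?I = "\<lambda>j. K - {j}"
  define F where "F j x = (if exceedances R (?I j) (R (x j)) x = real k then \<Prod>i\<in>?I j. (if R (x j) < R (x i) then g (x i) else 1) else 0)" for j x
  define G where "G j x = (if exceedances R (?I j) (R (x j)) x = real k then tail_mean R g (R (x j)) ^ k else 0)" for j x
  define H where "H x = (\<Prod>i\<in>K. if rank R K x i < k then g (x i) else 1)" for x
  have os: "integrable (sample K) (F j)" "integrable (sample K) (G j)"
    "(\<integral>x. F j x \<partial>sample K) = (\<integral>x. G j x \<partial>sample K)" if "j \<in> K" for j
    using integral_order_statistic[OF K(1) that R g gb t, of k] by (simp_all add: F_def[abs_def] G_def[abs_def])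
  obtain j0 where "j0 \<in> K" using K by fastforce
  have em[measurable]: "(\<lambda>x. exceedances R K u x) \<in> borel_measurable (sample K)" for u
    by (rule exceedances_measurable(2)[OF R K(1) subset_refl \<open>j0 \<in> K\<close>])
  define E1 where "E1 = {x\<in>space (sample K). exceedances R K u1 x \<le> real k}"
  define E2 where "E2 = {x\<in>space (sample K). real k \<le> exceedances R K u2 x}"
  have [measurable]: "E1 \<in> sets (sample K)" "E2 \<in> sets (sample K)" unfolding E1_def E2_def by measurable
  have iE[simp]: "integrable (sample K) (indicator E1 :: _ \<Rightarrow> real)" "integrable (sample K) (indicator E2 :: _ \<Rightarrow> real)"
    by (auto intro!: S.integrable_const_bound[of _ 1] simp: indicator_def)
  have ae: "AE x in sample K. H x = (\<Sum>j\<in>K. F j x) \<and>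
      norm ((\<Sum>j\<in>K. G j x) - c) \<le> \<delta> + 2 * (indicator E1 x + indicator E2 x)"
    using AE_no_ties[OF K(1) R atomless] AE_space
  proof eventually_elim
    case (elim x)
    obtain j where j: "j \<in> K" "rank R K x j = k" "\<And>i. i \<in> K \<Longrightarrow> R (x j) < R (x i) \<longleftrightarrow> rank R K x i < k"
      "\<And>f :: nat \<Rightarrow> complex. (\<Sum>i\<in>K. if exceedances R (K - {i}) (R (x i)) x = real k then f i else 0) = f j"
      by (rule order_statistic_obtain[where R=R and x=x, OF K(1) elim(1) K(2)]) (rule that)
    have "(\<Sum>j\<in>K. F j x) = (\<Prod>i\<in>?I j. (if R (x j) < R (x i) then g (x i) else 1))"
      unfolding F_def by (rule j(4))
    also have "\<dots> = (\<Prod>i\<in>?I j. if rank R K x i < k then g (x i) else 1)"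
      using j(3) by (intro prod.cong) auto
    \<comment> \<open>The factor of \<open>j\<close> itself is 1, since its rank is
      \<open>k\<close>.\<close>
    also have "\<dots> = H x" unfolding H_def using j(1,2) K(1) by (simp add: prod.remove)
    finally have 1: "H x = (\<Sum>j\<in>K. F j x)" ..
    have G: "(\<Sum>j\<in>K. G j x) = tail_mean R g (R (x j)) ^ k" unfolding G_def by (rule j(4))
    have "norm (tail_mean R g (R (x j)) ^ k) \<le> 1"
      unfolding norm_power by (intro power_le_one norm_tail_mean_le R g gb t) simp
    then have triv: "norm (tail_mean R g (R (x j)) ^ k - c) \<le> 2" using c norm_triangle_ineq4 by (smt (verit))
    have card_j: "card {i\<in>K. R (x j) < R (x i)} = k" using j(2) by (simp add: rank_def)
    have "norm (tail_mean R g (R (x j)) ^ k - c) \<le> \<delta> + 2 * (indicator E1 x + indicator E2 x)"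
    proof -
      \<comment> \<open>Exactly \<open>k\<close> points exceed the order statistic. If it lies below
        \<open>u1\<close>, at most \<open>k\<close> points exceed \<open>u1\<close>; if it lies
        above \<open>u2\<close>, at least \<open>k\<close> exceed \<open>u2\<close>. There the
        trivial bound 2 is used.\<close>
      consider "R (x j) < u1" | "u2 < R (x j)" | "u1 \<le> R (x j)" "R (x j) \<le> u2" by linarith
      then show ?thesis
      proof cases
        case 1
        then have "card {i\<in>K. u1 < R (x i)} \<le> card {i\<in>K. R (x j) < R (x i)}"
          using K(1) by (intro card_mono) auto
        then have "x \<in> E1" using elim(2) K(1) card_j by (simp add: E1_def exceedances_card)
        then show ?thesis using triv \<delta> by (simp add: indicator_def)
      next
        case 2
        then have "card {i\<in>K. R (x j) < R (x i)} \<le> card {i\<in>K. u2 < R (x i)}"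
          using K(1) by (intro card_mono) auto
        then have "x \<in> E2" using elim(2) K(1) card_j by (simp add: E2_def exceedances_card)
        then show ?thesis using triv \<delta> by (simp add: indicator_def)
      next
        case 3
        then show ?thesis using close[of "R (x j)"] by (simp add: indicator_def)
      qed
    qed
    with 1 G show ?case by simp
  qed
  have iF: "integrable (sample K) (\<lambda>x. \<Sum>j\<in>K. F j x)" and iG: "integrable (sample K) (\<lambda>x. \<Sum>j\<in>K. G j x)"
    using os(1,2) by (auto intro!: Bochner_Integration.integrable_sum)
  have rm: "Measurable.pred (sample K) (\<lambda>x. rank R K x i < k)" if "i \<in> K" for i
  proof -
    have "(\<lambda>x. rank R K x i < k) = (\<lambda>x. exceedances R (?I i) (R (x i)) x < real k)"
      by (simp add: exceedances_eq_rank[OF K(1)])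
    moreover have [measurable]: "(\<lambda>x. exceedances R (?I i) (R (x i)) x) \<in> borel_measurable (sample K)"
      using exceedances_measurable(1)[OF R _ _ that, of "?I i"] K(1) by auto
    ultimately show ?thesis by simp
  qed
  have Hm: "H \<in> borel_measurable (sample K)"
    unfolding H_def
  proof (intro borel_measurable_prod measurable_If borel_measurable_const)
    fix i assume i: "i \<in> K"
    show "(\<lambda>x. g (x i)) \<in> borel_measurable (sample K)" by (rule sample_component_measurable[OF g i])
    show "{x \<in> space (sample K). rank R K x i < k} \<in> sets (sample K)" using rm[OF i] by measurable
  qed
  have "(\<integral>x. H x \<partial>sample K) = (\<integral>x. (\<Sum>j\<in>K. F j x) \<partial>sample K)"
    using ae iF Hm by (intro integral_cong_AE) auto
  also have "\<dots> = (\<Sum>j\<in>K. \<integral>x. F j x \<partial>sample K)" using os(1) by (intro Bochner_Integration.integral_sum) auto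
  also have "\<dots> = (\<Sum>j\<in>K. \<integral>x. G j x \<partial>sample K)" using os(3) by (intro sum.cong) auto
  also have "\<dots> = (\<integral>x. (\<Sum>j\<in>K. G j x) \<partial>sample K)"
    using os(2) by (intro Bochner_Integration.integral_sum[symmetric]) auto
  finally have "(\<integral>x. H x \<partial>sample K) - c = (\<integral>x. (\<Sum>j\<in>K. G j x) - c \<partial>sample K)"
    using iG by (simp add: S.prob_space)
  also have "norm \<dots> \<le> (\<integral>x. norm ((\<Sum>j\<in>K. G j x) - c) \<partial>sample K)" by (rule integral_norm_bound)
  also have "\<dots> \<le> (\<integral>x. \<delta> + 2 * (indicator E1 x + indicator E2 x) \<partial>sample K)"
    using ae iG by (intro integral_mono_AE) auto
  also have "\<dots> = \<delta> + 2 * (S.prob E1 + S.prob E2)" by (simp add: S.prob_space)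
  finally show ?thesis by (simp add: H_def E1_def E2_def)
qed

end

section \<open>Regular variation\<close>

locale regular_variation = prob_space M for M :: "'a measure" +
  fixes X :: "'a \<Rightarrow> real ^ 'd" and \<nu> :: "(real ^ 'd) measure"
  assumes X[measurable]: "X \<in> borel_measurable M" and rv: "regularly_varying M X \<nu>"
begin

definition Tl :: "real \<Rightarrow> real" where "Tl t = prob {w\<in>space M. t < norm (X w)}"
definition G :: "real \<Rightarrow> real" where "G s = measure \<nu> {x. s < norm x}"

lemma sets_nu [measurable_cong, simp]: "sets \<nu> = sets borel"
  using rv by (simp add: regularly_varying_def)

lemma space_nu [simp]: "space \<nu> = UNIV"
  using sets_eq_imp_space_eq[OF sets_nu] by simp

lemma nu_finite: "r > 0 \<Longrightarrow> emeasure \<nu> {x. r \<le> norm x} < \<infinity>"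
  using rv by (simp add: regularly_varying_def)

lemma Tl_antimono: "s \<le> t \<Longrightarrow> Tl t \<le> Tl s"
  unfolding Tl_def by (rule finite_measure_mono) auto

lemma norm_ball_borel: "{x :: real ^ 'd. s < norm x} \<in> sets borel" "{x :: real ^ 'd. s \<le> norm x} \<in> sets borel"
   "{x :: real ^ 'd. norm x = s} \<in> sets borel"
  by measurable

text \<open>The frontier of \<open>{x. s < norm x}\<close> lies in the sphere of radius
  \<open>s\<close>; if \<open>\<nu>\<close> does not charge this sphere, the set is a continuity set
  and the limit relation applies to it.\<close>

lemma tail_ratio_tendsto:
  assumes s: "s > 0" and good: "emeasure \<nu> {x. norm x = s} = 0"
  shows "((\<lambda>t. Tl (s * t) / Tl t) \<longlongrightarrow> G s) at_top"
proof -
  let ?B = "{x :: real ^ 'd. s < norm x}"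
  have "open ?B" by (intro open_Collect_less continuous_intros)
  moreover have "closure ?B \<subseteq> {x. s \<le> norm x}"
    by (rule closure_minimal) (auto intro: closed_Collect_le continuous_intros)
  ultimately have "frontier ?B \<subseteq> {x. norm x = s}" by (auto simp: frontier_def interior_open)
  then have "emeasure \<nu> (frontier ?B) \<le> emeasure \<nu> {x. norm x = s}"
    using norm_ball_borel by (intro emeasure_mono) auto
  then have "emeasure \<nu> (frontier ?B) = 0" using good by simp
  moreover have "\<exists>r>0. \<forall>x\<in>?B. r \<le> norm x" using s by (auto intro!: exI[of _ s])
  moreover have "?B \<in> sets borel" by (rule norm_ball_borel)
  ultimately have "((\<lambda>t. measure M {w \<in> space M. (1 / t) *\<^sub>R X w \<in> ?B} /
              measure M {w \<in> space M. t < norm (X w)}) \<longlongrightarrow> measure \<nu> ?B) at_top"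
    using rv unfolding regularly_varying_def by blast
  moreover have "\<forall>\<^sub>F t in at_top. measure M {w \<in> space M. (1 / t) *\<^sub>R X w \<in> ?B} /
              measure M {w \<in> space M. t < norm (X w)} = Tl (s * t) / Tl t"
    using eventually_gt_at_top[of 0]
  proof eventually_elim
    case (elim t)
    then have "{w \<in> space M. (1 / t) *\<^sub>R X w \<in> ?B} = {w\<in>space M. s * t < norm (X w)}"
      by (auto simp: less_divide_eq)
    then show ?case by (simp add: Tl_def)
  qed
  ultimately show ?thesis unfolding G_def by (rule Lim_transform_eventually)
qed

text \<open>Away from the origin the image of \<open>\<nu>\<close> under the norm is a finite
  measure, which has at most countably many atoms.\<close>

lemma countable_bad_radii:
  assumes "r > 0"
  shows "countable {s. r \<le> s \<and> emeasure \<nu> {x. norm x = s} \<noteq> 0}"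
proof -
  define D where "D = distr (density \<nu> (indicator {x. r \<le> norm x})) borel norm"
  have [measurable]: "{x :: real ^ 'd. r \<le> norm x} \<in> sets borel" by (rule norm_ball_borel)
  have em: "emeasure D A = emeasure \<nu> {x. r \<le> norm x \<and> norm x \<in> A}" if [measurable]: "A \<in> sets borel" for A
  proof -
    have [measurable]: "(norm :: real ^ 'd \<Rightarrow> real) -` A \<in> sets borel"
      using measurable_sets[of "norm :: real ^ 'd \<Rightarrow> real" borel borel A] that by simp
    have "emeasure D A = emeasure (density \<nu> (indicator {x. r \<le> norm x})) (norm -` A)"
      unfolding D_def by (subst emeasure_distr) auto
    also have "\<dots> = (\<integral>\<^sup>+x. indicator {x. r \<le> norm x} x * indicator (norm -` A) x \<partial>\<nu>)"
      by (subst emeasure_density) auto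
    also have "\<dots> = (\<integral>\<^sup>+x. indicator ({x. r \<le> norm x} \<inter> norm -` A) x \<partial>\<nu>)"
      by (intro nn_integral_cong) (auto simp: indicator_def)
    also have "\<dots> = emeasure \<nu> ({x. r \<le> norm x} \<inter> norm -` A)" by (subst nn_integral_indicator) auto
    finally show ?thesis by (simp add: Int_def vimage_def)
  qed
  have "emeasure D (space D) \<noteq> \<infinity>" using nu_finite[OF assms] em[of UNIV] by (simp add: D_def)
  then interpret D: finite_measure D by (rule finite_measureI)
  have "{s. r \<le> s \<and> emeasure \<nu> {x. norm x = s} \<noteq> 0} \<subseteq> {s. measure D {s} \<noteq> 0}"
  proof (rule subsetI, rule CollectI, rule notI)
    fix s assume "s \<in> {s. r \<le> s \<and> emeasure \<nu> {x. norm x = s} \<noteq> 0}" and 0: "measure D {s} = 0"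
    then have s: "r \<le> s" "emeasure \<nu> {x. norm x = s} \<noteq> 0" by auto
    have "{x :: real ^ 'd. r \<le> norm x \<and> norm x \<in> {s}} = {x. norm x = s}" using s(1) by auto
    then have "emeasure D {s} = emeasure \<nu> {x. norm x = s}" by (subst em) auto
    then show False using s(2) 0 by (simp add: D.emeasure_eq_measure)
  qed
  then show ?thesis using D.countable_support by (rule countable_subset)
qed

lemma ex_good_radius:
  assumes "0 < a" "a < b"
  shows "\<exists>s. a < s \<and> s < b \<and> emeasure \<nu> {x. norm x = s} = 0"
proof (rule ccontr)
  assume "\<not> ?thesis"
  then have "{a<..<b} \<subseteq> {s. a \<le> s \<and> emeasure \<nu> {x. norm x = s} \<noteq> 0}" by force
  then have "countable {a<..<b}" using countable_bad_radii[OF assms(1)] by (rule countable_subset)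
  then show False using uncountable_open_interval[of a b] assms by simp
qed

text \<open>For each exponent only countably many bases are excluded, because powers are injective
  on bases above 1, and an interval is uncountable. All powers have to be good at once, since the
  tail ratio is going to be iterated.\<close>

lemma ex_good_radius_powers:
  assumes "1 < b"
  shows "\<exists>s. 1 < s \<and> s < b \<and> (\<forall>m\<ge>1. emeasure \<nu> {x. norm x = s ^ m} = 0)"
proof (rule ccontr)
  assume neg: "\<not> ?thesis"
  let ?Bd = "{s. 1 \<le> s \<and> emeasure \<nu> {x. norm x = s} \<noteq> 0}"
  have "{1<..<b} \<subseteq> (\<Union>m\<in>{1..}. {s \<in> {1<..}. s ^ m \<in> ?Bd})"
  proof
    fix s assume s: "s \<in> {1<..<b}"
    then obtain m where m: "m \<ge> (1::nat)" "emeasure \<nu> {x. norm x = s ^ m} \<noteq> 0" using neg by auto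
    have "1 \<le> s ^ m" using s by (intro one_le_power) auto
    then show "s \<in> (\<Union>m\<in>{1..}. {s \<in> {1<..}. s ^ m \<in> ?Bd})" using m s by auto
  qed
  moreover have "countable {s \<in> {1<..}. s ^ m \<in> ?Bd}" if "m \<ge> 1" for m :: nat
  proof (rule countable_image_inj_on)
    have "(\<lambda>s. s ^ m) ` {s \<in> {1<..}. s ^ m \<in> ?Bd} \<subseteq> ?Bd" by auto
    then show "countable ((\<lambda>s. s ^ m) ` {s \<in> {1<..}. s ^ m \<in> ?Bd})"
      using countable_bad_radii[of 1] by (auto intro: countable_subset)
    show "inj_on (\<lambda>s. s ^ m) {s \<in> {1<..}. s ^ m \<in> ?Bd}"
    proof (rule inj_onI)
      fix x y assume "x \<in> {s \<in> {1<..}. s ^ m \<in> ?Bd}" "y \<in> {s \<in> {1<..}. s ^ m \<in> ?Bd}" "x ^ m = y ^ m"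
      then show "x = y" using that by (intro power_eq_imp_eq_base[of x m y]) auto
    qed
  qed
  then have "countable (\<Union>m\<in>{1..}. {s \<in> {1<..}. s ^ m \<in> ?Bd})" by (intro countable_UN) auto
  ultimately have "countable {1<..<b}" by (rule countable_subset)
  then show False using uncountable_open_interval[of 1 b] assms by simp
qed

text \<open>If the tail vanished at some level, all later ratios would be \<open>0 / 0 = 0\<close>,
  so \<open>\<nu>\<close> would vanish outside every ball of good radius, hence outside every ball
  around the origin. As it does not charge the origin either, it would be zero.\<close>

lemma Tl_pos: "Tl t > 0"
proof (rule ccontr)
  assume neg: "\<not> Tl t > 0"
  have z: "Tl u = 0" if "u \<ge> t" for u
  proof -
    have "0 \<le> Tl u" by (simp add: Tl_def)
    then show ?thesis using Tl_antimono[OF that] neg by linarith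
  qed
  have G0: "G s = 0" if s: "s > 0" "emeasure \<nu> {x. norm x = s} = 0" for s
  proof -
    have "\<forall>\<^sub>F u in at_top. Tl (s * u) / Tl u = 0"
      using eventually_ge_at_top[of t] by eventually_elim (simp add: z)
    then have "((\<lambda>u. Tl (s * u) / Tl u) \<longlongrightarrow> 0) at_top" by (rule tendsto_eventually)
    with tail_ratio_tendsto[OF s] show ?thesis by (intro tendsto_unique[of at_top]) auto
  qed
  have null: "emeasure \<nu> {x. s < norm x} = 0" if "s > 0" for s
  proof -
    obtain s' where s': "s / 2 < s'" "s' < s" "emeasure \<nu> {x. norm x = s'} = 0"
      using ex_good_radius[of "s / 2" s] \<open>s > 0\<close> by auto
    have "emeasure \<nu> {x. s' < norm x} \<le> emeasure \<nu> {x. s' \<le> norm x}"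
      by (intro emeasure_mono) (auto simp: norm_ball_borel)
    then have "emeasure \<nu> {x. s' < norm x} \<noteq> \<infinity>" using nu_finite[of s'] s' \<open>s > 0\<close> by auto
    then have "emeasure \<nu> {x. s' < norm x} = 0"
      using G0[of s'] s' \<open>s > 0\<close>
      by (simp add: G_def emeasure_eq_ennreal_measure)
    moreover have "emeasure \<nu> {x. s < norm x} \<le> emeasure \<nu> {x. s' < norm x}"
      using s' by (intro emeasure_mono) (auto simp: norm_ball_borel)
    ultimately show ?thesis by simp
  qed
  have Un0: "emeasure \<nu> (\<Union>m::nat. {x. 1 / real (Suc m) < norm x}) = 0"
    by (rule emeasure_UN_eq_0) (auto intro: null simp: norm_ball_borel)
  have "UNIV \<subseteq> {0} \<union> (\<Union>m::nat. {x :: real ^ 'd. 1 / real (Suc m) < norm x})"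
  proof
    fix x :: "real ^ 'd"
    show "x \<in> {0} \<union> (\<Union>m::nat. {x :: real ^ 'd. 1 / real (Suc m) < norm x})"
    proof (cases "x = 0")
      case False
      then obtain m where "inverse (real (Suc m)) < norm x" using reals_Archimedean[of "norm x"] by auto
      then show ?thesis by (auto simp: inverse_eq_divide)
    qed simp
  qed
  then have U: "emeasure \<nu> UNIV \<le> emeasure \<nu> ({0} \<union> (\<Union>m::nat. {x. 1 / real (Suc m) < norm x}))"
    by (intro emeasure_mono) (auto simp: norm_ball_borel)
  have "emeasure \<nu> ({0} \<union> (\<Union>m::nat. {x. 1 / real (Suc m) < norm x})) \<le> emeasure \<nu> {0} + emeasure \<nu> (\<Union>m::nat. {x. 1 / real (Suc m) < norm x})"
    by (intro emeasure_subadditive) (auto simp: norm_ball_borel)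
  moreover have "emeasure \<nu> {0} = 0" "emeasure \<nu> UNIV \<noteq> 0" using rv by (simp_all add: regularly_varying_def)
  ultimately show False using U Un0 by simp
qed

lemma G_tendsto_0: "s > 1 \<Longrightarrow> (\<lambda>m. G (s ^ m)) \<longlonglongrightarrow> 0"
proof -
  assume s: "s > 1"
  let ?A = "\<lambda>m. {x :: real ^ 'd. s ^ m < norm x}"
  have fin: "emeasure \<nu> (?A m) \<noteq> \<infinity>" for m
  proof -
    have "emeasure \<nu> (?A m) \<le> emeasure \<nu> {x. s ^ m \<le> norm x}"
      by (intro emeasure_mono) (auto simp: norm_ball_borel)
    then show ?thesis using nu_finite[of "s ^ m"] s by auto
  qed
  have "(\<lambda>m. measure \<nu> (?A m)) \<longlonglongrightarrow> measure \<nu> (\<Inter>m. ?A m)"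
  proof (rule Lim_measure_decseq)
    show "decseq ?A"
    proof (rule decseq_SucI, rule subsetI)
      fix n and x :: "real ^ 'd" assume "x \<in> {x. s ^ Suc n < norm x}"
      moreover have "s ^ n \<le> s ^ Suc n" using s by (intro power_increasing) auto
      ultimately show "x \<in> {x. s ^ n < norm x}" by simp
    qed
  qed (use fin norm_ball_borel in auto)
  moreover have "(\<Inter>m. ?A m) = {}"
  proof -
    have "\<exists>m. norm x < s ^ m" for x :: "real ^ 'd" using real_arch_pow[OF s] by blast
    then show ?thesis by (auto simp: not_less) (metis less_asym)
  qed
  ultimately show ?thesis by (simp add: G_def)
qed

text \<open>The limit \<open>G s\<close> of the ratio is multiplicative along the powers of a good radius \<open>s\<close>, and
  \<open>G (s ^ m)\<close> tends to 0; hence \<open>G s < 1\<close>.\<close>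

theorem tail_ratio_bound:
  assumes "1 < b"
  obtains q where "0 < q" "q < 1" "\<forall>\<^sub>F t in at_top. Tl (b * t) \<le> q * Tl t"
proof -
  obtain s where s: "1 < s" "s < b" "\<And>m. m \<ge> 1 \<Longrightarrow> emeasure \<nu> {x. norm x = s ^ m} = 0"
    using ex_good_radius_powers[OF assms] by blast
  have lim: "((\<lambda>t. Tl (s ^ m * t) / Tl t) \<longlongrightarrow> G (s ^ m)) at_top" if "m \<ge> 1" for m
    using s that by (intro tail_ratio_tendsto) auto
  have lim1: "((\<lambda>t. Tl (s * t) / Tl t) \<longlongrightarrow> G s) at_top" using lim[of 1] by simp
  have "\<forall>\<^sub>F t in at_top. Tl (s * t) / Tl t \<le> 1"
    using eventually_gt_at_top[of 0]
    by eventually_elim (use s Tl_pos in \<open>auto simp: divide_le_eq intro!: Tl_antimono\<close>)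
  then have G1: "G s \<le> 1" by (intro tendsto_upperbound[OF lim1]) auto
  \<comment> \<open>The ratio for \<open>s ^ Suc m\<close> telescopes through the level
    \<open>s ^ m * t\<close>, which also tends to infinity.\<close>
  have pow: "((\<lambda>t. Tl (s ^ m * t) / Tl t) \<longlongrightarrow> G s ^ m) at_top" for m
  proof (induction m)
    case 0
    then show ?case using Tl_pos by (simp add: less_imp_neq[THEN not_sym])
  next
    case (Suc m)
    have "filterlim (\<lambda>t. s ^ m * t) at_top at_top"
      using s by (intro filterlim_tendsto_pos_mult_at_top[OF tendsto_const _ filterlim_ident]) auto
    from filterlim_compose[OF lim1 this]
    have "((\<lambda>t. Tl (s * (s ^ m * t)) / Tl (s ^ m * t)) \<longlongrightarrow> G s) at_top" .
    from tendsto_mult[OF this Suc] show ?case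
      using Tl_pos by (simp add: less_imp_neq[THEN not_sym] mult.assoc)
  qed
  have "G s \<noteq> 1"
  proof
    assume "G s = 1"
    then have eq: "G (s ^ m) = 1" if "m \<ge> 1" for m
      using tendsto_unique[OF _ lim[OF that] pow[of m]] by simp
    have "\<forall>\<^sub>F m in sequentially. G (s ^ m) = 1"
      by (rule eventually_mono[OF eventually_ge_at_top[of 1] eq])
    then have "(\<lambda>m. G (s ^ m)) \<longlonglongrightarrow> 1" by (rule tendsto_eventually)
    with G_tendsto_0[OF s(1)] show False using LIMSEQ_unique by fastforce
  qed
  with G1 have "G s < (1 + G s) / 2" "(1 + G s) / 2 < 1" by auto
  moreover have "0 \<le> G s" by (simp add: G_def)
  moreover have "\<forall>\<^sub>F t in at_top. Tl (b * t) \<le> (1 + G s) / 2 * Tl t"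
    using order_tendstoD(2)[OF lim1 \<open>G s < (1 + G s) / 2\<close>] eventually_gt_at_top[of 0]
  proof eventually_elim
    case (elim t)
    have "Tl (b * t) \<le> Tl (s * t)" using s elim by (intro Tl_antimono) auto
    also have "\<dots> \<le> (1 + G s) / 2 * Tl t" using elim(1) Tl_pos[of t] by (simp add: divide_less_eq)
    finally show ?case .
  qed
  ultimately show thesis by (intro that[of "(1 + G s) / 2"]) auto
qed

end

section \<open>Gaussian vectors\<close>

lemma integral_square_sum:
  fixes f :: "'i \<Rightarrow> 'a \<Rightarrow> real"
  assumes "finite I" "\<And>i j. i \<in> I \<Longrightarrow> j \<in> I \<Longrightarrow> integrable M (\<lambda>x. f i x * f j x)"
  shows "(\<integral>x. (\<Sum>i\<in>I. c i * f i x)\<^sup>2 \<partial>M) = (\<Sum>i\<in>I. \<Sum>j\<in>I. c i * c j * (\<integral>x. f i x * f j x \<partial>M))"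
proof -
  have "(\<integral>x. (\<Sum>i\<in>I. c i * f i x)\<^sup>2 \<partial>M) = (\<integral>x. (\<Sum>i\<in>I. \<Sum>j\<in>I. c i * c j * (f i x * f j x)) \<partial>M)"
    by (simp add: power2_eq_square sum_product mult_ac)
  also have "\<dots> = (\<Sum>i\<in>I. \<integral>x. (\<Sum>j\<in>I. c i * c j * (f i x * f j x)) \<partial>M)"
    using assms by (intro Bochner_Integration.integral_sum Bochner_Integration.integrable_sum integrable_mult_right)
  also have "\<dots> = (\<Sum>i\<in>I. \<Sum>j\<in>I. \<integral>x. c i * c j * (f i x * f j x) \<partial>M)"
    using assms by (intro sum.cong refl Bochner_Integration.integral_sum integrable_mult_right)
  finally show ?thesis by simp
qed

lemma matrix_inner_sum: "(a :: real ^ 'n ^ 'm) \<bullet> b = (\<Sum>(i, j)\<in>UNIV. a $ i $ j * b $ i $ j)"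
  by (simp add: inner_vec_def sum.cartesian_product)

lemma integrable_mult_of_squares:
  fixes f g :: "'a \<Rightarrow> real"
  assumes [measurable]: "f \<in> borel_measurable M" "g \<in> borel_measurable M"
    and "integrable M (\<lambda>x. (f x)\<^sup>2)" "integrable M (\<lambda>x. (g x)\<^sup>2)"
  shows "integrable M (\<lambda>x. f x * g x)"
proof (rule Bochner_Integration.integrable_bound)
  show "integrable M (\<lambda>x. (f x)\<^sup>2 + (g x)\<^sup>2)" using assms by simp
  show "AE x in M. norm (f x * g x) \<le> norm ((f x)\<^sup>2 + (g x)\<^sup>2)"
  proof (rule AE_I2)
    fix x
    have "0 \<le> (\<bar>f x\<bar> - \<bar>g x\<bar>)\<^sup>2" by simp
    then have "2 * (\<bar>f x\<bar> * \<bar>g x\<bar>) \<le> (f x)\<^sup>2 + (g x)\<^sup>2" by (simp add: power2_diff)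
    moreover have "0 \<le> \<bar>f x\<bar> * \<bar>g x\<bar>" by simp
    ultimately have "\<bar>f x\<bar> * \<bar>g x\<bar> \<le> (f x)\<^sup>2 + (g x)\<^sup>2" by linarith
    then show "norm (f x * g x) \<le> norm ((f x)\<^sup>2 + (g x)\<^sup>2)" by (simp add: abs_mult)
  qed
qed simp

text \<open>The variances of linear forms are determined by the covariances of the entries, the data
  that \<open>U\<close> shares with the limit model; the identity is applied to both.\<close>

lemma variance_matrix_inner:
  fixes Y :: "'a \<Rightarrow> real ^ 'n ^ 'm"
  assumes "prob_space M" and Y[measurable]: "Y \<in> borel_measurable M"
    and sq: "\<And>i j. integrable M (\<lambda>x. (Y x $ i $ j)\<^sup>2)"
  shows "(\<integral>x. (a \<bullet> Y x - (\<integral>y. a \<bullet> Y y \<partial>M))\<^sup>2 \<partial>M) =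
    (\<Sum>(i, j)\<in>UNIV. \<Sum>(l, m)\<in>UNIV. a $ i $ j * a $ l $ m * covariance M (\<lambda>x. Y x $ i $ j) (\<lambda>x. Y x $ l $ m))"
proof -
  interpret prob_space M by fact
  have comp[measurable]: "(\<lambda>x. Y x $ i $ j) \<in> borel_measurable M" for i j
    by (rule measurable_compose[OF Y]) (auto intro!: borel_measurable_continuous_onI continuous_intros)
  have int: "integrable M (\<lambda>x. Y x $ i $ j)" for i j
    using integrable_mult_of_squares[OF comp[of i j], of "\<lambda>_. 1"] sq by simp
  define e where "e p = (\<integral>x. Y x $ fst p $ snd p \<partial>M)" for p
  define f where "f p x = Y x $ fst p $ snd p - e p" for p x
  have [measurable]: "f p \<in> borel_measurable M" for p unfolding f_def by measurable
  have "integrable M (\<lambda>x. (f p x)\<^sup>2)" for p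
    unfolding f_def power2_diff using sq int by simp
  then have ff: "integrable M (\<lambda>x. f p x * f q x)" for p q by (intro integrable_mult_of_squares) auto
  have m: "(\<integral>y. a \<bullet> Y y \<partial>M) = (\<Sum>p\<in>UNIV. a $ fst p $ snd p * e p)"
    unfolding matrix_inner_sum case_prod_beta e_def using int
    by (subst Bochner_Integration.integral_sum) auto
  have "a \<bullet> Y x - (\<integral>y. a \<bullet> Y y \<partial>M) = (\<Sum>p\<in>UNIV. a $ fst p $ snd p * f p x)" for x
    unfolding m unfolding matrix_inner_sum case_prod_beta f_def by (simp add: right_diff_distrib sum_subtractf)
  then have "(\<integral>x. (a \<bullet> Y x - (\<integral>y. a \<bullet> Y y \<partial>M))\<^sup>2 \<partial>M) = (\<integral>x. (\<Sum>p\<in>UNIV. a $ fst p $ snd p * f p x)\<^sup>2 \<partial>M)"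
    by simp
  also have "\<dots> = (\<Sum>p\<in>UNIV. \<Sum>q\<in>UNIV. a $ fst p $ snd p * a $ fst q $ snd q * (\<integral>x. f p x * f q x \<partial>M))"
    using ff by (subst integral_square_sum) auto
  finally show ?thesis by (simp add: case_prod_beta covariance_def f_def e_def)
qed

lemma normal_charfun:
  assumes "prob_space M" and \<sigma>: "\<sigma> > 0" and D: "distributed M lborel Y (normal_density 0 \<sigma>)"
  shows "(\<integral>x. cis (Y x) \<partial>M) = complex_of_real (exp (- \<sigma>\<^sup>2 / 2))"
proof -
  interpret prob_space M by fact
  have "distributed M lborel (\<lambda>x. Y x / \<sigma>) std_normal_density"
    using normal_standard_normal_convert[OF \<sigma>, of Y 0] D by simp
  then have eq: "distr M lborel (\<lambda>x. Y x / \<sigma>) = std_normal_distribution"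
    and [measurable]: "(\<lambda>x. Y x / \<sigma>) \<in> borel_measurable M"
    by (simp_all add: distributed_def measurable_lborel1)
  have "distr M borel (\<lambda>x. Y x / \<sigma>) = std_normal_distribution"
    unfolding eq[symmetric] by (rule distr_cong) auto
  then have "char (distr M borel (\<lambda>x. Y x / \<sigma>)) \<sigma> = complex_of_real (exp (- \<sigma>\<^sup>2 / 2))"
    by (simp add: char_std_normal_distribution)
  moreover have "char (distr M borel (\<lambda>x. Y x / \<sigma>)) \<sigma> = (\<integral>x. cis (Y x) \<partial>M)"
    using \<sigma> by (subst char_distr_inner) auto
  ultimately show ?thesis by simp
qed

text \<open>The integral of a non-integrable function is 0 by convention, so the vanishing mean of
  \<open>U\<close> is informative only once integrability has been derived.\<close>

lemma gaussian_inner_moments: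
  assumes "prob_space M" and "gaussian M Y"
  shows "integrable M (\<lambda>w. a \<bullet> Y w)" "integrable M (\<lambda>w. (a \<bullet> Y w)\<^sup>2)"
proof -
  interpret prob_space M by fact
  have [measurable]: "Y \<in> borel_measurable M" using assms(2) by (simp add: gaussian_def)
  from assms(2) obtain m s where "(s = 0 \<and> (AE w in M. a \<bullet> Y w = m)) \<or>
      (s > 0 \<and> distributed M lborel (\<lambda>w. a \<bullet> Y w) (normal_density m s))"
    unfolding gaussian_def by blast
  then have "integrable M (\<lambda>w. a \<bullet> Y w) \<and> integrable M (\<lambda>w. (a \<bullet> Y w)\<^sup>2)"
  proof (elim disjE conjE)
    assume ae: "AE w in M. a \<bullet> Y w = m"
    have "integrable M (\<lambda>w. a \<bullet> Y w)"
      by (rule integrable_const_bound[of _ "\<bar>m\<bar>"]) (use ae in auto)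
    moreover have "integrable M (\<lambda>w. (a \<bullet> Y w)\<^sup>2)"
      by (rule integrable_const_bound[of _ "m\<^sup>2"]) (use ae in auto)
    ultimately show ?thesis ..
  next
    assume s: "s > 0" and D: "distributed M lborel (\<lambda>w. a \<bullet> Y w) (normal_density m s)"
    have c: "integrable lborel (\<lambda>x. normal_density m s x * (x - m) ^ j)" for j
      by (rule integrable_normal_moment[OF s])
    have "integrable M (\<lambda>w. a \<bullet> Y w - m)"
      using distributed_integrable[OF D, of "\<lambda>x. x - m"] c[of 1] by simp
    then have 1: "integrable M (\<lambda>w. a \<bullet> Y w)"
      using Bochner_Integration.integrable_add[of M "\<lambda>w. a \<bullet> Y w - m" "\<lambda>_. m"] by simp
    have "integrable M (\<lambda>w. (a \<bullet> Y w - m)\<^sup>2)"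
      using distributed_integrable[OF D, of "\<lambda>x. (x - m)\<^sup>2"] c[of 2] by simp
    then have "integrable M (\<lambda>w. (a \<bullet> Y w - m)\<^sup>2 + (2 * m * (a \<bullet> Y w) - m\<^sup>2))" using 1 by simp
    then show ?thesis using 1 by (simp add: power2_diff algebra_simps)
  qed
  then show "integrable M (\<lambda>w. a \<bullet> Y w)" "integrable M (\<lambda>w. (a \<bullet> Y w)\<^sup>2)" by auto
qed

text \<open>A linear form is either almost surely constant, and then 0 by centering, or normal with
  mean 0; one formula in terms of the second moment covers both cases.\<close>

lemma gaussian_charfun:
  assumes M: "prob_space M" and Y: "gaussian M Y" and centered: "(\<integral>w. Y w \<partial>M) = 0"
  shows "(\<integral>w. a \<bullet> Y w \<partial>M) = 0"
    and "(\<integral>w. cis (a \<bullet> Y w) \<partial>M) = complex_of_real (exp (- (\<integral>w. (a \<bullet> Y w)\<^sup>2 \<partial>M) / 2))"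
proof -
  interpret prob_space M by fact
  have [measurable]: "Y \<in> borel_measurable M" using Y by (simp add: gaussian_def)
  have "integrable M (\<lambda>w. \<Sum>b\<in>Basis. (b \<bullet> Y w) *\<^sub>R b)"
    by (intro Bochner_Integration.integrable_sum integrable_scaleR_left gaussian_inner_moments M Y)
  then have "integrable M Y" by (simp add: inner_commute[of _ "Y _"] euclidean_representation)
  then have zero: "(\<integral>w. a \<bullet> Y w \<partial>M) = 0" using centered by simp
  then show "(\<integral>w. a \<bullet> Y w \<partial>M) = 0" .
  from Y obtain m s where "(s = 0 \<and> (AE w in M. a \<bullet> Y w = m)) \<or>
      (s > 0 \<and> distributed M lborel (\<lambda>w. a \<bullet> Y w) (normal_density m s))"
    unfolding gaussian_def by blast
  then show "(\<integral>w. cis (a \<bullet> Y w) \<partial>M) = complex_of_real (exp (- (\<integral>w. (a \<bullet> Y w)\<^sup>2 \<partial>M) / 2))"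
  proof (elim disjE conjE)
    assume ae: "AE w in M. a \<bullet> Y w = m"
    have "(\<integral>w. a \<bullet> Y w \<partial>M) = (\<integral>w. m \<partial>M)" by (rule integral_cong_AE) (use ae in auto)
    then have "m = 0" using zero by (simp add: prob_space)
    have "(\<integral>w. cis (a \<bullet> Y w) \<partial>M) = (\<integral>w. 1 \<partial>M)"
    proof (rule integral_cong_AE)
      show "(\<lambda>w. cis (a \<bullet> Y w)) \<in> borel_measurable M"
        by (rule measurable_compose[of "\<lambda>w. a \<bullet> Y w" _ borel cis])
           (auto intro!: borel_measurable_continuous_onI continuous_intros)
    qed (use ae \<open>m = 0\<close> in auto)
    moreover have "(\<integral>w. (a \<bullet> Y w)\<^sup>2 \<partial>M) = (\<integral>w. 0 \<partial>M)" by (rule integral_cong_AE) (use ae \<open>m = 0\<close> in auto)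
    ultimately show ?thesis by (simp add: prob_space)
  next
    assume s: "s > 0" and D: "distributed M lborel (\<lambda>w. a \<bullet> Y w) (normal_density m s)"
    have "m = 0" using normal_distributed_expectation[OF s D] zero by simp
    moreover have "(\<integral>w. (a \<bullet> Y w)\<^sup>2 \<partial>M) = s\<^sup>2"
      using normal_distributed_variance[OF s D] zero by simp
    ultimately show ?thesis using normal_charfun[OF M s] D by simp
  qed
qed

section \<open>Exceedances over high thresholds\<close>

lemma continuous_on_outer_square: "continuous_on S (outer_square :: real ^ 'd \<Rightarrow> real ^ 'd ^ 'd)"
  unfolding outer_square_def by (intro continuous_intros)

lemma matrix_entry_le_onorm: "\<bar>D $ i $ j\<bar> \<le> onorm ((*v) (D :: real ^ 'n ^ 'm))"
proof -
  have "D $ i $ j = axis i 1 \<bullet> (D *v axis j 1)"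
    by (simp add: inner_axis' matrix_vector_mult_basis column_def)
  then have "\<bar>D $ i $ j\<bar> \<le> norm (axis i (1::real)) * norm (D *v axis j 1)"
    using Cauchy_Schwarz_ineq2 by metis
  also have "\<dots> \<le> onorm ((*v) D)"
    using onorm[of "(*v) D" "axis j 1"] by (simp add: norm_axis_1)
  finally show ?thesis .
qed

text \<open>The bias condition is formulated in the operator norm, whereas characteristic functions
  see a matrix only through its inner products.\<close>

lemma inner_le_onorm:
  "\<bar>a \<bullet> D\<bar> \<le> (\<Sum>(i, j)\<in>UNIV. \<bar>a $ i $ j\<bar>) * onorm ((*v) (D :: real ^ 'n ^ 'm))"
proof -
  have "\<bar>a \<bullet> D\<bar> \<le> (\<Sum>(i, j)\<in>UNIV. \<bar>a $ i $ j * D $ i $ j\<bar>)"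
    unfolding matrix_inner_sum case_prod_beta by (rule sum_abs)
  also have "\<dots> \<le> (\<Sum>(i, j)\<in>UNIV. \<bar>a $ i $ j\<bar> * onorm ((*v) D))"
    unfolding case_prod_beta abs_mult by (intro sum_mono mult_left_mono matrix_entry_le_onorm) auto
  finally show ?thesis by (simp add: sum_distrib_right case_prod_beta)
qed

text \<open>Bounds the base of the geometric Chernoff rate. It follows from
  \<open>1 + y \<le> exp y\<close> at \<open>y = 1 / z - 1\<close>.\<close>

lemma exp_div_less_one:
  fixes z x :: real
  assumes z: "z > 0" and x: "x < 1 - 1 / z"
  shows "exp x / z < 1"
proof -
  have "exp x < exp (1 - 1 / z)" using x by simp
  moreover have "1 / z \<le> exp (1 / z - 1)" using exp_ge_add_one_self[of "1 / z - 1"] by simp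
  then have "exp (1 - 1 / z) * (1 / z) \<le> exp (1 - 1 / z) * exp (1 / z - 1)" by (intro mult_left_mono) auto
  then have "exp (1 - 1 / z) / z \<le> 1" by (simp add: exp_add[symmetric])
  then have "exp (1 - 1 / z) \<le> z" using z by (simp add: divide_le_eq)
  ultimately have "exp x < z" by (rule less_le_trans)
  then show ?thesis using z by (simp add: divide_less_eq)
qed

lemma uniform_limit_along:
  assumes "uniform_limit A f (\<lambda>_. l) sequentially" "\<And>n. s n \<in> A"
  shows "(\<lambda>n. f n (s n)) \<longlonglongrightarrow> l"
proof (rule tendstoI)
  fix e :: real assume "e > 0"
  from uniform_limitD[OF assms(1) this] show "\<forall>\<^sub>F n in sequentially. dist (f n (s n)) l < e"
    by eventually_elim (use assms(2) in auto)
qed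

text \<open>Choose for each \<open>n\<close> a point that violates the bound, if there is one:
  convergence along this single sequence excludes violations for large \<open>n\<close>.\<close>

lemma eventually_uniform_of_sequences:
  fixes f :: "nat \<Rightarrow> 'b \<Rightarrow> 'c::metric_space"
  assumes seq: "\<And>s. (\<And>n. s n \<in> A) \<Longrightarrow> (\<lambda>n. f n (s n)) \<longlonglongrightarrow> l" and "A \<noteq> {}" "\<delta> > 0"
  shows "\<forall>\<^sub>F n in sequentially. \<forall>x\<in>A. dist (f n x) l < \<delta>"
proof -
  obtain x0 where "x0 \<in> A" using \<open>A \<noteq> {}\<close> by blast
  define s where "s n = (if \<exists>x\<in>A. \<not> dist (f n x) l < \<delta> then SOME x. x \<in> A \<and> \<not> dist (f n x) l < \<delta> else x0)" for n
  have s: "s n \<in> A \<and> (dist (f n (s n)) l < \<delta> \<longrightarrow> (\<forall>x\<in>A. dist (f n x) l < \<delta>))" for n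
  proof (cases "\<exists>x\<in>A. \<not> dist (f n x) l < \<delta>")
    case True
    then have "\<exists>x. x \<in> A \<and> \<not> dist (f n x) l < \<delta>" by blast
    from someI_ex[OF this] True show ?thesis by (simp add: s_def)
  next
    case False
    then show ?thesis using \<open>x0 \<in> A\<close> by (simp add: s_def)
  qed
  then have "\<forall>\<^sub>F n in sequentially. dist (f n (s n)) l < \<delta>"
    using seq[of s] \<open>\<delta> > 0\<close> by (intro tendstoD) auto
  then show ?thesis by eventually_elim (use s in blast)
qed

section \<open>Exceedance laws, the quantile threshold and second moments\<close>

locale extremal_sample = regular_variation M X \<nu>
  for M :: "'a measure" and X :: "'a \<Rightarrow> real ^ 'd" and \<nu> :: "(real ^ 'd) measure" +
  fixes \<omega> :: "real ^ 'd \<Rightarrow> real" and k :: "nat \<Rightarrow> nat" and \<epsilon> :: real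
  assumes cont: "continuous_on UNIV (cdf (distr M borel (\<lambda>w. norm (X w))))"
    and \<omega>[measurable]: "\<omega> \<in> borel_measurable borel"
    and bdd: "bounded (range (scaled \<omega>))"
    and weak: "converges_weakly (\<lambda>t. distr (exceedance_law M X t) borel (scaled \<omega>))
           (distr (limit_law \<nu>) borel (scaled \<omega>)) at_top"
    and k_range: "\<forall>n\<ge>2. k n \<in> {1..n - 1}"
    and k_inf: "filterlim k at_top sequentially"
    and k_small: "(\<lambda>n. real (k n) / real n) \<longlonglongrightarrow> 0"
    and eps: "\<epsilon> > 0"
    and bias: "uniform_limit {1 - \<epsilon>..1 + \<epsilon>}
           (\<lambda>n s. sqrt (real (k n)) *
              onorm ((*v) (second_moment \<omega> (exceedance_law M X (s * threshold M X n (k n)))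
                         - second_moment \<omega> (exceedance_law M X (threshold M X n (k n))))))
           (\<lambda>_. 0) sequentially"
begin

abbreviation F where "F \<equiv> cdf (distr M borel (\<lambda>w. norm (X w)))"
abbreviation tn where "tn n \<equiv> threshold M X n (k n)"
abbreviation Law where "Law \<equiv> exceedance_law M X"

definition sq :: "real ^ 'd \<Rightarrow> real ^ 'd ^ 'd" where "sq x = outer_square (scaled \<omega> x)"
definition Sig :: "real \<Rightarrow> real ^ 'd ^ 'd" where "Sig t = second_moment \<omega> (Law t)"
definition SigInf :: "real ^ 'd ^ 'd" where "SigInf = second_moment \<omega> (limit_law \<nu>)"

lemma scaled_measurable [measurable]: "scaled \<omega> \<in> borel_measurable borel"
  unfolding scaled_def[abs_def] by measurable

lemma sq_measurable [measurable]: "sq \<in> borel_measurable borel"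
  unfolding sq_def[abs_def]
  by (rule measurable_compose[OF scaled_measurable borel_measurable_continuous_onI[OF continuous_on_outer_square]])

lemma ex_sq_bound: "\<exists>C>0. \<forall>x. norm (sq x) \<le> C"
proof -
  obtain B where B: "B > 0" "\<And>x. norm (scaled \<omega> x) \<le> B" using bdd unfolding bounded_pos by auto
  have "bounded (outer_square ` cball (0 :: real ^ 'd) B)"
    by (intro compact_imp_bounded compact_continuous_image continuous_on_outer_square) auto
  then obtain C where "C > 0" "\<And>y. y \<in> cball 0 B \<Longrightarrow> norm (outer_square (y :: real ^ 'd)) \<le> C"
    unfolding bounded_pos by auto
  then show ?thesis using B by (auto simp: sq_def intro!: exI[of _ C])
qed

lemma F_eq: "F x = 1 - Tl x"
proof -
  have "F x = prob {w\<in>space M. norm (X w) \<le> x}"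
    by (simp add: cdf_def measure_distr vimage_def Int_def conj_commute)
  also have "\<dots> = 1 - Tl x"
    unfolding Tl_def by (subst prob_compl[symmetric]) (auto intro!: arg_cong[where f=prob])
  finally show ?thesis .
qed

lemma prob_norm_eq_0: "prob {w\<in>space M. norm (X w) = v} = 0"
proof -
  interpret D: real_distribution "distr M borel (\<lambda>w. norm (X w))" by (rule real_distribution_distr) measurable
  have "measure (distr M borel (\<lambda>w. norm (X w))) {v} = 0"
    using cont by (simp add: D.isCont_cdf[symmetric] continuous_on_eq_continuous_at)
  then show ?thesis by (simp add: measure_distr vimage_def Int_def conj_commute)
qed

text \<open>Continuity of the distribution function makes the quantile exact: the infimum is
  attained because the set is closed, and continuity from the left excludes an overshoot.\<close>

lemma Tl_threshold:
  assumes "n \<ge> 2"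
  shows "Tl (tn n) = real (k n) / real n"
proof -
  interpret D: real_distribution "distr M borel (\<lambda>w. norm (X w))" by (rule real_distribution_distr) measurable
  define q where "q = 1 - real (k n) / real n"
  have kn: "1 \<le> k n" "k n < n" using k_range assms by force+
  then have q: "0 < q" "q < 1" by (auto simp: q_def)
  let ?S = "{x. q \<le> F x}"
  have tS: "tn n = Inf ?S" by (simp add: threshold_def quantile_def q_def)
  have "\<forall>\<^sub>F x in at_top. q < F x" using order_tendstoD(1)[OF D.cdf_lim_at_top_prob q(2)] .
  then obtain x1 where "q < F x1" using eventually_happens[of _ at_top] by fastforce
  then have ne: "?S \<noteq> {}" by (auto intro: less_imp_le)
  have "\<forall>\<^sub>F x in at_bot. F x < q" using order_tendstoD(2)[OF D.cdf_lim_at_bot q(1)] .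
  then obtain x0 where "F x0 < q" using eventually_happens[of _ at_bot] by fastforce
  then have "x0 \<le> y" if "y \<in> ?S" for y
    using that D.cdf_nondecreasing[of y x0] by (cases "x0 \<le> y") auto
  then have bb: "bdd_below ?S" by (rule bdd_belowI)
  have "closed ?S" using cont by (intro closed_Collect_le continuous_intros) auto
  then have "tn n \<in> ?S" unfolding tS using ne bb by (intro closed_contains_Inf)
  moreover have "\<not> q < F (tn n)"
  proof
    assume "q < F (tn n)"
    moreover have "isCont F (tn n)" using cont by (simp add: continuous_on_eq_continuous_at)
    then have "(F \<longlongrightarrow> F (tn n)) (at_left (tn n))"
      by (simp add: isCont_def filterlim_at_split)
    ultimately have "\<forall>\<^sub>F y in at_left (tn n). q < F y" by (intro order_tendstoD(1))
    then have "\<forall>\<^sub>F y in at_left (tn n). q < F y \<and> y < tn n"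
      by (intro eventually_conj) (auto simp: eventually_at_filter)
    then obtain y where "q < F y" "y < tn n" using eventually_happens'[of "at_left (tn n)"] by force
    then have "tn n \<le> y" unfolding tS using bb by (intro cInf_lower) auto
    with \<open>y < tn n\<close> show False by simp
  qed
  ultimately have "F (tn n) = q" by simp
  then show ?thesis by (simp add: F_eq q_def)
qed

lemma threshold_tendsto: "filterlim tn at_top sequentially"
  unfolding filterlim_at_top
proof
  fix Z :: real
  have "\<forall>\<^sub>F n in sequentially. real (k n) / real n < Tl Z" using k_small Tl_pos[of Z] by (rule order_tendstoD)
  then show "\<forall>\<^sub>F n in sequentially. Z \<le> tn n"
    using eventually_ge_at_top[of 2]
  proof eventually_elim
    case (elim n)
    then have "Tl (tn n) < Tl Z" by (simp add: Tl_threshold)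
    then show ?case using Tl_antimono[of "tn n" Z] by (cases "Z \<le> tn n") auto
  qed
qed

lemma sets_Law [measurable_cong, simp]: "sets (Law t) = sets borel" "space (Law t) = UNIV"
  by (auto simp: exceedance_law_def)

lemma sets_limit_law [measurable_cong, simp]: "sets (limit_law \<nu>) = sets borel" "space (limit_law \<nu>) = UNIV"
  by (auto simp: limit_law_def)

lemma emeasure_tail_event: "emeasure M {w \<in> space M. t < norm (X w)} = ennreal (Tl t)"
  by (simp add: Tl_def emeasure_eq_measure)

lemma prob_space_Law: "prob_space (Law t)"
  unfolding exceedance_law_def
proof (rule prob_space.prob_space_distr)
  show "prob_space (uniform_measure M {w \<in> space M. t < norm (X w)})"
    using Tl_pos[of t] by (intro prob_space_uniform_measure) (auto simp: emeasure_tail_event)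
qed measurable

lemma integral_Law:
  fixes f :: "real ^ 'd \<Rightarrow> 'b::{banach, second_countable_topology}"
  assumes [measurable]: "f \<in> borel_measurable borel"
  shows "(\<integral>x. f x \<partial>Law t) = (1 / Tl t) *\<^sub>R (\<integral>w. (if t < norm (X w) then f (X w) else 0) \<partial>M)"
proof -
  let ?A = "{w \<in> space M. t < norm (X w)}"
  have "uniform_measure M ?A = density M (\<lambda>w. ennreal (indicator ?A w / Tl t))"
    unfolding uniform_measure_def emeasure_tail_event
    using Tl_pos[of t] by (intro density_cong) (auto simp: indicator_def divide_ennreal[symmetric])
  then have "(\<integral>x. f x \<partial>Law t) = (\<integral>w. f (X w) \<partial>density M (\<lambda>w. ennreal (indicator ?A w / Tl t)))"
    unfolding exceedance_law_def by (simp add: integral_distr)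
  also have "\<dots> = (\<integral>w. (indicator ?A w / Tl t) *\<^sub>R f (X w) \<partial>M)"
    using Tl_pos[of t] by (intro integral_density) (auto intro: less_imp_le)
  also have "\<dots> = (\<integral>w. (1 / Tl t) *\<^sub>R (if t < norm (X w) then f (X w) else 0) \<partial>M)"
    by (intro Bochner_Integration.integral_cong) (auto simp: indicator_def)
  finally show ?thesis by simp
qed

text \<open>Weak convergence tests bounded functions only, while \<open>h\<close> may be a quadratic
  form or its square. The scaled vectors stay in a fixed ball, so truncating \<open>h\<close> at its
  bound on this ball changes no value that occurs.\<close>

lemma Law_integral_tendsto:
  fixes h :: "real ^ 'd \<Rightarrow> real"
  assumes h: "continuous_on UNIV h"
  shows "((\<lambda>t. \<integral>x. h (scaled \<omega> x) \<partial>Law t) \<longlongrightarrow> (\<integral>x. h (scaled \<omega> x) \<partial>limit_law \<nu>)) at_top"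
proof -
  obtain B where B: "B > 0" "\<And>x. norm (scaled \<omega> x) \<le> B" using bdd unfolding bounded_pos by auto
  have "bounded (h ` cball 0 B)"
    by (intro compact_imp_bounded compact_continuous_image continuous_on_subset[OF h]) auto
  then obtain K where K: "\<And>y. norm y \<le> B \<Longrightarrow> \<bar>h y\<bar> \<le> K" unfolding bounded_iff
    by (metis image_eqI mem_cball_0 real_norm_def)
  define f where "f y = max (- K) (min K (h y))" for y
  have f: "f (scaled \<omega> x) = h (scaled \<omega> x)" for x using K[OF B(2)[of x]] by (auto simp: f_def max_def min_def)
  have fc: "continuous_on UNIV f" unfolding f_def by (intro continuous_intros h)
  have [measurable]: "f \<in> borel_measurable borel" by (rule borel_measurable_continuous_onI[OF fc])
  have "0 \<le> K" using K[of 0] B by auto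
  then have "bounded (range f)" unfolding bounded_iff by (intro exI[of _ K]) (auto simp: f_def)
  then have "((\<lambda>t. \<integral>y. f y \<partial>distr (Law t) borel (scaled \<omega>)) \<longlongrightarrow> (\<integral>y. f y \<partial>distr (limit_law \<nu>) borel (scaled \<omega>))) at_top"
    using weak fc unfolding converges_weakly_def by blast
  then show ?thesis by (simp add: integral_distr f)
qed

text \<open>The constant 1 is a test function for the weak convergence, so the total mass is the
  limit of the masses of the exceedance laws.\<close>

lemma prob_space_limit_law: "prob_space (limit_law \<nu>)"
proof -
  have "((\<lambda>t. \<integral>x. (1::real) \<partial>Law t) \<longlongrightarrow> (\<integral>x. (1::real) \<partial>limit_law \<nu>)) at_top"
    using Law_integral_tendsto[of "\<lambda>_. 1"] by simp
  moreover have "(\<integral>x. 1 \<partial>Law t) = (1::real)" for t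
    using prob_space.prob_space[OF prob_space_Law[of t]] by simp
  ultimately have m: "measure (limit_law \<nu>) UNIV = 1"
    by (simp add: tendsto_const_iff)
  have "emeasure (limit_law \<nu>) UNIV = emeasure \<nu> {x. 1 < norm x}"
    unfolding limit_law_def by (subst emeasure_density) (auto simp: norm_ball_borel)
  also have "\<dots> \<le> emeasure \<nu> {x. 1 \<le> norm x}" by (intro emeasure_mono) (auto simp: norm_ball_borel)
  also have "\<dots> < \<infinity>" by (rule nu_finite) simp
  finally have "emeasure (limit_law \<nu>) UNIV = ennreal 1"
    using m by (simp add: emeasure_eq_ennreal_measure)
  then show ?thesis by (intro prob_spaceI) simp
qed

lemma integrable_bounded:
  fixes f :: "real ^ 'd \<Rightarrow> 'b::{banach, second_countable_topology}"
  assumes "prob_space L" "sets L = sets borel" "f \<in> borel_measurable borel" "\<And>x. norm (f x) \<le> B"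
  shows "integrable L f"
proof -
  interpret L: prob_space L by fact
  have "f \<in> borel_measurable L" using assms(3) measurable_cong_sets[OF assms(2) refl] by blast
  then show ?thesis using assms(4) by (intro L.integrable_const_bound[of _ B]) auto
qed

lemma integrable_sq: "prob_space L \<Longrightarrow> sets L = sets borel \<Longrightarrow> integrable L sq"
  using ex_sq_bound integrable_bounded[OF _ _ sq_measurable] by blast

lemma inner_second_moment:
  assumes "prob_space L" "sets L = sets borel"
  shows "a \<bullet> second_moment \<omega> L = (\<integral>x. a \<bullet> sq x \<partial>L)"
  using integrable_sq[OF assms] by (simp add: second_moment_def sq_def[symmetric])

lemma Sig_inner_tendsto: "((\<lambda>t. a \<bullet> Sig t) \<longlongrightarrow> a \<bullet> SigInf) at_top"
  unfolding Sig_def SigInf_def inner_second_moment[OF prob_space_Law sets_Law(1)]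
    inner_second_moment[OF prob_space_limit_law sets_limit_law(1)] sq_def
  by (rule Law_integral_tendsto) (intro continuous_intros continuous_on_outer_square)

lemma Sig_tendsto: "(Sig \<longlongrightarrow> SigInf) at_top"
  unfolding tendsto_componentwise_iff[of Sig] using Sig_inner_tendsto by (simp add: inner_commute)

lemma norm_Sig_le:
  assumes "\<And>x. norm (sq x) \<le> C"
  shows "norm (Sig t) \<le> C"
proof -
  interpret L: prob_space "Law t" by (rule prob_space_Law)
  have "norm (Sig t) \<le> (\<integral>x. norm (sq x) \<partial>Law t)"
    unfolding Sig_def second_moment_def sq_def[symmetric] by (rule integral_norm_bound)
  also have "\<dots> \<le> (\<integral>x. C \<partial>Law t)"
    using assms integrable_sq[OF prob_space_Law sets_Law(1)] by (intro integral_mono) auto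
  finally show ?thesis by (simp add: L.prob_space[unfolded sets_Law(2)])
qed

lemma transpose_second_moment:
  assumes "prob_space L" "sets L = sets borel"
  shows "transpose (second_moment \<omega> L) = second_moment \<omega> L"
proof -
  have "transpose (second_moment \<omega> L) = (\<integral>x. transpose (sq x) \<partial>L)"
    unfolding second_moment_def sq_def[symmetric]
    using integral_bounded_linear[OF bounded_linear_transpose integrable_sq[OF assms]] by simp
  then show ?thesis by (simp add: second_moment_def sq_def transpose_outer_square)
qed

end

section \<open>The characteristic function of a single exceedance\<close>

lemma norm_cis_Taylor: "cmod (cis y - (1 + \<i> * complex_of_real y - complex_of_real (y\<^sup>2 / 2))) \<le> \<bar>y\<bar> ^ 3 / 6"
proof -
  have "(\<Sum>j\<le>2. (\<i> * complex_of_real y) ^ j / fact j) = 1 + \<i> * complex_of_real y - complex_of_real (y\<^sup>2 / 2)"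
  proof -
    have "(\<i> * complex_of_real y)\<^sup>2 = - complex_of_real (y\<^sup>2)" by (simp add: power_mult_distrib)
    moreover have "(\<Sum>j\<le>2. (\<i> * complex_of_real y) ^ j / fact j) = 1 + \<i> * complex_of_real y + (\<i> * complex_of_real y)\<^sup>2 / 2"
      by (simp add: numeral_2_eq_2)
    ultimately show ?thesis by simp
  qed
  moreover have "fact (Suc 2) = (6 :: real)" by (simp add: numeral_2_eq_2)
  ultimately show ?thesis using iexp_approx1[of y 2] by (simp add: cis_conv_exp numeral_3_eq_3 numeral_2_eq_2)
qed

text \<open>The law enters the remainder only through the bound \<open>B\<close>, which permits it
  to change with the sample size and with the level.\<close>

lemma norm_integral_cis_Taylor:
  assumes "prob_space L" and y[measurable]: "y \<in> borel_measurable L" and B: "\<And>x. \<bar>y x\<bar> \<le> B" and r: "r > 0"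
  shows "cmod ((\<integral>x. cis (y x / r) \<partial>L) - (1 + \<i> * complex_of_real ((\<integral>x. y x \<partial>L) / r) -
     complex_of_real ((\<integral>x. (y x)\<^sup>2 \<partial>L) / (2 * r\<^sup>2)))) \<le> B ^ 3 / (6 * r ^ 3)"
proof -
  interpret prob_space L by fact
  have "0 \<le> B" using B[of undefined] by linarith
  have [measurable]: "(\<lambda>x. cis (y x / r)) \<in> borel_measurable L"
    by (rule measurable_compose[of "\<lambda>x. y x / r" _ borel cis]) (auto intro!: borel_measurable_continuous_onI continuous_intros)
  have b2: "(y x)\<^sup>2 \<le> B\<^sup>2" for x using power_mono[OF B[of x], of 2] by simp
  have i: "integrable L (\<lambda>x. cis (y x / r))" "integrable L y" "integrable L (\<lambda>x. (y x)\<^sup>2)"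
    by (auto intro: integrable_const_bound[of "\<lambda>x. cis (y x / r)" 1] integrable_const_bound[of y B]
        integrable_const_bound[of "\<lambda>x. (y x)\<^sup>2" "B\<^sup>2"] simp: B b2)
  have ic: "integrable L (\<lambda>x. complex_of_real (y x))" "integrable L (\<lambda>x. complex_of_real ((y x)\<^sup>2))"
    using i by (intro integrable_of_real; simp)+
  let ?T = "\<lambda>x. 1 + (\<i> / complex_of_real r) * complex_of_real (y x) - (1 / complex_of_real (2 * r\<^sup>2)) * complex_of_real ((y x)\<^sup>2)"
  have iT: "integrable L ?T" using ic by (intro Bochner_Integration.integrable_diff Bochner_Integration.integrable_add integrable_mult_right) auto
  have "(\<integral>x. ?T x \<partial>L) = 1 + (\<i> / complex_of_real r) * (\<integral>x. complex_of_real (y x) \<partial>L) - (1 / complex_of_real (2 * r\<^sup>2)) * (\<integral>x. complex_of_real ((y x)\<^sup>2) \<partial>L)"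
    using ic by (simp add: prob_space del: of_real_power)
  then have eT: "(\<integral>x. ?T x \<partial>L) = 1 + \<i> * complex_of_real ((\<integral>x. y x \<partial>L) / r) - complex_of_real ((\<integral>x. (y x)\<^sup>2 \<partial>L) / (2 * r\<^sup>2))"
    unfolding integral_complex_of_real by simp
  have bd: "cmod (cis (y x / r) - ?T x) \<le> B ^ 3 / (6 * r ^ 3)" for x
  proof -
    have "?T x = 1 + \<i> * complex_of_real (y x / r) - complex_of_real ((y x / r)\<^sup>2 / 2)"
    proof -
      have "(y x / r)\<^sup>2 / 2 = (1 / (2 * r\<^sup>2)) * (y x)\<^sup>2" by (simp add: power_divide)
      then have "complex_of_real ((y x / r)\<^sup>2 / 2) = (1 / complex_of_real (2 * r\<^sup>2)) * complex_of_real ((y x)\<^sup>2)"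
        by (simp only: of_real_mult of_real_divide of_real_1)
      then show ?thesis by (simp del: of_real_power)
    qed
    then have "cmod (cis (y x / r) - ?T x) \<le> \<bar>y x / r\<bar> ^ 3 / 6"
      using norm_cis_Taylor[of "y x / r"] by (simp only:)
    also have "\<dots> \<le> (B / r) ^ 3 / 6"
      using B[of x] r by (intro divide_right_mono power_mono) (auto simp: abs_divide divide_right_mono)
    finally show ?thesis by (simp add: power_divide)
  qed
  have "cmod (\<integral>x. cis (y x / r) - ?T x \<partial>L) \<le> (\<integral>x. cmod (cis (y x / r) - ?T x) \<partial>L)" by (rule integral_norm_bound)
  also have "\<dots> \<le> (\<integral>x. B ^ 3 / (6 * r ^ 3) \<partial>L)"
    using i iT bd by (intro integral_mono) auto
  finally show ?thesis using i iT eT by (simp add: prob_space)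
qed

context extremal_sample
begin

definition lim_var :: "real ^ 'd ^ 'd \<Rightarrow> real" where
  "lim_var a = (\<integral>x. (a \<bullet> sq x - a \<bullet> SigInf)\<^sup>2 \<partial>limit_law \<nu>)"

text \<open>The contribution of one exceedance to \<open>cis (a \<bullet> Z)\<close>. The centering
  refers to the deterministic threshold even when the point is drawn above another level; the
  mismatch is the bias.\<close>

definition phase :: "real ^ 'd ^ 'd \<Rightarrow> nat \<Rightarrow> real ^ 'd \<Rightarrow> complex" where
  "phase a n x = cis (a \<bullet> (sq x - Sig (tn n)) / sqrt (real (k n)))"

lemma phase_measurable [measurable]: "phase a n \<in> borel_measurable borel"
proof -
  have "cis \<in> borel_measurable borel" by (intro borel_measurable_continuous_onI continuous_intros)
  moreover have "(\<lambda>x. a \<bullet> (sq x - Sig (tn n)) / sqrt (real (k n))) \<in> borel_measurable borel" by measurable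
  ultimately show ?thesis unfolding phase_def[abs_def] by (rule measurable_compose[rotated])
qed

lemma norm_phase [simp]: "norm (phase a n x) = 1" by (simp add: phase_def)

lemma Law_square_tendsto:
  "((\<lambda>t. \<integral>x. (a \<bullet> sq x)\<^sup>2 \<partial>Law t) \<longlongrightarrow> lim_var a + (a \<bullet> SigInf)\<^sup>2) at_top"
proof -
  interpret L: prob_space "limit_law \<nu>" by (rule prob_space_limit_law)
  obtain C where C: "\<And>x. norm (sq x) \<le> C" using ex_sq_bound by blast
  have i1: "integrable (limit_law \<nu>) (\<lambda>x. a \<bullet> sq x)"
    using integrable_sq[OF prob_space_limit_law sets_limit_law(1)] by simp
  have b: "\<bar>a \<bullet> sq x\<bar> \<le> norm a * C" for x
    using Cauchy_Schwarz_ineq2[of a "sq x"] C[of x] mult_left_mono[OF C[of x], of "norm a"] by auto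
  have b2: "norm ((a \<bullet> sq x)\<^sup>2) \<le> (norm a * C)\<^sup>2" for x
    using power_mono[OF b[of x], of 2] by simp
  have i2: "integrable (limit_law \<nu>) (\<lambda>x. (a \<bullet> sq x)\<^sup>2)"
    by (rule integrable_bounded[OF prob_space_limit_law sets_limit_law(1) _ b2]) measurable
  have m: "(\<integral>x. a \<bullet> sq x \<partial>limit_law \<nu>) = a \<bullet> SigInf"
    unfolding SigInf_def by (rule inner_second_moment[symmetric, OF prob_space_limit_law sets_limit_law(1)])
  have "lim_var a = (\<integral>x. (a \<bullet> sq x)\<^sup>2 - 2 * (a \<bullet> SigInf) * (a \<bullet> sq x) + (a \<bullet> SigInf)\<^sup>2 \<partial>limit_law \<nu>)"
    unfolding lim_var_def by (intro Bochner_Integration.integral_cong refl) (simp add: power2_diff)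
  also have "\<dots> = (\<integral>x. (a \<bullet> sq x)\<^sup>2 \<partial>limit_law \<nu>) - 2 * (a \<bullet> SigInf) * (a \<bullet> SigInf) + (a \<bullet> SigInf)\<^sup>2"
    using i1 i2 m L.prob_space by simp
  finally have "lim_var a + (a \<bullet> SigInf)\<^sup>2 = (\<integral>x. (a \<bullet> sq x)\<^sup>2 \<partial>limit_law \<nu>)"
    by (simp add: power2_eq_square)
  moreover have "((\<lambda>t. \<integral>x. (a \<bullet> sq x)\<^sup>2 \<partial>Law t) \<longlongrightarrow> (\<integral>x. (a \<bullet> sq x)\<^sup>2 \<partial>limit_law \<nu>)) at_top"
    unfolding sq_def
    by (rule Law_integral_tendsto) (intro continuous_intros continuous_on_outer_square)
  ultimately show ?thesis by simp
qed

lemma lim_var_nonneg: "0 \<le> lim_var a" unfolding lim_var_def by simp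

lemma sqrt_k_at_top: "filterlim (\<lambda>n. sqrt (real (k n))) at_top sequentially"
  by (rule filterlim_compose[OF sqrt_at_top filterlim_compose[OF filterlim_real_sequentially k_inf]])

text \<open>The cap \<open>1 / 2\<close> keeps all levels considered at least half the threshold, so
  that they tend to infinity with it.\<close>

definition \<delta>0 :: real where "\<delta>0 = min \<epsilon> (1 / 2)"

lemma delta0: "0 < \<delta>0" "\<delta>0 \<le> 1 / 2" "\<delta>0 \<le> \<epsilon>" using eps by (auto simp: \<delta>0_def)

text \<open>A central limit argument for laws that vary with \<open>n\<close>. The characteristic
  function is compared with \<open>w n = 1 - lim_var a / (2 * k n)\<close>; numbers in the unit disc
  have \<open>k\<close>-th powers that differ by at most \<open>k\<close> times their distance.
  After this factor the Taylor terms contribute the rescaled bias, half the error of the variance,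
  and a remainder of order \<open>1 / sqrt k\<close>. Admitting an arbitrary sequence
  \<open>s\<close> of relative levels prepares the passage to a uniform statement.\<close>

theorem phase_power_tendsto:
  assumes s: "\<And>n. s n \<in> {1 - \<delta>0..1 + \<delta>0}"
  shows "(\<lambda>n. (\<integral>x. phase a n x \<partial>Law (s n * tn n)) ^ k n) \<longlonglongrightarrow> complex_of_real (exp (- lim_var a / 2))"
proof -
  define L where "L n = Law (s n * tn n)" for n
  define r where "r n = sqrt (real (k n))" for n
  define y where "y n x = a \<bullet> (sq x - Sig (tn n))" for n x
  define m where "m n = (\<integral>x. y n x \<partial>L n)" for n
  define v where "v n = (\<integral>x. (y n x)\<^sup>2 \<partial>L n)" for n
  define \<phi> where "\<phi> n = (\<integral>x. phase a n x \<partial>L n)" for n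
  define w where "w n = 1 + (- lim_var a / 2) / real (k n)" for n
  have L: "prob_space (L n)" and sL[measurable_cong]: "sets (L n) = sets borel" for n
    by (simp_all add: L_def prob_space_Law)
  obtain C where C: "C > 0" "\<And>x. norm (sq x) \<le> C" using ex_sq_bound by blast
  have s_bd: "1 / 2 \<le> s n" for n using s[of n] delta0 by auto
  have "filterlim (\<lambda>n. s n * tn n) at_top sequentially"
  proof (rule filterlim_at_top_mono)
    show "filterlim (\<lambda>n. 1 / 2 * tn n) at_top sequentially"
      by (rule filterlim_tendsto_pos_mult_at_top[OF tendsto_const _ threshold_tendsto]) simp
    have "\<forall>\<^sub>F n in sequentially. 0 \<le> tn n" using threshold_tendsto by (simp add: filterlim_at_top)
    then show "\<forall>\<^sub>F n in sequentially. 1 / 2 * tn n \<le> s n * tn n"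
      by eventually_elim (intro mult_right_mono s_bd)
  qed
  note S = this
  have ySig: "integrable (L n) sq" for n by (rule integrable_sq[OF L sL])
  have int_sq: "(\<integral>x. a \<bullet> sq x \<partial>L n) = a \<bullet> Sig (s n * tn n)" for n
    unfolding Sig_def L_def by (rule inner_second_moment[symmetric, OF prob_space_Law sets_Law(1)])
  have one: "(\<integral>x. c \<partial>L n) = c" for c :: real and n using prob_space.prob_space[OF L] by simp
  \<comment> \<open>The first-order term is the bias tested against \<open>a\<close>; all dependence
    on the level that is not automatically negligible sits here.\<close>
  have m_eq: "m n = a \<bullet> (Sig (s n * tn n) - Sig (tn n))" for n
    using ySig[of n] one[of n "a \<bullet> Sig (tn n)"] int_sq[of n] unfolding m_def y_def inner_diff_right
    by (subst Bochner_Integration.integral_diff) (auto intro: finite_measure.integrable_const prob_space.finite_measure L)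
  have "(\<lambda>n. r n * m n) \<longlonglongrightarrow> 0"
  proof (rule Lim_null_comparison)
    let ?A = "\<Sum>(i, j)\<in>UNIV. \<bar>a $ i $ j\<bar>"
    let ?o = "\<lambda>n. sqrt (real (k n)) * onorm ((*v) (Sig (s n * tn n) - Sig (tn n)))"
    have "(\<lambda>n. ?o n) \<longlonglongrightarrow> 0"
      unfolding Sig_def
    proof (rule uniform_limit_along[OF bias])
      show "s n \<in> {1 - \<epsilon>..1 + \<epsilon>}" for n using s[of n] delta0 by auto
    qed
    then show "(\<lambda>n. ?A * ?o n) \<longlonglongrightarrow> 0" by (rule tendsto_mult_right_zero)
    show "\<forall>\<^sub>F n in sequentially. norm (r n * m n) \<le> ?A * ?o n"
    proof (rule always_eventually, rule allI)
      fix n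
      have "norm (r n * m n) = r n * \<bar>m n\<bar>" by (simp add: r_def abs_mult)
      also have "\<dots> \<le> r n * (?A * onorm ((*v) (Sig (s n * tn n) - Sig (tn n))))"
        unfolding m_eq by (intro mult_left_mono inner_le_onorm) (simp add: r_def)
      finally show "norm (r n * m n) \<le> ?A * ?o n" by (simp add: r_def mult_ac)
    qed
  qed
  note rm = this
  have v_eq: "v n = (\<integral>x. (a \<bullet> sq x)\<^sup>2 \<partial>L n) - 2 * (a \<bullet> Sig (tn n)) * (a \<bullet> Sig (s n * tn n)) + (a \<bullet> Sig (tn n))\<^sup>2" for n
  proof -
    interpret Ln: prob_space "L n" by (rule L)
    have b: "\<bar>a \<bullet> sq x\<bar> \<le> norm a * C" for x
      using Cauchy_Schwarz_ineq2[of a "sq x"] mult_left_mono[OF C(2)[of x], of "norm a"] by auto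
    have b2: "norm ((a \<bullet> sq x)\<^sup>2) \<le> (norm a * C)\<^sup>2" for x using power_mono[OF b[of x], of 2] by simp
    have i2: "integrable (L n) (\<lambda>x. (a \<bullet> sq x)\<^sup>2)"
      by (rule integrable_bounded[OF L sL _ b2]) measurable
    have "v n = (\<integral>x. (a \<bullet> sq x)\<^sup>2 - 2 * (a \<bullet> Sig (tn n)) * (a \<bullet> sq x) + (a \<bullet> Sig (tn n))\<^sup>2 \<partial>L n)"
      unfolding v_def y_def by (intro Bochner_Integration.integral_cong refl) (simp add: inner_diff_right power2_diff)
    also have "\<dots> = (\<integral>x. (a \<bullet> sq x)\<^sup>2 \<partial>L n) - 2 * (a \<bullet> Sig (tn n)) * (\<integral>x. a \<bullet> sq x \<partial>L n) + (a \<bullet> Sig (tn n))\<^sup>2"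
      using i2 ySig[of n] Ln.prob_space by simp
    finally show ?thesis by (simp add: int_sq)
  qed
  have lim1: "(\<lambda>n. a \<bullet> Sig (tn n)) \<longlonglongrightarrow> a \<bullet> SigInf" by (rule filterlim_compose[OF Sig_inner_tendsto threshold_tendsto])
  have lim2: "(\<lambda>n. a \<bullet> Sig (s n * tn n)) \<longlonglongrightarrow> a \<bullet> SigInf" by (rule filterlim_compose[OF Sig_inner_tendsto S])
  have lim3: "(\<lambda>n. \<integral>x. (a \<bullet> sq x)\<^sup>2 \<partial>L n) \<longlonglongrightarrow> lim_var a + (a \<bullet> SigInf)\<^sup>2"
    unfolding L_def by (rule filterlim_compose[OF Law_square_tendsto S])
  have "v \<longlonglongrightarrow> (lim_var a + (a \<bullet> SigInf)\<^sup>2) - 2 * (a \<bullet> SigInf) * (a \<bullet> SigInf) + (a \<bullet> SigInf)\<^sup>2"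
    unfolding v_eq[abs_def] by (intro tendsto_intros lim1 lim2 lim3)
  then have v_lim: "v \<longlonglongrightarrow> lim_var a" by (simp add: power2_eq_square)
  define B where "B = norm a * (2 * C)"
  have yB: "\<bar>y n x\<bar> \<le> B" for n x
  proof -
    have "norm (sq x - Sig (tn n)) \<le> 2 * C"
      using norm_triangle_ineq4[of "sq x" "Sig (tn n)"] C(2)[of x] norm_Sig_le[OF C(2), of "tn n"] by linarith
    then have "norm a * norm (sq x - Sig (tn n)) \<le> B" unfolding B_def by (intro mult_left_mono) auto
    then show ?thesis using Cauchy_Schwarz_ineq2[of a "sq x - Sig (tn n)"] by (simp add: y_def)
  qed
  have [measurable]: "y n \<in> borel_measurable borel" for n unfolding y_def by measurable
  have Taylor: "cmod (\<phi> n - (1 + \<i> * complex_of_real (m n / r n) - complex_of_real (v n / (2 * (r n)\<^sup>2)))) \<le> B ^ 3 / (6 * r n ^ 3)"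
    if "k n > 0" for n
    unfolding \<phi>_def phase_def m_def v_def using that yB
    by (fold y_def r_def, intro norm_integral_cis_Taylor L) (auto simp: r_def)
  have wlim: "(\<lambda>n. w n ^ k n) \<longlonglongrightarrow> exp (- lim_var a / 2)"
    unfolding w_def by (rule filterlim_compose[OF tendsto_exp_limit_sequentially k_inf])
  have err: "(\<lambda>n. \<bar>r n * m n\<bar> + \<bar>lim_var a - v n\<bar> / 2 + B ^ 3 / 6 * inverse (r n)) \<longlonglongrightarrow> \<bar>0\<bar> + \<bar>lim_var a - lim_var a\<bar> / 2 + B ^ 3 / 6 * 0"
    by (intro tendsto_intros rm v_lim tendsto_inverse_0_at_top[OF sqrt_k_at_top[folded r_def]]) simp_all
  \<comment> \<open>With \<open>lim_var a \<le> k n\<close> the real number \<open>w n\<close> lies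
    in the unit disc, as the comparison of powers requires.\<close>
  have kbig: "\<forall>\<^sub>F n in sequentially. max 1 (lim_var a) \<le> real (k n)"
    using filterlim_compose[OF filterlim_real_sequentially k_inf] unfolding filterlim_at_top by (rule spec)
  have "(\<lambda>n. \<phi> n ^ k n - complex_of_real (w n) ^ k n) \<longlonglongrightarrow> 0"
  proof (rule Lim_null_comparison)
    show "(\<lambda>n. \<bar>r n * m n\<bar> + \<bar>lim_var a - v n\<bar> / 2 + B ^ 3 / 6 * inverse (r n)) \<longlonglongrightarrow> 0" using err by simp
    from kbig show "\<forall>\<^sub>F n in sequentially. norm (\<phi> n ^ k n - complex_of_real (w n) ^ k n) \<le>
        \<bar>r n * m n\<bar> + \<bar>lim_var a - v n\<bar> / 2 + B ^ 3 / 6 * inverse (r n)"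
    proof eventually_elim
      case (elim n)
      let ?k = "real (k n)"
      have k: "?k \<ge> 1" "lim_var a \<le> ?k" using elim by auto
      have r: "r n > 0" "(r n)\<^sup>2 = ?k" using k by (auto simp: r_def)
      have "cmod (\<phi> n) \<le> (\<integral>x. cmod (phase a n x) \<partial>L n)" unfolding \<phi>_def by (rule integral_norm_bound)
      then have \<phi>1: "cmod (\<phi> n) \<le> 1" using one[of n 1] by simp
      have "lim_var a / ?k \<le> 1" using k by (simp add: divide_le_eq)
      moreover have "0 \<le> lim_var a / ?k" using lim_var_nonneg k by simp
      moreover have "w n = 1 - (lim_var a / ?k) / 2" by (simp add: w_def)
      ultimately have "\<bar>w n\<bar> \<le> 1" by (simp add: abs_le_iff)
      then have w1: "cmod (complex_of_real (w n)) \<le> 1" by (simp only: norm_of_real)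
      have "norm (\<phi> n ^ k n - complex_of_real (w n) ^ k n) \<le> ?k * cmod (\<phi> n - complex_of_real (w n))"
        by (rule norm_power_diff[OF \<phi>1 w1])
      also have "\<phi> n - complex_of_real (w n) = (\<phi> n - (1 + \<i> * complex_of_real (m n / r n) - complex_of_real (v n / (2 * (r n)\<^sup>2))))
          + \<i> * complex_of_real (m n / r n) + complex_of_real ((lim_var a - v n) / (2 * ?k))"
        using k by (simp add: w_def r(2) diff_divide_distrib)
      also have "cmod \<dots> \<le> cmod (\<phi> n - (1 + \<i> * complex_of_real (m n / r n) - complex_of_real (v n / (2 * (r n)\<^sup>2))))
          + cmod (\<i> * complex_of_real (m n / r n)) + cmod (complex_of_real ((lim_var a - v n) / (2 * ?k)))"
        by (rule order_trans[OF norm_triangle_ineq add_right_mono[OF norm_triangle_ineq]])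
      also have "\<dots> \<le> B ^ 3 / (6 * r n ^ 3) + \<bar>m n / r n\<bar> + \<bar>(lim_var a - v n) / (2 * ?k)\<bar>"
        unfolding norm_mult norm_of_real norm_ii mult_1 by (intro add_right_mono Taylor) (use k in simp)
      finally have "norm (\<phi> n ^ k n - complex_of_real (w n) ^ k n) \<le>
        ?k * (B ^ 3 / (6 * r n ^ 3) + \<bar>m n / r n\<bar> + \<bar>(lim_var a - v n) / (2 * ?k)\<bar>)"
        using k by simp
      also have "\<dots> = ?k * (B ^ 3 / (6 * r n ^ 3)) + ?k * \<bar>m n / r n\<bar> + ?k * \<bar>(lim_var a - v n) / (2 * ?k)\<bar>"
        by (simp add: distrib_left)
      also have "?k * (B ^ 3 / (6 * r n ^ 3)) = B ^ 3 / 6 * inverse (r n)"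
        unfolding r(2)[symmetric] using r(1) by (simp add: power2_eq_square power3_eq_cube field_simps)
      also have "?k * \<bar>m n / r n\<bar> = \<bar>r n * m n\<bar>"
        unfolding r(2)[symmetric] using r(1) by (simp add: abs_mult abs_divide power2_eq_square)
      also have "?k * \<bar>(lim_var a - v n) / (2 * ?k)\<bar> = \<bar>lim_var a - v n\<bar> / 2"
        using k by (simp add: abs_divide)
      finally show ?case by (simp only: add_ac)
    qed
  qed
  moreover have "(\<lambda>n. complex_of_real (w n) ^ k n) \<longlonglongrightarrow> complex_of_real (exp (- lim_var a / 2))"
    using tendsto_of_real[OF wlim] by simp
  ultimately have "(\<lambda>n. \<phi> n ^ k n) \<longlonglongrightarrow> complex_of_real (exp (- lim_var a / 2))" by (rule Lim_transform[rotated])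
  then show ?thesis by (simp add: \<phi>_def L_def)
qed

section \<open>Concentration of the order statistic around the threshold\<close>

abbreviation PX where "PX \<equiv> distr M borel X"

lemma prob_space_PX: "prob_space PX" by (rule prob_space_distr) measurable

lemma tail_PX: "prob_space.tail PX norm u = Tl u"
  unfolding prob_space.tail_def[OF prob_space_PX] Tl_def
  by (subst measure_distr) (auto intro!: arg_cong[where f=prob])

lemma tail_mean_PX:
  assumes [measurable]: "g \<in> borel_measurable borel"
  shows "prob_space.tail_mean PX norm g u = (\<integral>x. g x \<partial>Law u)"
  unfolding prob_space.tail_mean_def[OF prob_space_PX] tail_PX integral_Law[OF assms]
  by (subst integral_distr) (auto simp: scaleR_conv_of_real)

lemma atomless_PX: "measure PX {x\<in>space PX. norm x = v} = 0"
  using prob_norm_eq_0[of v] by (subst measure_distr) (auto simp: vimage_def Int_def conj_commute)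

abbreviation samp where "samp n \<equiv> PiM {1..n} (\<lambda>_::nat. PX)"

lemma eventually_k_range: "\<forall>\<^sub>F n in sequentially. n \<ge> 2 \<and> 1 \<le> k n \<and> k n < n \<and> 0 < tn n"
  using eventually_ge_at_top[of 2] filterlim_at_top_dense[THEN iffD1, OF threshold_tendsto, rule_format, of 0]
proof eventually_elim
  case (elim n)
  then show ?case using k_range by force
qed

lemma power_k_tendsto_0:
  fixes \<rho> :: real
  assumes "0 \<le> \<rho>" "\<rho> < 1"
  shows "(\<lambda>n. \<rho> ^ k n) \<longlonglongrightarrow> 0"
  by (rule filterlim_compose[OF LIMSEQ_realpow_zero[OF assms] k_inf])

lemma exceedances_PX_pred:
  "Measurable.pred (samp n) (\<lambda>x. exceedances norm {1..n} u x \<le> real j)"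
  "Measurable.pred (samp n) (\<lambda>x. real j \<le> exceedances norm {1..n} u x)"
proof -
  interpret P: prob_space PX by (rule prob_space_PX)
  have "(\<lambda>x. exceedances norm {1..n} u x) \<in> borel_measurable (samp n)"
  proof (cases "n = 0")
    case True
    then show ?thesis by (simp add: exceedances_def)
  next
    case False
    then show ?thesis using P.exceedances_measurable(2)[of norm "{1..n}" "{1..n}" 1] by auto
  qed
  note this[measurable]
  show "Measurable.pred (samp n) (\<lambda>x. exceedances norm {1..n} u x \<le> real j)"
    "Measurable.pred (samp n) (\<lambda>x. real j \<le> exceedances norm {1..n} u x)" by measurable
qed

text \<open>The expected number of points above \<open>b * tn n\<close> is at most
  \<open>q * k n\<close> with \<open>q < 1\<close>, so the probability of reaching
  \<open>k n\<close> decays geometrically in \<open>k n\<close>.\<close>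

lemma upper_order_statistic_concentration:
  assumes "1 < b"
  shows "(\<lambda>n. measure (samp n) {x\<in>space (samp n). real (k n) \<le> exceedances norm {1..n} (b * tn n) x}) \<longlonglongrightarrow> 0"
proof -
  interpret P: prob_space PX by (rule prob_space_PX)
  obtain q where q: "0 < q" "q < 1" "\<forall>\<^sub>F t in at_top. Tl (b * t) \<le> q * Tl t"
    using tail_ratio_bound[OF assms] by blast
  \<comment> \<open>A point between 1 and \<open>1 / q\<close>: the upper tail needs
    \<open>1 < z\<close>, and \<open>z < 1 / q\<close> makes the rate \<open>\<rho>\<close> less
    than 1.\<close>
  define z where "z = (1 + 1 / q) / 2"
  have "1 < 1 / q" using q by (simp add: less_divide_eq)
  then have z: "1 < z" "z < 1 / q" by (auto simp: z_def)
  define \<rho> where "\<rho> = exp (q * (z - 1)) / z"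
  have "q * z < 1" using z(2) q(1) by (simp add: less_divide_eq mult.commute)
  then have "q < 1 / z" using z(1) by (simp add: less_divide_eq)
  then have "q * (z - 1) < 1 / z * (z - 1)" using z(1) by (intro mult_strict_right_mono) auto
  also have "\<dots> = 1 - 1 / z" using z(1) by (simp add: right_diff_distrib)
  finally have \<rho>: "\<rho> < 1" "0 \<le> \<rho>" unfolding \<rho>_def using exp_div_less_one[of z "q * (z - 1)"] z(1) by auto
  show ?thesis
  proof (rule Lim_null_comparison[OF _ power_k_tendsto_0[OF \<rho>(2,1)]])
    show "\<forall>\<^sub>F n in sequentially. norm (measure (samp n) {x\<in>space (samp n). real (k n) \<le> exceedances norm {1..n} (b * tn n) x}) \<le> \<rho> ^ k n"
      using eventually_k_range eventually_compose_filterlim[OF q(3) threshold_tendsto]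
    proof eventually_elim
      case (elim n)
      have "measure (samp n) {x\<in>space (samp n). real (k n) \<le> exceedances norm {1..n} (b * tn n) x} \<le>
          exp (real (card {1..n}) * P.tail norm (b * tn n) * (z - 1)) / z ^ k n"
      proof (rule P.prob_exceedances_Chernoff)
        show "z ^ k n \<le> z ^ card {i\<in>{1..n}. b * tn n < norm (x i)}" if "real (k n) \<le> exceedances norm {1..n} (b * tn n) x" for x
          using that z(1) by (intro power_increasing) (auto simp: exceedances_card)
      qed (use z(1) exceedances_PX_pred in auto)
      also have "\<dots> \<le> exp (real (k n) * (q * (z - 1))) / z ^ k n"
      proof (intro divide_right_mono)
        have "real n * Tl (b * tn n) \<le> real n * (q * (real (k n) / real n))"
          using elim by (intro mult_left_mono) (auto simp: Tl_threshold)
        also have "\<dots> = real (k n) * q" using elim by simp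
        finally have "real n * Tl (b * tn n) * (z - 1) \<le> real (k n) * q * (z - 1)"
          using z(1) by (intro mult_right_mono) auto
        then show "exp (real (card {1..n}) * P.tail norm (b * tn n) * (z - 1)) \<le> exp (real (k n) * (q * (z - 1)))"
          by (simp add: tail_PX mult.assoc)
      qed (use z(1) in simp)
      also have "\<dots> = \<rho> ^ k n" unfolding \<rho>_def power_divide exp_of_nat_mult ..
      finally show ?case by simp
    qed
  qed
qed

text \<open>The tail ratio with factor \<open>1 / b\<close> is used at the level
  \<open>b * tn n\<close>, where it says that the expected number of points above this level is at
  least \<open>k n / q\<close>, hence exceeds \<open>k n\<close> by a fixed factor.\<close>

lemma lower_order_statistic_concentration:
  assumes "0 < b" "b < 1"
  shows "(\<lambda>n. measure (samp n) {x\<in>space (samp n). exceedances norm {1..n} (b * tn n) x \<le> real (k n)}) \<longlonglongrightarrow> 0"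
proof -
  interpret P: prob_space PX by (rule prob_space_PX)
  have "1 < 1 / b" using assms by (simp add: less_divide_eq)
  then obtain q where q: "0 < q" "q < 1" "\<forall>\<^sub>F t in at_top. Tl (1 / b * t) \<le> q * Tl t"
    using tail_ratio_bound by blast
  have bt: "filterlim (\<lambda>n. b * tn n) at_top sequentially"
    by (rule filterlim_tendsto_pos_mult_at_top[OF tendsto_const assms(1) threshold_tendsto])
  \<comment> \<open>A point between \<open>q\<close> and 1: the lower tail needs
    \<open>z < 1\<close>, and \<open>q < z\<close> makes the rate \<open>\<rho>\<close> less than
    1.\<close>
  define z where "z = (1 + q) / 2"
  have z: "q < z" "z < 1" "0 < z" using q by (auto simp: z_def)
  define \<rho> where "\<rho> = exp ((z - 1) / q) / z"
  have "(1 - z) / z < (1 - z) / q" using z q by (intro divide_strict_left_mono) auto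
  then have "(z - 1) / q < 1 - 1 / z" using z q by (simp add: diff_divide_distrib)
  then have \<rho>: "\<rho> < 1" "0 \<le> \<rho>" unfolding \<rho>_def using exp_div_less_one[of z "(z - 1) / q"] z by auto
  show ?thesis
  proof (rule Lim_null_comparison[OF _ power_k_tendsto_0[OF \<rho>(2,1)]])
    show "\<forall>\<^sub>F n in sequentially. norm (measure (samp n) {x\<in>space (samp n). exceedances norm {1..n} (b * tn n) x \<le> real (k n)}) \<le> \<rho> ^ k n"
      using eventually_k_range eventually_compose_filterlim[OF q(3) bt]
    proof eventually_elim
      case (elim n)
      have "measure (samp n) {x\<in>space (samp n). exceedances norm {1..n} (b * tn n) x \<le> real (k n)} \<le>
          exp (real (card {1..n}) * P.tail norm (b * tn n) * (z - 1)) / z ^ k n"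
      proof (rule P.prob_exceedances_Chernoff)
        show "z ^ k n \<le> z ^ card {i\<in>{1..n}. b * tn n < norm (x i)}" if "exceedances norm {1..n} (b * tn n) x \<le> real (k n)" for x
          using that z by (intro power_decreasing) (auto simp: exceedances_card)
      qed (use z exceedances_PX_pred in auto)
      also have "\<dots> \<le> exp (real (k n) * ((z - 1) / q)) / z ^ k n"
      proof (intro divide_right_mono)
        have "real n * (real (k n) / real n) \<le> real n * (q * Tl (b * tn n))"
          using elim assms by (intro mult_left_mono) (auto simp: Tl_threshold)
        then have "real (k n) / q \<le> real n * Tl (b * tn n)" using elim q by (simp add: divide_le_eq mult_ac)
        then have "real n * Tl (b * tn n) * (z - 1) \<le> real (k n) / q * (z - 1)"
          using z by (intro mult_right_mono_neg) auto
        then show "exp (real (card {1..n}) * P.tail norm (b * tn n) * (z - 1)) \<le> exp (real (k n) * ((z - 1) / q))"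
          by (simp add: tail_PX)
      qed (use z in simp)
      also have "\<dots> = \<rho> ^ k n" unfolding \<rho>_def power_divide exp_of_nat_mult ..
      finally show ?case by simp
    qed
  qed
qed

text \<open>Near the threshold the conditional characteristic function is uniformly close to the
  limit, and the order statistic leaves this range with vanishing probability. The shares
  \<open>e / 4\<close> and twice the two \<open>e / 8\<close> stay below \<open>e\<close>.\<close>

theorem sample_phase_tendsto:
  "(\<lambda>n. \<integral>x. (\<Prod>i\<in>{1..n}. if rank norm {1..n} x i < k n then phase a n (x i) else 1) \<partial>samp n) \<longlonglongrightarrow>
     complex_of_real (exp (- lim_var a / 2))" (is "?f \<longlonglongrightarrow> ?c")
proof (rule tendstoI)
  interpret P: prob_space PX by (rule prob_space_PX)
  fix e :: real assume e: "e > 0"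
  let ?I = "{1 - \<delta>0..1 + \<delta>0}"
  have ev: "\<forall>\<^sub>F n in sequentially. \<forall>s\<in>?I. dist ((\<integral>x. phase a n x \<partial>Law (s * tn n)) ^ k n) ?c < e / 4"
    by (rule eventually_uniform_of_sequences[OF phase_power_tendsto]) (use delta0 e in auto)
  have up: "\<forall>\<^sub>F n in sequentially. measure (samp n) {x\<in>space (samp n). real (k n) \<le> exceedances norm {1..n} ((1 + \<delta>0) * tn n) x} < e / 8"
    using delta0 e by (intro order_tendstoD(2)[OF upper_order_statistic_concentration]) auto
  have lo: "\<forall>\<^sub>F n in sequentially. measure (samp n) {x\<in>space (samp n). exceedances norm {1..n} ((1 - \<delta>0) * tn n) x \<le> real (k n)} < e / 8"
    using delta0 e by (intro order_tendstoD(2)[OF lower_order_statistic_concentration]) auto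
  from ev up lo eventually_k_range show "\<forall>\<^sub>F n in sequentially. dist (?f n) ?c < e"
  proof eventually_elim
    case (elim n)
    have "norm (?f n - ?c) \<le> e / 4 + 2 * (
        measure (samp n) {x\<in>space (samp n). exceedances norm {1..n} ((1 - \<delta>0) * tn n) x \<le> real (k n)} +
        measure (samp n) {x\<in>space (samp n). real (k n) \<le> exceedances norm {1..n} ((1 + \<delta>0) * tn n) x})"
    proof (rule P.norm_integral_top_order_statistics)
      show "norm (P.tail_mean norm (phase a n) u ^ k n - ?c) \<le> e / 4" if u: "(1 - \<delta>0) * tn n \<le> u" "u \<le> (1 + \<delta>0) * tn n" for u
      proof -
        have t: "tn n > 0" using elim by simp
        have "u / tn n \<in> ?I" using u t by (simp add: le_divide_eq divide_le_eq)
        moreover have "u / tn n * tn n = u" using t by simp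
        ultimately have "dist ((\<integral>x. phase a n x \<partial>Law u) ^ k n) ?c < e / 4" using elim(1) by metis
        then show ?thesis by (simp add: tail_mean_PX dist_norm)
      qed
      show "cmod ?c \<le> 1" using lim_var_nonneg[of a] by (simp only: norm_of_real) simp
      show "measure PX {x\<in>space PX. norm x = v} = 0" for v by (rule atomless_PX)
    qed (use elim e Tl_pos in \<open>auto simp: tail_PX\<close>)
    then show ?case using elim(2,3) e by (simp add: dist_norm field_simps)
  qed
qed

end

lemma cis_sum: "cis (\<Sum>i\<in>A. f i) = (\<Prod>i\<in>A. cis (f i))"
  by (induction A rule: infinite_finite_induct) (simp_all add: cis_mult[symmetric])

text \<open>Function types carry the product topology; this reduces joint convergence over all
  dimensions to each of them.\<close>

lemma tendsto_funI:
  fixes f :: "'i \<Rightarrow> 'a \<Rightarrow> 'b::topological_space"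
  assumes "\<And>j. ((\<lambda>i. f i j) \<longlongrightarrow> l j) F"
  shows "(f \<longlongrightarrow> l) F"
proof -
  have "limitin (product_topology (\<lambda>_. euclidean) UNIV) f l F"
    unfolding limitin_componentwise using assms by (simp add: limitin_canonical_iff)
  then show ?thesis by (simp add: euclidean_product_topology limitin_canonical_iff)
qed

text \<open>Without ties the reversed sorted list is strictly decreasing, so the position of
  \<open>norm (x i)\<close> in it is the number of larger norms, that is, its rank. Positions and
  ranks both start at 0, so the entry at \<open>j\<close> has exactly \<open>j\<close> norms above
  it.\<close>

lemma emp_threshold_less_iff:
  fixes x :: "nat \<Rightarrow> real ^ 'd"
  assumes inj: "inj_on (\<lambda>i. norm (x i)) {1..n}" and j: "j < n" and i: "i \<in> {1..n}"
  shows "emp_threshold x n j < norm (x i) \<longleftrightarrow> rank norm {1..n} x i < j"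
proof -
  define xs where "xs = map (\<lambda>i. norm (x i)) [1..<Suc n]"
  define s where "s = rev (sort xs)"
  have len: "length s = n" by (simp add: s_def xs_def)
  have dist: "distinct xs" using inj unfolding xs_def by (simp add: distinct_map atLeastLessThanSuc_atLeastAtMost del: upt_Suc)
  have ss: "set s = (\<lambda>i. norm (x i)) ` {1..n}" by (simp add: s_def xs_def atLeastLessThanSuc_atLeastAtMost del: upt_Suc)
  have "sorted_wrt (<) (sort xs)" using dist by (simp add: strict_sorted_iff)
  then have "sorted_wrt (\<lambda>a b. b < a) s" by (simp add: s_def sorted_wrt_rev)
  then have dec: "s ! b < s ! a" if "a < b" "b < n" for a b
    using that len by (simp add: sorted_wrt_iff_nth_less)
  have less_iff: "s ! b < s ! a \<longleftrightarrow> a < b" if "a < n" "b < n" for a b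
    using dec[of a b] dec[of b a] that by (cases a b rule: linorder_cases) auto
  have "norm (x i) \<in> set s" using i by (simp add: ss)
  then obtain m where m: "m < n" "norm (x i) = s ! m" by (metis in_set_conv_nth len)
  have "rank norm {1..n} x i = card ((\<lambda>l. norm (x l)) ` {l\<in>{1..n}. norm (x i) < norm (x l)})"
    unfolding rank_def by (rule card_image[symmetric]) (rule inj_on_subset[OF inj], auto)
  also have "(\<lambda>l. norm (x l)) ` {l\<in>{1..n}. norm (x i) < norm (x l)} = {v\<in>set s. s ! m < v}"
    by (auto simp: ss m(2))
  also have "\<dots> = (\<lambda>l. s ! l) ` {..<m}"
  proof (intro set_eqI iffI)
    fix v assume "v \<in> {v\<in>set s. s ! m < v}"
    then obtain l where "l < n" "v = s ! l" "s ! m < s ! l" by (auto simp: in_set_conv_nth len)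
    then show "v \<in> (\<lambda>l. s ! l) ` {..<m}" using less_iff m by auto
  next
    fix v assume "v \<in> (\<lambda>l. s ! l) ` {..<m}"
    then obtain l where "l < m" "v = s ! l" by auto
    then show "v \<in> {v\<in>set s. s ! m < v}" using less_iff[of l m] m len by (auto intro!: nth_mem)
  qed
  also have "card \<dots> = m"
  proof -
    have "inj_on (\<lambda>l. s ! l) {..<m}"
    proof (rule inj_onI)
      fix a b assume "a \<in> {..<m}" "b \<in> {..<m}" "s ! a = s ! b"
      then show "a = b" using less_iff[of a b] less_iff[of b a] m by (cases a b rule: linorder_cases) auto
    qed
    then show ?thesis by (simp add: card_image)
  qed
  finally have "rank norm {1..n} x i = m" .
  moreover have "emp_threshold x n j = s ! j" by (simp add: emp_threshold_def s_def xs_def)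
  ultimately show ?thesis using less_iff[OF m(1) j] m(2) by simp
qed

lemma bounded_linear_trace_mult: "bounded_linear (\<lambda>A :: real ^ 'n ^ 'n. trace (A ** P))"
  by (rule bounded_linear_compose[OF bounded_linear_trace bounded_bilinear.bounded_linear_left[OF bounded_bilinear_matrix_mult]])

lemma trace_outer_square_mult: "trace (outer_square v ** P) = v \<bullet> (P *v v)"
  using trace_mult_outer_square[of P v] trace_mul_sym[of P "outer_square v"] by simp

lemma limit_map_minus: "limit_map A \<mu> r J (- u) = - limit_map A \<mu> r J u"
  unfolding limit_map_def Let_def sum_negf[symmetric]
  by (intro sum.cong refl)
    (simp add: bounded_bilinear.minus_left[OF bounded_bilinear_matrix_mult]
      bounded_bilinear.minus_right[OF bounded_bilinear_matrix_mult] algebra_simps)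

lemma continuous_on_limit_map: "continuous_on S (limit_map A \<mu> r J)"
  unfolding limit_map_def Let_def by (intro continuous_intros)

section \<open>From the product sample to the given random vectors\<close>

locale extremal_iid_sample = extremal_sample M X \<nu> \<omega> k \<epsilon>
  for M :: "'a measure" and X :: "'a \<Rightarrow> real ^ 'd" and \<nu> \<omega> k \<epsilon> +
  fixes Xs :: "nat \<Rightarrow> 'a \<Rightarrow> real ^ 'd"
  assumes indep: "indep_vars (\<lambda>_. borel) Xs {1..}"
    and ident: "\<forall>i\<ge>1. distr M borel (Xs i) = distr M borel X"
begin

text \<open>The empirical second moment matrix, with the exceedances selected by rank and not by
  comparison with the empirical threshold: the rank events are visibly measurable, and without ties
  the selection is the same.\<close>

definition top_mean :: "nat \<Rightarrow> (nat \<Rightarrow> real ^ 'd) \<Rightarrow> real ^ 'd ^ 'd" where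
  "top_mean n x = (1 / real (k n)) *\<^sub>R (\<Sum>i\<in>{1..n}. if rank norm {1..n} x i < k n then sq (x i) else 0)"

definition Z :: "nat \<Rightarrow> 'a \<Rightarrow> real ^ 'd ^ 'd" where
  "Z n w = sqrt (real (k n)) *\<^sub>R (top_mean n (\<lambda>i. Xs i w) - Sig (tn n))"

text \<open>One event for all sample sizes, since the mapping argument follows sequences of sample
  points along which \<open>n\<close> varies.\<close>

definition untied :: "'a \<Rightarrow> bool" where
  "untied w \<longleftrightarrow> (\<forall>n. inj_on (\<lambda>i. norm (Xs i w)) {1..n})"

lemma Xs_measurable: "i \<ge> 1 \<Longrightarrow> Xs i \<in> borel_measurable M"
  using indep by (auto simp: indep_vars_def)

text \<open>Carries results from the product space, where Fubini is available, to the variables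
  \<open>Xs\<close>.\<close>

lemma joint_law:
  assumes "n \<ge> 1"
  shows "distr M (PiM {1..n} (\<lambda>_. borel)) (\<lambda>w. \<lambda>i\<in>{1..n}. Xs i w) = samp n"
proof -
  have "indep_vars (\<lambda>_. borel) Xs {1..n}" by (rule indep_vars_subset[OF indep]) auto
  then have "distr M (PiM {1..n} (\<lambda>_. borel)) (\<lambda>w. \<lambda>i\<in>{1..n}. Xs i w) = PiM {1..n} (\<lambda>i. distr M borel (Xs i))"
    using assms Xs_measurable by (subst (asm) indep_vars_iff_distr_eq_PiM') auto
  also have "\<dots> = samp n" using ident by (intro PiM_cong) auto
  finally show ?thesis .
qed

lemma joint_measurable: "(\<lambda>w. \<lambda>i\<in>{1..n}. Xs i w) \<in> measurable M (PiM {1..n} (\<lambda>_. borel))"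
  using Xs_measurable by (intro measurable_restrict) auto

lemma sets_samp: "sets (samp n) = sets (PiM {1..n} (\<lambda>_. borel))"
  by (intro sets_PiM_cong) auto

lemma rank_restrict: "i \<in> K \<Longrightarrow> rank R K (\<lambda>i\<in>K. x i) i = rank R K x i"
  unfolding rank_def by (intro arg_cong[where f=card]) auto

lemma top_mean_restrict: "top_mean n (\<lambda>i\<in>{1..n}. x i) = top_mean n x"
  unfolding top_mean_def by (intro arg_cong2[where f="(*\<^sub>R)"] sum.cong refl) (simp add: rank_restrict del: atLeastAtMost_iff)

lemma rank_less_measurable:
  assumes i: "i \<in> {1..n}"
  shows "{x \<in> space (samp n). rank norm {1..n} x i < j} \<in> sets (samp n)"
proof -
  interpret P: prob_space PX by (rule prob_space_PX)
  have [measurable]: "(\<lambda>x. exceedances norm ({1..n} - {i}) (norm (x i)) x) \<in> borel_measurable (samp n)"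
    using P.exceedances_measurable(1)[of norm "{1..n} - {i}" "{1..n}" i] i by auto
  have "{x \<in> space (samp n). exceedances norm ({1..n} - {i}) (norm (x i)) x < real j} \<in> sets (samp n)" by measurable
  then show ?thesis by (simp add: exceedances_eq_rank)
qed

lemma component_measurable:
  assumes "f \<in> borel_measurable borel" "i \<in> {1..n}"
  shows "(\<lambda>x. f (x i)) \<in> borel_measurable (samp n)"
  by (rule measurable_compose[OF measurable_component_singleton[OF assms(2)]]) (use assms(1) in simp)

lemma top_mean_measurable: "top_mean n \<in> borel_measurable (samp n)"
  unfolding top_mean_def[abs_def]
  by (intro borel_measurable_scaleR borel_measurable_const borel_measurable_sum measurable_If
      component_measurable rank_less_measurable sq_measurable)

lemma Z_measurable: "Z n \<in> borel_measurable M"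
proof -
  have "top_mean n \<in> borel_measurable (PiM {1..n} (\<lambda>_. borel))"
    using top_mean_measurable measurable_cong_sets[OF sets_samp refl] by blast
  from measurable_compose[OF joint_measurable this]
  have [measurable]: "(\<lambda>w. top_mean n (\<lambda>i. Xs i w)) \<in> borel_measurable M" by (simp only: top_mean_restrict)
  show ?thesis unfolding Z_def[abs_def] by measurable
qed

lemma AE_untied: "AE w in M. untied w"
proof -
  interpret P: prob_space PX by (rule prob_space_PX)
  have "AE w in M. inj_on (\<lambda>i. norm (Xs i w)) {1..n}" for n
  proof (cases "n \<ge> 1")
    case True
    have "AE x in samp n. inj_on (\<lambda>i. norm (x i)) {1..n}"
    proof (rule P.AE_no_ties)
      show "measure PX {x\<in>space PX. norm x = v} = 0" for v by (rule atomless_PX)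
    qed auto
    then have "AE x in distr M (PiM {1..n} (\<lambda>_. borel)) (\<lambda>w. \<lambda>i\<in>{1..n}. Xs i w). inj_on (\<lambda>i. norm (x i)) {1..n}"
      by (simp only: joint_law[OF True])
    from AE_distrD[where P="\<lambda>x. inj_on (\<lambda>i. norm (x i)) {1..n}", OF joint_measurable[of n] this]
    have "AE w in M. inj_on (\<lambda>i. norm ((\<lambda>i\<in>{1..n}. Xs i w) i)) {1..n}" .
    moreover have "inj_on (\<lambda>i. norm ((\<lambda>i\<in>{1..n}. Xs i w) i)) {1..n} \<longleftrightarrow> inj_on (\<lambda>i. norm (Xs i w)) {1..n}" for w
      by (rule inj_on_cong) simp
    ultimately show ?thesis by (simp only:)
  qed simp
  then show ?thesis unfolding untied_def by (simp add: AE_all_countable)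
qed

text \<open>Exactly \<open>k n\<close> points have rank below \<open>k n\<close>, so the centering
  of \<open>Z\<close> can be distributed evenly over the factors.\<close>

lemma cis_Z:
  assumes "untied w" "1 \<le> k n" "k n \<le> n"
  shows "cis (a \<bullet> Z n w) = (\<Prod>i\<in>{1..n}. if rank norm {1..n} (\<lambda>i. Xs i w) i < k n then phase a n (Xs i w) else 1)"
proof -
  let ?x = "\<lambda>i. Xs i w" and ?K = "{1..n}"
  define T where "T = {i\<in>?K. rank norm ?K ?x i < k n}"
  define r where "r = sqrt (real (k n))"
  have r: "r > 0" "real (k n) = r * r" using assms by (auto simp: r_def)
  have bij: "bij_betw (rank norm ?K ?x) ?K {..<card ?K}"
    by (rule rank_bij) (use assms(1) in \<open>auto simp: untied_def\<close>)
  have "bij_betw (rank norm ?K ?x) T {..<k n}"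
  proof (rule bij_betw_subset[OF bij])
    show "rank norm ?K ?x ` T = {..<k n}"
    proof
      show "{..<k n} \<subseteq> rank norm ?K ?x ` T"
      proof
        fix m assume "m \<in> {..<k n}"
        moreover from this have "m \<in> rank norm ?K ?x ` ?K"
          using bij assms(3) by (auto simp: bij_betw_def)
        ultimately show "m \<in> rank norm ?K ?x ` T" by (auto simp: T_def)
      qed
    qed (auto simp: T_def)
  qed (auto simp: T_def)
  then have card: "card T = k n" using bij_betw_same_card by fastforce
  have "(\<Prod>i\<in>?K. if rank norm ?K ?x i < k n then phase a n (?x i) else 1) = (\<Prod>i\<in>T. phase a n (?x i))"
    unfolding T_def by (rule prod.inter_filter[symmetric]) simp
  also have "\<dots> = cis (\<Sum>i\<in>T. a \<bullet> (sq (?x i) - Sig (tn n)) / r)" by (simp add: phase_def cis_sum r_def)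
  also have "(\<Sum>i\<in>T. a \<bullet> (sq (?x i) - Sig (tn n)) / r) = ((\<Sum>i\<in>T. a \<bullet> sq (?x i)) - real (k n) * (a \<bullet> Sig (tn n))) / r"
    by (simp add: inner_diff_right sum_divide_distrib[symmetric] sum_subtractf card)
  also have "\<dots> = a \<bullet> Z n w"
  proof -
    have "top_mean n ?x = (1 / real (k n)) *\<^sub>R (\<Sum>i\<in>T. sq (?x i))"
      unfolding top_mean_def T_def by (subst sum.inter_filter) simp_all
    then have "a \<bullet> Z n w = r * ((1 / (r * r)) * (\<Sum>i\<in>T. a \<bullet> sq (?x i)) - a \<bullet> Sig (tn n))"
      unfolding Z_def r_def[symmetric] by (simp add: inner_diff_right inner_sum_right r(2))
    also have "\<dots> = ((\<Sum>i\<in>T. a \<bullet> sq (?x i)) - real (k n) * (a \<bullet> Sig (tn n))) / r"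
      unfolding r(2) using r(1) by (simp add: field_simps)
    finally show ?thesis ..
  qed
  finally show ?thesis ..
qed

lemma Z_charfun_tendsto:
  "(\<lambda>n. \<integral>z. cis (a \<bullet> z) \<partial>distr M borel (Z n)) \<longlonglongrightarrow> complex_of_real (exp (- lim_var a / 2))"
proof (rule Lim_transform_eventually[OF sample_phase_tendsto])
  from eventually_k_range show "\<forall>\<^sub>F n in sequentially.
      (\<integral>x. (\<Prod>i\<in>{1..n}. if rank norm {1..n} x i < k n then phase a n (x i) else 1) \<partial>samp n) =
      (\<integral>z. cis (a \<bullet> z) \<partial>distr M borel (Z n))"
  proof eventually_elim
    case (elim n)
    let ?f = "\<lambda>x. \<Prod>i\<in>{1..n}. if rank norm {1..n} x i < k n then phase a n (x i) else 1"
    have "?f \<in> borel_measurable (samp n)"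
      by (intro borel_measurable_prod measurable_If borel_measurable_const component_measurable
          rank_less_measurable phase_measurable)
    then have fm: "?f \<in> borel_measurable (PiM {1..n} (\<lambda>_. borel))"
      using measurable_cong_sets[OF sets_samp refl] by blast
    have fr: "?f (\<lambda>i\<in>{1..n}. Xs i w) = ?f (\<lambda>i. Xs i w)" for w
      by (intro prod.cong refl) (simp add: rank_restrict del: atLeastAtMost_iff)
    have cm: "(\<lambda>z :: real ^ 'd ^ 'd. cis (a \<bullet> z)) \<in> borel_measurable borel"
      by (intro borel_measurable_continuous_onI continuous_intros)
    have "(\<integral>x. ?f x \<partial>samp n) = (\<integral>w. ?f (\<lambda>i\<in>{1..n}. Xs i w) \<partial>M)"
    proof -
      have "n \<ge> 1" using elim by simp
      from joint_law[OF this] integral_distr[OF joint_measurable fm] show ?thesis by simp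
    qed
    also have "\<dots> = (\<integral>w. cis (a \<bullet> Z n w) \<partial>M)"
    proof (rule integral_cong_AE)
      show "(\<lambda>w. ?f (\<lambda>i\<in>{1..n}. Xs i w)) \<in> borel_measurable M" by (rule measurable_compose[OF joint_measurable fm])
      show "(\<lambda>w. cis (a \<bullet> Z n w)) \<in> borel_measurable M" by (rule measurable_compose[OF Z_measurable cm])
      show "AE w in M. ?f (\<lambda>i\<in>{1..n}. Xs i w) = cis (a \<bullet> Z n w)"
        using AE_untied
      proof eventually_elim
        case (elim w)
        show ?case unfolding fr using cis_Z[OF elim, of n a] \<open>2 \<le> n \<and> 1 \<le> k n \<and> k n < n \<and> 0 < tn n\<close> by simp
      qed
    qed
    also have "\<dots> = (\<integral>z. cis (a \<bullet> z) \<partial>distr M borel (Z n))"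
      by (rule integral_distr[symmetric, OF Z_measurable cm])
    finally show ?case .
  qed
qed

lemma lim_var_covariance:
  "lim_var a = (\<Sum>(i, j)\<in>UNIV. \<Sum>(l, m)\<in>UNIV. a $ i $ j * a $ l $ m *
     covariance (limit_law \<nu>) (\<lambda>x. scaled \<omega> x $ i * scaled \<omega> x $ j) (\<lambda>x. scaled \<omega> x $ l * scaled \<omega> x $ m))"
proof -
  obtain C where C: "\<And>x. norm (sq x) \<le> C" using ex_sq_bound by blast
  have c: "norm ((sq x $ i $ j)\<^sup>2) \<le> C\<^sup>2" for x i j
  proof -
    have "\<bar>sq x $ i $ j\<bar> \<le> C"
      by (rule order_trans[OF component_le_norm_cart order_trans[OF Finite_Cartesian_Product.norm_nth_le C]])
    from power_mono[OF this, of 2] show ?thesis by simp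
  qed
  have [measurable]: "(\<lambda>x. sq x $ i $ j) \<in> borel_measurable borel" for i j
    by (rule measurable_compose[OF sq_measurable]) (auto intro!: borel_measurable_continuous_onI continuous_intros)
  have "integrable (limit_law \<nu>) (\<lambda>x. (sq x $ i $ j)\<^sup>2)" for i j
    by (rule integrable_bounded[OF prob_space_limit_law sets_limit_law(1) _ c]) measurable
  moreover have "sq \<in> borel_measurable (limit_law \<nu>)" by simp
  ultimately have "(\<integral>x. (a \<bullet> sq x - (\<integral>y. a \<bullet> sq y \<partial>limit_law \<nu>))\<^sup>2 \<partial>limit_law \<nu>) =
    (\<Sum>(i, j)\<in>UNIV. \<Sum>(l, m)\<in>UNIV. a $ i $ j * a $ l $ m *
      covariance (limit_law \<nu>) (\<lambda>x. sq x $ i $ j) (\<lambda>x. sq x $ l $ m))"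
    by (intro variance_matrix_inner prob_space_limit_law)
  then
  show ?thesis
    unfolding lim_var_def SigInf_def inner_second_moment[OF prob_space_limit_law sets_limit_law(1)]
    by (simp add: sq_def outer_square_def)
qed

text \<open>The limit is written as the law of \<open>- U\<close>, so that the minus sign carried by
  the perturbation limit cancels when the two are composed.\<close>

theorem Z_converges_weakly:
  assumes Q: "prob_space Q" and U: "gaussian Q U" "(\<integral>w. U w \<partial>Q) = 0"
    and cov: "\<forall>i j l m. covariance Q (\<lambda>w. U w $ i $ j) (\<lambda>w. U w $ l $ m) =
           covariance (limit_law \<nu>) (\<lambda>x. scaled \<omega> x $ i * scaled \<omega> x $ j)
             (\<lambda>x. scaled \<omega> x $ l * scaled \<omega> x $ m)"
  shows "converges_weakly (\<lambda>n. distr M borel (Z n)) (distr Q borel (\<lambda>w. - U w)) sequentially"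
proof (rule levy_continuity_euclidean)
  have Um[measurable]: "U \<in> borel_measurable Q" using U(1) by (simp add: gaussian_def)
  show "prob_space (distr M borel (Z n))" for n by (rule prob_space_distr[OF Z_measurable])
  show "prob_space (distr Q borel (\<lambda>w. - U w))" by (intro prob_space.prob_space_distr Q) measurable
  fix a :: "real ^ 'd ^ 'd"
  have cm: "(\<lambda>z :: real ^ 'd ^ 'd. cis (a \<bullet> z)) \<in> borel_measurable borel"
    by (intro borel_measurable_continuous_onI continuous_intros)
  have "integrable Q (\<lambda>w. (U w $ i $ j)\<^sup>2)" for i j
    using gaussian_inner_moments(2)[OF Q U(1), of "axis i (axis j 1)"] by (simp add: inner_axis')
  from variance_matrix_inner[OF Q Um this, of a]
  have var: "(\<integral>w. (a \<bullet> U w)\<^sup>2 \<partial>Q) = lim_var a"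
    unfolding gaussian_charfun(1)[OF Q U] lim_var_covariance using cov by simp
  have "(\<integral>z. cis (a \<bullet> z) \<partial>distr Q borel (\<lambda>w. - U w)) = (\<integral>w. cis ((- a) \<bullet> U w) \<partial>Q)"
    using cm by (subst integral_distr) auto
  also have "\<dots> = complex_of_real (exp (- lim_var a / 2))"
    unfolding gaussian_charfun(2)[OF Q U] using var by simp
  finally show "(\<lambda>n. \<integral>z. cis (a \<bullet> z) \<partial>distr M borel (Z n)) \<longlonglongrightarrow> (\<integral>z. cis (a \<bullet> z) \<partial>distr Q borel (\<lambda>w. - U w))"
    using Z_charfun_tendsto by simp
qed simp_all

text \<open>The gain is linear in the second moment matrix. With the analogous formula for
  \<open>emp_gain\<close>, the optimal subspaces become trace maximizers for two matrices that
  differ by \<open>Z / sqrt k\<close>.\<close>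

lemma proj_gain_eq: "proj_gain \<omega> (Law t) V = trace (Sig t ** proj_mat V)"
proof -
  have "trace (Sig t ** proj_mat V) = (\<integral>x. trace (sq x ** proj_mat V) \<partial>Law t)"
    unfolding Sig_def second_moment_def sq_def[symmetric]
    by (rule integral_bounded_linear[symmetric, OF bounded_linear_trace_mult integrable_sq[OF prob_space_Law sets_Law(1)]])
  then show ?thesis by (simp add: proj_gain_def sq_def trace_outer_square_mult)
qed

lemma emp_gain_eq:
  assumes "untied w" "k n < n"
  shows "emp_gain \<omega> (\<lambda>i. Xs i w) n (k n) V = trace (top_mean n (\<lambda>i. Xs i w) ** proj_mat V)"
proof -
  interpret L: bounded_linear "\<lambda>A :: real ^ 'd ^ 'd. trace (A ** proj_mat V)" by (rule bounded_linear_trace_mult)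
  have "trace (top_mean n (\<lambda>i. Xs i w) ** proj_mat V) = 1 / real (k n) *
      (\<Sum>i\<in>{1..n}. trace ((if rank norm {1..n} (\<lambda>i. Xs i w) i < k n then sq (Xs i w) else 0) ** proj_mat V))"
    unfolding top_mean_def by (simp only: L.scaleR L.sum real_scaleR_def)
  also have "(\<Sum>i\<in>{1..n}. trace ((if rank norm {1..n} (\<lambda>i. Xs i w) i < k n then sq (Xs i w) else 0) ** proj_mat V)) =
      (\<Sum>i\<in>{1..n}. scaled \<omega> (Xs i w) \<bullet> (proj_mat V *v scaled \<omega> (Xs i w)) *
        of_bool (emp_threshold (\<lambda>i. Xs i w) n (k n) < norm (Xs i w)))"
  proof (rule sum.cong[OF refl])
    fix i assume i: "i \<in> {1..n}"
    have "emp_threshold (\<lambda>i. Xs i w) n (k n) < norm (Xs i w) \<longleftrightarrow> rank norm {1..n} (\<lambda>i. Xs i w) i < k n"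
      using assms i by (intro emp_threshold_less_iff) (simp_all add: untied_def)
    then show "trace ((if rank norm {1..n} (\<lambda>i. Xs i w) i < k n then sq (Xs i w) else 0) ** proj_mat V) =
      scaled \<omega> (Xs i w) \<bullet> (proj_mat V *v scaled \<omega> (Xs i w)) * of_bool (emp_threshold (\<lambda>i. Xs i w) n (k n) < norm (Xs i w))"
      using L.zero by (simp add: sq_def trace_outer_square_mult)
  qed
  finally show ?thesis by (simp only: emp_gain_def)
qed

lemma transpose_top_mean: "transpose (top_mean n x) = top_mean n x"
proof -
  interpret T: bounded_linear "transpose :: real ^ 'd ^ 'd \<Rightarrow> _" by (rule bounded_linear_transpose)
  show ?thesis
    unfolding top_mean_def T.scaleR T.sum
    by (intro arg_cong2[where f="(*\<^sub>R)"] sum.cong refl) (simp add: sq_def transpose_outer_square T.zero)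
qed

theorem projection_error_tendsto:
  assumes gap: "spectral_gap SigInf B c \<mu> r J p"
    and W: "\<And>n. n \<ge> 2 \<Longrightarrow> is_arg_max (proj_gain \<omega> (Law (tn n))) (\<lambda>V. V \<in> subspaces_of_dim p) (W n)"
    and V: "\<And>n w. n \<ge> 2 \<Longrightarrow> w \<in> space M \<Longrightarrow>
      is_arg_max (emp_gain \<omega> (\<lambda>i. Xs i w) n (k n)) (\<lambda>V. V \<in> subspaces_of_dim p) (V n w)"
    and q: "strict_mono q" and w: "\<And>i. w i \<in> space M \<and> untied (w i)"
    and z: "(\<lambda>i. Z (q i) (w i)) \<longlonglongrightarrow> z"
  shows "(\<lambda>i. sqrt (real (k (q i))) *\<^sub>R (proj_mat (V (q i) (w i)) - proj_mat (W (q i)))) \<longlonglongrightarrow>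
    - limit_map SigInf \<mu> r J z"
proof -
  interpret G: spectral_gap SigInf B c \<mu> r J p by (rule gap)
  \<comment> \<open>The shift guarantees \<open>h i \<ge> 2\<close>, the range in which
    \<open>k\<close> is admissible and the subspaces are known to be optimal; it does not affect
    limits.\<close>
  define h where "h i = q (i + 2)" for i
  have h2: "h i \<ge> 2" for i using strict_mono_imp_increasing[OF q, of "i + 2"] by (simp add: h_def)
  have kh: "1 \<le> k (h i)" "k (h i) < h i" for i using k_range h2[of i] by force+
  have hlim: "filterlim h at_top sequentially"
    unfolding h_def
    by (rule filterlim_compose[OF filterlim_subseq[OF q]]) (rule filterlim_add_const_nat_at_top)
  let ?\<kappa> = "\<lambda>i. sqrt (real (k (h i)))"
  have "(\<lambda>i. ?\<kappa> i *\<^sub>R (proj_mat (V (h i) (w (i + 2))) - proj_mat (W (h i)))) \<longlonglongrightarrow> - limit_map SigInf \<mu> r J z"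
  proof (rule G.projection_perturbation)
    show "(\<lambda>i. Sig (tn (h i))) \<longlonglongrightarrow> SigInf"
      by (rule filterlim_compose[OF Sig_tendsto filterlim_compose[OF threshold_tendsto hlim]])
    show symS: "transpose (Sig (tn (h i))) = Sig (tn (h i))" for i
      unfolding Sig_def by (rule transpose_second_moment[OF prob_space_Law sets_Law(1)])
    show "(\<lambda>i. Z (h i) (w (i + 2))) \<longlonglongrightarrow> z"
      unfolding h_def by (rule LIMSEQ_ignore_initial_segment[OF z])
    show "transpose (Z (h i) (w (i + 2))) = Z (h i) (w (i + 2))" for i
    proof -
      interpret T: bounded_linear "transpose :: real ^ 'd ^ 'd \<Rightarrow> _" by (rule bounded_linear_transpose)
      show ?thesis unfolding Z_def T.scaleR T.diff transpose_top_mean symS ..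
    qed
    show "filterlim ?\<kappa> at_top sequentially" by (rule filterlim_compose[OF sqrt_k_at_top hlim])
    show \<kappa>: "?\<kappa> i > 0" for i using kh[of i] by simp
    have gW: "proj_gain \<omega> (Law (tn (h i))) = (\<lambda>V. trace (Sig (tn (h i)) ** proj_mat V))" for i
      by (rule ext) (rule proj_gain_eq)
    show "is_arg_max (\<lambda>V. trace (Sig (tn (h i)) ** proj_mat V)) (\<lambda>V. V \<in> subspaces_of_dim p) (W (h i))" for i
      using W[OF h2[of i]] unfolding gW .
    have gV: "emp_gain \<omega> (\<lambda>j. Xs j (w (i + 2))) (h i) (k (h i)) =
        (\<lambda>V. trace ((Sig (tn (h i)) + (1 / ?\<kappa> i) *\<^sub>R Z (h i) (w (i + 2))) ** proj_mat V))" for i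
    proof (rule ext)
      fix V
      have "Sig (tn (h i)) + (1 / ?\<kappa> i) *\<^sub>R Z (h i) (w (i + 2)) = top_mean (h i) (\<lambda>j. Xs j (w (i + 2)))"
        using \<kappa>[of i] unfolding Z_def by simp
      then show "emp_gain \<omega> (\<lambda>j. Xs j (w (i + 2))) (h i) (k (h i)) V =
          trace ((Sig (tn (h i)) + (1 / ?\<kappa> i) *\<^sub>R Z (h i) (w (i + 2))) ** proj_mat V)"
        using emp_gain_eq[of "w (i + 2)" "h i" V] w[of "i + 2"] kh(2)[of i] by simp
    qed
    show "is_arg_max (\<lambda>V. trace ((Sig (tn (h i)) + (1 / ?\<kappa> i) *\<^sub>R Z (h i) (w (i + 2))) ** proj_mat V))
        (\<lambda>V. V \<in> subspaces_of_dim p) (V (h i) (w (i + 2)))" for i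
      using V[OF h2[of i], of "w (i + 2)"] w[of "i + 2"] unfolding gV by simp
  qed
  then show ?thesis
    unfolding h_def
    by (rule LIMSEQ_offset[where f="\<lambda>i. sqrt (real (k (q i))) *\<^sub>R (proj_mat (V (q i) (w i)) - proj_mat (W (q i)))"])
qed

end

section \<open>Weak limits of the projections, for each dimension and jointly\<close>

theorem corollary4p1:
  fixes M :: "'a measure" and Q :: "'b measure"
    and X :: "'a \<Rightarrow> real ^ 'd" and Xs :: "nat \<Rightarrow> 'a \<Rightarrow> real ^ 'd"
    and \<nu> :: "(real ^ 'd) measure" and \<omega> :: "real ^ 'd \<Rightarrow> real"
    and k :: "nat \<Rightarrow> nat" and U :: "'b \<Rightarrow> real ^ 'd ^ 'd"
    and lam \<mu> :: "nat \<Rightarrow> real" and N :: "nat \<Rightarrow> nat" and d_inf :: nat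
    and Vstar :: "nat \<Rightarrow> nat \<Rightarrow> (real ^ 'd) set"
    and Vhat :: "nat \<Rightarrow> nat \<Rightarrow> 'a \<Rightarrow> (real ^ 'd) set"
    and \<epsilon> :: real
  assumes "prob_space M"
    and "X \<in> borel_measurable M"
    and "regularly_varying M X \<nu>"
    and "continuous_on UNIV (cdf (distr M borel (\<lambda>w. norm (X w))))"
    \<comment> \<open>i.i.d. copies of X\<close>
    and "prob_space.indep_vars M (\<lambda>_. borel) Xs {1..}"
    and "\<forall>i\<ge>1. distr M borel (Xs i) = distr M borel X"
    \<comment> \<open>the scaling\<close>
    and "\<omega> \<in> borel_measurable borel"
    and "\<forall>x. \<omega> x > 0"
    and "bounded (range (scaled \<omega>))"
    and "converges_weakly (\<lambda>t. distr (exceedance_law M X t) borel (scaled \<omega>))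
           (distr (limit_law \<nu>) borel (scaled \<omega>)) at_top"
    \<comment> \<open>the intermediate sequence\<close>
    and "\<forall>n\<ge>2. k n \<in> {1..n - 1}"
    and "filterlim k at_top sequentially"
    and "(\<lambda>n. real (k n) / real n) \<longlonglongrightarrow> 0"
    \<comment> \<open>the Gaussian matrix\<close>
    and "prob_space Q"
    and "gaussian Q U"
    and "AE w in Q. transpose (U w) = U w"
    and "(\<integral>w. U w \<partial>Q) = 0"
    and "\<forall>i j l m. covariance Q (\<lambda>w. U w $ i $ j) (\<lambda>w. U w $ l $ m) =
           covariance (limit_law \<nu>) (\<lambda>x. scaled \<omega> x $ i * scaled \<omega> x $ j)
             (\<lambda>x. scaled \<omega> x $ l * scaled \<omega> x $ m)"
    \<comment> \<open>the eigenstructure of the limit matrix\<close>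
    and "ordered_eigenvalues (second_moment \<omega> (limit_law \<nu>)) lam"
    and "N 0 = 0" and "strict_mono_on {0..d_inf} N" and "N d_inf = CARD('d)"
    and "\<forall>i\<in>{1..d_inf}. \<forall>j\<in>{1..d_inf}. i < j \<longrightarrow> \<mu> j < \<mu> i"
    and "\<forall>j\<in>{1..d_inf}. \<forall>m. N (j - 1) < m \<and> m \<le> N j \<longrightarrow> lam m = \<mu> j"
    \<comment> \<open>the optimal subspaces, for every admissible dimension p = N J\<close>
    and "\<forall>n\<ge>2. \<forall>p \<in> N ` {1..<d_inf}.
           is_arg_max (proj_gain \<omega> (exceedance_law M X (threshold M X n (k n))))
             (\<lambda>V. V \<in> subspaces_of_dim p) (Vstar n p)"
    and "\<forall>n\<ge>2. \<forall>p \<in> N ` {1..<d_inf}. \<forall>w \<in> space M.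
           is_arg_max (emp_gain \<omega> (\<lambda>i. Xs i w) n (k n))
             (\<lambda>V. V \<in> subspaces_of_dim p) (Vhat n p w)"
    and "\<forall>n\<ge>2. \<forall>p \<in> N ` {1..<d_inf}. (\<lambda>w. proj_mat (Vhat n p w)) \<in> borel_measurable M"
    \<comment> \<open>the bias condition, the o-term being uniform in s\<close>
    and "\<epsilon> > 0"
    and "uniform_limit {1 - \<epsilon>..1 + \<epsilon>}
           (\<lambda>n s. sqrt (real (k n)) *
              onorm ((*v) (second_moment \<omega> (exceedance_law M X (s * threshold M X n (k n)))
                         - second_moment \<omega> (exceedance_law M X (threshold M X n (k n))))))
           (\<lambda>_. 0) sequentially"
  shows "(\<forall>J \<in> {1..<d_inf}.
           converges_weakly
             (\<lambda>n. distr M borel (\<lambda>w.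
                sqrt (real (k n)) *\<^sub>R (proj_mat (Vhat n (N J) w) - proj_mat (Vstar n (N J)))))
             (distr Q borel (\<lambda>w. limit_map (second_moment \<omega> (limit_law \<nu>)) \<mu> d_inf J (U w)))
             sequentially)
       \<and> converges_weakly
           (\<lambda>n. distr M borel (\<lambda>w. \<lambda>J\<in>{1..<d_inf}.
              sqrt (real (k n)) *\<^sub>R (proj_mat (Vhat n (N J) w) - proj_mat (Vstar n (N J)))))
           (distr Q borel (\<lambda>w. \<lambda>J\<in>{1..<d_inf}.
              limit_map (second_moment \<omega> (limit_law \<nu>)) \<mu> d_inf J (U w)))
           sequentially"
proof -
  let ?L = "limit_map (second_moment \<omega> (limit_law \<nu>)) \<mu> d_inf"
  let ?Y = "\<lambda>n J w. sqrt (real (k n)) *\<^sub>R (proj_mat (Vhat n (N J) w) - proj_mat (Vstar n (N J)))"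
  interpret prob_space M by fact
  interpret S: extremal_iid_sample M X \<nu> \<omega> k \<epsilon> Xs
    by unfold_locales fact+
  have Um [measurable]: "U \<in> borel_measurable Q" using \<open>gaussian Q U\<close> by (simp add: gaussian_def)
  have limit: "converges_weakly (\<lambda>n. distr M borel (S.Z n)) (distr Q borel (\<lambda>w. - U w)) sequentially"
    by (rule S.Z_converges_weakly) fact+
  have SI: "S.SigInf = second_moment \<omega> (limit_law \<nu>)" by (rule S.SigInf_def)
  have symI: "transpose S.SigInf = S.SigInf"
    unfolding SI by (rule S.transpose_second_moment[OF S.prob_space_limit_law S.sets_limit_law(1)])
  obtain B c where B: "orthonormal B" "span B = UNIV" "\<And>b. b \<in> B \<Longrightarrow> S.SigInf *v b = c b *\<^sub>R b"
    using spectral_basis[OF symI] by blast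
  note star = assms(25) and hat = assms(26) and meas = assms(27)
  have gap: "spectral_gap S.SigInf B c \<mu> d_inf J (N J)" if J: "J \<in> {1..<d_inf}" for J
  proof
    show "\<exists>j\<in>{1..d_inf}. c b = \<mu> j" if "b \<in> B" for b
      by (rule eigenbasis_multiplicities(1)[OF B(1,2) _ assms(19)[folded SI] assms(20-24) that]) (rule B(3))
    show "card {b \<in> B. \<mu> J \<le> c b} = N J" 
      by (rule eigenbasis_multiplicities(2)[OF B(1,2) _ assms(19)[folded SI] assms(20-24)]) (use J B(3) in simp_all)
  qed fact+
  have seq: "(\<lambda>i. ?Y (q i) J (w i)) \<longlonglongrightarrow> - ?L J z"
    if J: "J \<in> {1..<d_inf}" and "strict_mono q" "\<And>i. w i \<in> space M \<and> S.untied (w i)" "(\<lambda>i. S.Z (q i) (w i)) \<longlonglongrightarrow> z"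
    for J q w z
    unfolding SI[symmetric]
  proof (rule S.projection_error_tendsto[OF gap[OF that(1)] _ _ that(2-4), where W="\<lambda>n. Vstar n (N J)" and V="\<lambda>n. Vhat n (N J)"])
    show "is_arg_max (proj_gain \<omega> (exceedance_law M X (threshold M X n (k n)))) (\<lambda>V. V \<in> subspaces_of_dim (N J)) (Vstar n (N J))"
      if "2 \<le> n" for n using star that J by blast
    show "is_arg_max (emp_gain \<omega> (\<lambda>i. Xs i w) n (k n)) (\<lambda>V. V \<in> subspaces_of_dim (N J)) (Vhat n (N J) w)"
      if "2 \<le> n" "w \<in> space M" for n w using hat that J by blast
  qed
  have Ym: "?Y n J \<in> borel_measurable M" if "n \<ge> 2" "J \<in> {1..<d_inf}" for n J
  proof -
    have [measurable]: "(\<lambda>w. proj_mat (Vhat n (N J) w)) \<in> borel_measurable M" using meas that by blast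
    show ?thesis by measurable
  qed
  have prob_limit: "prob_space (distr Q borel (\<lambda>w. - U w))"
    by (rule prob_space.prob_space_distr[OF \<open>prob_space Q\<close>]) measurable
  have mZ: "\<forall>\<^sub>F n in sequentially. S.Z n \<in> borel_measurable M" using S.Z_measurable by simp
  show ?thesis
  proof (intro conjI ballI)
    fix J assume J: "J \<in> {1..<d_inf}"
    have g: "continuous_on UNIV (\<lambda>z. - ?L J z)" by (intro continuous_intros continuous_on_limit_map)
    have "converges_weakly (\<lambda>n. distr M borel (?Y n J)) (distr (distr Q borel (\<lambda>w. - U w)) borel (\<lambda>z. - ?L J z)) sequentially"
    proof (rule extended_continuous_mapping[OF \<open>prob_space M\<close> prob_limit _ mZ _ limit g S.AE_untied])
      show "\<forall>\<^sub>F n in sequentially. ?Y n J \<in> borel_measurable M"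
        using eventually_ge_at_top[of 2] by eventually_elim (rule Ym[OF _ J])
    qed (use seq[OF J] in simp_all)
    \<comment> \<open>\<open>limit_map\<close> is odd in its last argument, so the sign in front of
      it and the one in \<open>- U\<close> cancel.\<close>
    also have "distr (distr Q borel (\<lambda>w. - U w)) borel (\<lambda>z. - ?L J z) = distr Q borel (\<lambda>w. ?L J (U w))"
      using borel_measurable_continuous_onI[OF g] by (subst distr_distr) (auto simp: o_def limit_map_minus)
    finally show "converges_weakly (\<lambda>n. distr M borel (?Y n J)) (distr Q borel (\<lambda>w. ?L J (U w))) sequentially" .
  next
    \<comment> \<open>All dimensions are collected in one continuous function of the same matrix
      \<open>Z\<close>, so that joint convergence is again a single continuous mapping.\<close>
    let ?g = "\<lambda>z. \<lambda>J\<in>{1..<d_inf}. - ?L J z"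
    let ?T = "\<lambda>n w. \<lambda>J\<in>{1..<d_inf}. ?Y n J w"
    have g: "continuous_on UNIV ?g"
    proof (rule continuous_on_coordinatewise_then_product)
      \<comment> \<open>Outside the index set a restricted function takes the constant value
        \<open>undefined\<close>, so these coordinates are trivially continuous.\<close>
      show "continuous_on UNIV (\<lambda>z. ?g z J)" for J
        by (cases "J \<in> {1..<d_inf}") (auto intro!: continuous_intros continuous_on_limit_map simp del: atLeastLessThan_iff)
    qed
    have "converges_weakly (\<lambda>n. distr M borel (?T n)) (distr (distr Q borel (\<lambda>w. - U w)) borel ?g) sequentially"
    proof (rule extended_continuous_mapping[OF \<open>prob_space M\<close> prob_limit _ mZ _ limit g S.AE_untied])
      show "\<forall>\<^sub>F n in sequentially. ?T n \<in> borel_measurable M"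
        using eventually_ge_at_top[of 2]
      proof eventually_elim
        case (elim n)
        show ?case
        proof (rule measurable_coordinatewise_then_product)
          show "(\<lambda>w. ?T n w J) \<in> borel_measurable M" for J
            using Ym[OF elim, of J] by (cases "J \<in> {1..<d_inf}") (simp_all del: atLeastLessThan_iff)
        qed
      qed
      show "(\<lambda>i. ?T (q i) (w i)) \<longlonglongrightarrow> ?g z"
        if "strict_mono q" "\<And>i. w i \<in> space M \<and> S.untied (w i)" "(\<lambda>i. S.Z (q i) (w i)) \<longlonglongrightarrow> z" for q w z
      proof (rule tendsto_funI)
        show "(\<lambda>i. ?T (q i) (w i) J) \<longlonglongrightarrow> ?g z J" for J
          using seq[OF _ that, of J] by (cases "J \<in> {1..<d_inf}") (simp_all del: atLeastLessThan_iff)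
      qed
    qed simp
    also have "distr (distr Q borel (\<lambda>w. - U w)) borel ?g = distr Q borel (\<lambda>w. \<lambda>J\<in>{1..<d_inf}. ?L J (U w))"
      using borel_measurable_continuous_onI[OF g] by (subst distr_distr) (auto simp: o_def limit_map_minus)
    finally show "converges_weakly (\<lambda>n. distr M borel (?T n)) (distr Q borel (\<lambda>w. \<lambda>J\<in>{1..<d_inf}. ?L J (U w))) sequentially" .
  qed
qed

end
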